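(* For every $n\ge 1$, the map $\Psi_T$ from diagrams of $\mathfrak{sl}_n$ web-tangles to the $\mathfrak{sl}_n$ web skein module $n\mathbf{Web}$, defined by replacing locally every crossing by the following linear combination of ladders (crossing drawn with both strands oriented upward, bottom labels $k$ on the left and $l$ on the right): $$\text{positive } (k,l)\text{ crossing}\ \longmapsto\ \sum_{\substack{a,b,c\ge 0\\ a-b+c=k-l}}(-1)^{b-l}q^{-ac+b-l}\,E^{(a)}F^{(b)}E^{(c)}1_{(k,l)},$$ $$\text{negative } (k,l)\text{ crossing}\ \longmapsto\ \sum_{\substack{a,b,c\ge 0\\ a-b+c=l-k}}(-1)^{b+k}q^{ac-b+k}\,F^{(a)}E^{(b)}F^{(c)}1_{(k,l)},$$ is a Kauffman bracket for $\mathfrak{sl}_n$ webs; that is, $\Psi_T$ takes equal values on any two diagrams related by one of the moves (K1)–(K5) (listed in the context), for all admissible orientations and labels.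
   Context: Webs. An $\mathfrak{sl}_n$ web is an oriented trivalent graph embedded in the plane (or a disc), possibly with boundary endpoints and vertexless loops, with edges labelled by $\{1,\dots,n\}$, such that at each vertex the sum of incoming labels equals the sum of outgoing labels (so each vertex is a merge $k,l\to k+l$ or a split $k+l\to k,l$). Edges labelled $0$ are erased; a diagram with an edge label $<0$ or $>n$ is $0$. Quantum integers: $[k]=\frac{q^k-q^{-k}}{q-q^{-1}}$, and ${p \brack t}_q=\prod_{i=1}^{t}\frac{[p-i+1]}{[i]}$ for $p\in\mathbb Z$, $t\ge 0$. Ladder notation: for two upward edges labelled $(k,l)$ from left to right, $E^{(s)}1_{(k,l)}$ adds a rung labelled $s$ oriented from the left edge to the right edge (top labels $(k-s,l+s)$), and $F^{(s)}1_{(k,l)}$ adds a rung labelled $s$ from the right edge to the left edge (top labels $(k+s,l-s)$). Products are read right to left as bottom to top. $n\mathbf{Web}$ is the $\mathbb Z[q^{\pm1}]$-module generated by webs (possibly with boundary) up to isotopy and the following local relations, together with their mirror images and the ones with all arrows reversed (labels $0$ allowed): (W1) an edge $k+l$ splitting into $k$ and $l$ which then merge back equals ${k+l\brack l}_q$ times the edge $k+l$; (W2) an upward edge $k$ merging with an edge $l$ into an edge $k+l$, which then splits into an upward edge $k$ and an edge $l$ that turns back down to feed the merge, equals ${n-k\brack l}_q$ times the edge $k$ (in particular a circle labelled $l$ equals ${n\brack l}_q$); (W3) associativity of merging: merging $k,l,m$ into $k+l+m$ by first merging $k,l$ equals first merging $l,m$; (W4) $E^{(r)}E^{(s)}1_{(k,l)}={r+s\brack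 r}_qE^{(r+s)}1_{(k,l)}$; (W5) $F^{(r)}E^{(s)}1_{(k,l)}=\sum_{t\ge0}{k-l+r-s\brack t}_qE^{(s-t)}F^{(r-t)}1_{(k,l)}$; (W6) for two parallel oppositely oriented $n$-labelled strands, the two planar oriented reconnections of the four endpoints (saddle) are equal. Diagrams. A diagram of a web-tangle is a web drawn in the plane with, in addition, transverse double points carrying over/under information (a generic projection of a web embedded in $\mathbb R^3$, possibly with boundary). Any crossing can be rotated so that both strands point upward; it is positive if the over-strand goes from bottom left to top right, negative if the over-strand goes from bottom right to top left. Strands may carry framing marks: a mark $\pm\frac12$ on a $k$-labelled strand means multiplication by $h_k^{\pm1}$, where $h_k=(-1)^{k/2}q^{\frac{-nk+k(k-1)}{2}}$ for a fixed primitive fourth root of unity $(-1)^{1/2}$ (and a fixed $q^{1/2}$; scalars are extended accordingly when marks are present). A Kauffman bracket for $\mathfrak{sl}_n$ webs is a map from diagrams of web-tangles to $n\mathbf{Web}$, defined locally by replacing a crossing by a linear combination of smoothings, and invariant under the moves (all strands carry arbitrary admissible orientations and labels): (K1) a strand with a curl having a positive crossing followed by a curl having a negative crossing (both curls on the same side of the strand) $\leftrightarrow$ a straight strand; (K2) Reidemeister II; (K3) Reidemeister III: a strand passing under everything is moved across a crossing of two other strands (either sign of that crossing); (K4) a strand is moved across a trivalent vertex, passing entirely over, or entirely under, the edges at the vertex; (K5) a vertex with one leg at the bottom and two legs at the top, whose two top legs then cross with the leg starting on the left passing over to the right $\leftrightarrow$ the vertex without crossing (same labels at the endpoints), with framing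 mark $+\frac12$ on the bottom leg and $-\frac12$ on each top leg. *)

theory Defs
  imports Complex_Main
    "HOL-Library.Poly_Mapping"
    "HOL-Computational_Algebra.Formal_Laurent_Series"
begin

section \<open>Scalars\<close>

text \<open>
  All scalars live in the field of formal Laurent series in \<open>q\<^sup>1\<^sup>/\<^sup>2\<close> over the complex
  numbers, so that quotients of quantum integers are honest quotients. The rings that matter are
  the subrings \<open>Zq\<close>, i.e. \<open>\<int>[q, q\<^sup>-\<^sup>1]\<close>, and \<open>Zq_ext\<close>, i.e.
  \<open>\<int>[\<i>][q\<^sup>1\<^sup>/\<^sup>2, q\<^sup>-\<^sup>1\<^sup>/\<^sup>2]\<close>, the latter being used only when framing
  marks are present.
\<close>

type_synonym scalar = "complex fls"

definition sqrtq :: scalar where "sqrtq = fls_X"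

definition q :: scalar where "q = sqrtq ^ 2"

definition imag :: scalar where "imag = fls_const \<i>"

inductive_set ring_gen :: "scalar set \<Rightarrow> scalar set" for G :: "scalar set" where
  gen: "x \<in> G \<Longrightarrow> x \<in> ring_gen G"
| one: "1 \<in> ring_gen G"
| diff: "x \<in> ring_gen G \<Longrightarrow> y \<in> ring_gen G \<Longrightarrow> x - y \<in> ring_gen G"
| mult: "x \<in> ring_gen G \<Longrightarrow> y \<in> ring_gen G \<Longrightarrow> x * y \<in> ring_gen G"

definition Zq :: "scalar set" where
  "Zq = ring_gen {q, inverse q}"

definition Zq_ext :: "scalar set" where
  "Zq_ext = ring_gen {sqrtq, inverse sqrtq, imag}"

definition qint :: "int \<Rightarrow> scalar" where
  "qint k = (q powi k - q powi (- k)) / (q - inverse q)"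

definition qbinom :: "int \<Rightarrow> nat \<Rightarrow> scalar" where
  "qbinom p t = (\<Prod>i=1..t. qint (p - int i + 1) / qint (int i))"

text \<open>The factor \<open>h\<^sub>k\<close> of a framing mark \<open>1/2\<close>; the exponent of \<open>q\<close> is halved by writing
  it as an exponent of \<open>sqrtq\<close>.\<close>

definition framing :: "nat \<Rightarrow> int \<Rightarrow> scalar" where
  "framing n k = imag powi k * sqrtq powi (- int n * k + k * (k - 1))"


section \<open>Plane diagrams\<close>

text \<open>
  Diagrams in a rectangle, with endpoints on the bottom and top sides, are written as words in
  elementary pieces, composed vertically and placed side by side. Words that draw the same diagram
  up to planar isotopy are identified by \<open>isotopic\<close> below. An endpoint carries the label and the
  direction of its strand. Labels are integers, so that out-of-range labels can be written; they
  are excluded by \<open>admissible\<close>.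
\<close>

datatype strand = Up int | Dn int

fun label :: "strand \<Rightarrow> int" where
  "label (Up k) = k"
| "label (Dn k) = k"

fun opp :: "strand \<Rightarrow> strand" where
  "opp (Up k) = Dn k"
| "opp (Dn k) = Up k"

definition dual :: "strand list \<Rightarrow> strand list" where
  "dual xs = rev (map opp xs)"

text \<open>
  Pieces, read from bottom to top:
  \<^item> \<open>Cup x\<close> and \<open>Cap x\<close> are arcs with left endpoint \<open>x\<close> and right endpoint \<open>opp x\<close>;
  \<^item> \<open>Merge k l\<close> and \<open>Split k l\<close> are the vertices with all edges upward;
  \<^item> \<open>Cross s k l\<close> has both strands upward, \<open>k\<close> at the bottom left and \<open>l\<close> at the bottom
    right; the strand over is the one starting at the bottom left iff \<open>s\<close>, i.e. \<open>s\<close> says that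
    the crossing is positive;
  \<^item> \<open>Mark s x\<close> is a strand with framing mark \<open>1/2\<close> (if \<open>s\<close>) or \<open>-1/2\<close> (otherwise);
  \<^item> \<open>Comp D E\<close> is \<open>D\<close> on top of \<open>E\<close>, and \<open>Tens D E\<close> is \<open>D\<close> to the left of \<open>E\<close>.
\<close>

datatype diagram =
    Ident "strand list"
  | Cup strand
  | Cap strand
  | Merge int int
  | Split int int
  | Cross bool int int
  | Mark bool strand
  | Comp diagram diagram
  | Tens diagram diagram

primrec src :: "diagram \<Rightarrow> strand list" where
  "src (Ident xs) = xs"
| "src (Cup x) = []"
| "src (Cap x) = [x, opp x]"
| "src (Merge k l) = [Up k, Up l]"
| "src (Split k l) = [Up (k + l)]"
| "src (Cross s k l) = [Up k, Up l]"
| "src (Mark s x) = [x]"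
| "src (Comp D E) = src E"
| "src (Tens D E) = src D @ src E"

primrec tgt :: "diagram \<Rightarrow> strand list" where
  "tgt (Ident xs) = xs"
| "tgt (Cup x) = [x, opp x]"
| "tgt (Cap x) = []"
| "tgt (Merge k l) = [Up (k + l)]"
| "tgt (Split k l) = [Up k, Up l]"
| "tgt (Cross s k l) = [Up l, Up k]"
| "tgt (Mark s x) = [x]"
| "tgt (Comp D E) = tgt D"
| "tgt (Tens D E) = tgt D @ tgt E"

definition strands :: "nat \<Rightarrow> strand set" where
  "strands n = {x. 1 \<le> label x \<and> label x \<le> int n}"

primrec admissible :: "nat \<Rightarrow> diagram \<Rightarrow> bool" where
  "admissible n (Ident xs) \<longleftrightarrow> set xs \<subseteq> strands n"
| "admissible n (Cup x) \<longleftrightarrow> x \<in> strands n"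
| "admissible n (Cap x) \<longleftrightarrow> x \<in> strands n"
| "admissible n (Merge k l) \<longleftrightarrow> 1 \<le> k \<and> 1 \<le> l \<and> k + l \<le> int n"
| "admissible n (Split k l) \<longleftrightarrow> 1 \<le> k \<and> 1 \<le> l \<and> k + l \<le> int n"
| "admissible n (Cross s k l) \<longleftrightarrow> Up k \<in> strands n \<and> Up l \<in> strands n"
| "admissible n (Mark s x) \<longleftrightarrow> x \<in> strands n"
| "admissible n (Comp D E) \<longleftrightarrow> admissible n D \<and> admissible n E \<and> src D = tgt E"
| "admissible n (Tens D E) \<longleftrightarrow> admissible n D \<and> admissible n E"

primrec unmarked :: "diagram \<Rightarrow> bool" where
  "unmarked (Ident xs) \<longleftrightarrow> True"
| "unmarked (Cup x) \<longleftrightarrow> True"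
| "unmarked (Cap x) \<longleftrightarrow> True"
| "unmarked (Merge k l) \<longleftrightarrow> True"
| "unmarked (Split k l) \<longleftrightarrow> True"
| "unmarked (Cross s k l) \<longleftrightarrow> True"
| "unmarked (Mark s x) \<longleftrightarrow> False"
| "unmarked (Comp D E) \<longleftrightarrow> unmarked D \<and> unmarked E"
| "unmarked (Tens D E) \<longleftrightarrow> unmarked D \<and> unmarked E"

primrec uncrossed :: "diagram \<Rightarrow> bool" where
  "uncrossed (Ident xs) \<longleftrightarrow> True"
| "uncrossed (Cup x) \<longleftrightarrow> True"
| "uncrossed (Cap x) \<longleftrightarrow> True"
| "uncrossed (Merge k l) \<longleftrightarrow> True"
| "uncrossed (Split k l) \<longleftrightarrow> True"
| "uncrossed (Cross s k l) \<longleftrightarrow> False"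
| "uncrossed (Mark s x) \<longleftrightarrow> True"
| "uncrossed (Comp D E) \<longleftrightarrow> uncrossed D \<and> uncrossed E"
| "uncrossed (Tens D E) \<longleftrightarrow> uncrossed D \<and> uncrossed E"

definition web :: "nat \<Rightarrow> diagram \<Rightarrow> bool" where
  "web n D \<longleftrightarrow> admissible n D \<and> uncrossed D \<and> unmarked D"


section \<open>Planar isotopy\<close>

primrec cups :: "strand list \<Rightarrow> diagram" where
  "cups [] = Ident []"
| "cups (x # xs) = Comp (Tens (Ident [x]) (Tens (cups xs) (Ident [opp x]))) (Cup x)"

primrec caps :: "strand list \<Rightarrow> diagram" where
  "caps [] = Ident []"
| "caps (x # xs) = Comp (Cap x) (Tens (Ident [x]) (Tens (caps xs) (Ident [opp x])))"

text \<open>The diagram rotated by a half turn, with its endpoints pulled back into position with nested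
  arcs: \<open>rot\<close> bends the top endpoints to the right and down, \<open>rot'\<close> to the left and down. Both go
  from \<open>dual (tgt D)\<close> to \<open>dual (src D)\<close>.\<close>

definition rot :: "diagram \<Rightarrow> diagram" where
  "rot D =
     Comp (Tens (Ident (dual (src D))) (caps (tgt D)))
    (Comp (Tens (Ident (dual (src D))) (Tens D (Ident (dual (tgt D)))))
          (Tens (cups (dual (src D))) (Ident (dual (tgt D)))))"

definition rot' :: "diagram \<Rightarrow> diagram" where
  "rot' D =
     Comp (Tens (caps (dual (tgt D))) (Ident (dual (src D))))
    (Comp (Tens (Ident (dual (tgt D))) (Tens D (Ident (dual (src D)))))
          (Tens (Ident (dual (tgt D))) (cups (src D))))"

text \<open>
  Planar isotopy fixing the endpoints, through generic drawings: rectilinear isotopy (the laws of a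
  strict monoidal category), straightening of a zigzag, rotation of a piece by a full turn, and
  sliding of a mark along its strand.
\<close>

inductive isotopic :: "nat \<Rightarrow> diagram \<Rightarrow> diagram \<Rightarrow> bool" for n :: nat where
  refl: "admissible n D \<Longrightarrow> isotopic n D D"
| sym: "isotopic n D E \<Longrightarrow> isotopic n E D"
| trans: "isotopic n D E \<Longrightarrow> isotopic n E F \<Longrightarrow> isotopic n D F"
| comp: "isotopic n D D' \<Longrightarrow> isotopic n E E' \<Longrightarrow> src D = tgt E \<Longrightarrow>
    isotopic n (Comp D E) (Comp D' E')"
| tens: "isotopic n D D' \<Longrightarrow> isotopic n E E' \<Longrightarrow> isotopic n (Tens D E) (Tens D' E')"
| comp_assoc: "admissible n (Comp D (Comp E F)) \<Longrightarrow>
    isotopic n (Comp D (Comp E F)) (Comp (Comp D E) F)"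
| comp_Id_left: "admissible n D \<Longrightarrow> isotopic n (Comp (Ident (tgt D)) D) D"
| comp_Id_right: "admissible n D \<Longrightarrow> isotopic n (Comp D (Ident (src D))) D"
| tens_assoc: "admissible n (Tens D (Tens E F)) \<Longrightarrow>
    isotopic n (Tens D (Tens E F)) (Tens (Tens D E) F)"
| tens_Id_left: "admissible n D \<Longrightarrow> isotopic n (Tens (Ident []) D) D"
| tens_Id_right: "admissible n D \<Longrightarrow> isotopic n (Tens D (Ident [])) D"
| tens_Id_Id: "admissible n (Ident (xs @ ys)) \<Longrightarrow>
    isotopic n (Tens (Ident xs) (Ident ys)) (Ident (xs @ ys))"
| interchange: "admissible n (Comp D D') \<Longrightarrow> admissible n (Comp E E') \<Longrightarrow>
    isotopic n (Comp (Tens D E) (Tens D' E')) (Tens (Comp D D') (Comp E E'))"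
| zigzag_left: "x \<in> strands n \<Longrightarrow>
    isotopic n (Comp (Tens (Cap x) (Ident [x])) (Tens (Ident [x]) (Cup (opp x)))) (Ident [x])"
| zigzag_right: "x \<in> strands n \<Longrightarrow>
    isotopic n (Comp (Tens (Ident [x]) (Cap (opp x))) (Tens (Cup x) (Ident [x]))) (Ident [x])"
| rotation: "admissible n D \<Longrightarrow> isotopic n (rot D) (rot' D)"
| mark_Cup: "x \<in> strands n \<Longrightarrow>
    isotopic n (Comp (Tens (Mark s x) (Ident [opp x])) (Cup x))
               (Comp (Tens (Ident [x]) (Mark s (opp x))) (Cup x))"
| mark_Cap: "x \<in> strands n \<Longrightarrow>
    isotopic n (Comp (Cap x) (Tens (Mark s x) (Ident [opp x])))
               (Comp (Cap x) (Tens (Ident [x]) (Mark s (opp x))))"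


section \<open>Linear combinations of webs\<close>

type_synonym lin = "diagram \<Rightarrow>\<^sub>0 scalar"

definition scale :: "scalar \<Rightarrow> lin \<Rightarrow> lin" where
  "scale c x = Poly_Mapping.map (\<lambda>a. c * a) x"

text \<open>A web seen as a linear combination; it is 0 if a label is out of range (or if the boundaries
  of two composed pieces do not match).\<close>

definition vec :: "nat \<Rightarrow> diagram \<Rightarrow> lin" where
  "vec n W = (if web n W then Poly_Mapping.single W 1 else 0)"

definition linear_ext :: "(diagram \<Rightarrow> lin) \<Rightarrow> lin \<Rightarrow> lin" where
  "linear_ext f x = (\<Sum>W\<in>Poly_Mapping.keys x. scale (Poly_Mapping.lookup x W) (f W))"

definition lin_comp :: "nat \<Rightarrow> lin \<Rightarrow> lin \<Rightarrow> lin" where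
  "lin_comp n x y = linear_ext (\<lambda>V. linear_ext (\<lambda>W. vec n (Comp V W)) y) x"

definition lin_tens :: "nat \<Rightarrow> lin \<Rightarrow> lin \<Rightarrow> lin" where
  "lin_tens n x y = linear_ext (\<lambda>V. linear_ext (\<lambda>W. vec n (Tens V W)) y) x"

text \<open>The \<open>A\<close>-linear combinations of webs with given boundary.\<close>

definition lin_webs :: "scalar set \<Rightarrow> nat \<Rightarrow> strand list \<Rightarrow> strand list \<Rightarrow> lin set" where
  "lin_webs A n xs ys =
     {x. \<forall>W\<in>Poly_Mapping.keys x. web n W \<and> src W = xs \<and> tgt W = ys
          \<and> Poly_Mapping.lookup x W \<in> A}"


section \<open>Erasing edges labelled 0, and ladders\<close>

definition up :: "int \<Rightarrow> strand list" where
  "up k = (if k = 0 then [] else [Up k])"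

definition dn :: "int \<Rightarrow> strand list" where
  "dn k = (if k = 0 then [] else [Dn k])"

definition merge0 :: "int \<Rightarrow> int \<Rightarrow> diagram" where
  "merge0 k l = (if k = 0 \<or> l = 0 then Ident (up (k + l)) else Merge k l)"

definition split0 :: "int \<Rightarrow> int \<Rightarrow> diagram" where
  "split0 k l = (if k = 0 \<or> l = 0 then Ident (up (k + l)) else Split k l)"

definition cup0 :: "int \<Rightarrow> diagram" where
  "cup0 k = (if k = 0 then Ident [] else Cup (Up k))"

definition cap0 :: "int \<Rightarrow> diagram" where
  "cap0 k = (if k = 0 then Ident [] else Cap (Up k))"

text \<open>\<open>ladE s k l\<close> and \<open>ladF s k l\<close> are \<open>E\<^sup>(\<^sup>s\<^sup>)1\<^sub>(\<^sub>k\<^sub>,\<^sub>l\<^sub>)\<close> and \<open>F\<^sup>(\<^sup>s\<^sup>)1\<^sub>(\<^sub>k\<^sub>,\<^sub>l\<^sub>)\<close>.\<close>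

definition ladE :: "int \<Rightarrow> int \<Rightarrow> int \<Rightarrow> diagram" where
  "ladE s k l = Comp (Tens (Ident (up (k - s))) (merge0 s l)) (Tens (split0 (k - s) s) (Ident (up l)))"

definition ladF :: "int \<Rightarrow> int \<Rightarrow> int \<Rightarrow> diagram" where
  "ladF s k l = Comp (Tens (merge0 k s) (Ident (up (l - s)))) (Tens (Ident (up k)) (split0 s (l - s)))"


section \<open>The web module\<close>

text \<open>\<open>mirror\<close> reflects in a vertical line. \<open>flip\<close> reflects in a horizontal line and reverses all
  arrows, so that upward strands remain upward. Modulo planar rotations these two operations
  generate the same group as mirror image and arrow reversal.\<close>

primrec mirror :: "diagram \<Rightarrow> diagram" where
  "mirror (Ident xs) = Ident (rev xs)"
| "mirror (Cup x) = Cup (opp x)"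
| "mirror (Cap x) = Cap (opp x)"
| "mirror (Merge k l) = Merge l k"
| "mirror (Split k l) = Split l k"
| "mirror (Cross s k l) = Cross (\<not> s) l k"
| "mirror (Mark s x) = Mark s x"
| "mirror (Comp D E) = Comp (mirror D) (mirror E)"
| "mirror (Tens D E) = Tens (mirror E) (mirror D)"

primrec flip :: "diagram \<Rightarrow> diagram" where
  "flip (Ident xs) = Ident xs"
| "flip (Cup x) = Cap x"
| "flip (Cap x) = Cup x"
| "flip (Merge k l) = Split k l"
| "flip (Split k l) = Merge k l"
| "flip (Cross s k l) = Cross (\<not> s) l k"
| "flip (Mark s x) = Mark s x"
| "flip (Comp D E) = Comp (flip E) (flip D)"
| "flip (Tens D E) = Tens (flip D) (flip E)"

text \<open>Each relation is given as left hand side minus right hand side.\<close>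

inductive_set relations :: "nat \<Rightarrow> lin set" for n :: nat where
  digon: "vec n (Comp (merge0 (int k) (int l)) (split0 (int k) (int l)))
      - scale (qbinom (int (k + l)) l) (vec n (Ident (up (int (k + l))))) \<in> relations n"
| bubble: "vec n (Comp (Tens (Ident (up (int k))) (cap0 (int l)))
             (Comp (Tens (split0 (int k) (int l)) (Ident (dn (int l))))
             (Comp (Tens (merge0 (int k) (int l)) (Ident (dn (int l))))
                   (Tens (Ident (up (int k))) (cup0 (int l))))))
      - scale (qbinom (int n - int k) l) (vec n (Ident (up (int k)))) \<in> relations n"
| merge_assoc:
    "vec n (Comp (merge0 (int (k + l)) (int m)) (Tens (merge0 (int k) (int l)) (Ident (up (int m)))))
      - vec n (Comp (merge0 (int k) (int (l + m))) (Tens (Ident (up (int k))) (merge0 (int l) (int m))))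
      \<in> relations n"
| rungs: "vec n (Comp (ladE (int r) (int k - int s) (int l + int s)) (ladE (int s) (int k) (int l)))
      - scale (qbinom (int (r + s)) r) (vec n (ladE (int (r + s)) (int k) (int l)))
      \<in> relations n"
| square_switch:
    "vec n (Comp (ladF (int r) (int k - int s) (int l + int s)) (ladE (int s) (int k) (int l)))
      - (\<Sum>t\<le>min r s. scale (qbinom (int k - int l + int r - int s) t)
          (vec n (Comp (ladE (int s - int t) (int k + (int r - int t)) (int l - (int r - int t)))
                       (ladF (int r - int t) (int k) (int l)))))
      \<in> relations n"
| saddle: "vec n (Ident [Up (int n), Dn (int n)]) - vec n (Comp (Cup (Up (int n))) (Cap (Up (int n))))
      \<in> relations n"
| mirror: "x \<in> relations n \<Longrightarrow> linear_ext (\<lambda>W. vec n (mirror W)) x \<in> relations n"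
| flip: "x \<in> relations n \<Longrightarrow> linear_ext (\<lambda>W. vec n (flip W)) x \<in> relations n"

text \<open>\<open>null_webs A n\<close> is the \<open>A\<close>-submodule of the free module on webs by which one divides to
  obtain \<open>nWeb\<close> with scalars in \<open>A\<close>: webs are identified up to isotopy, and the relations are
  imposed inside arbitrary webs.\<close>

inductive_set null_webs :: "scalar set \<Rightarrow> nat \<Rightarrow> lin set" for A :: "scalar set" and n :: nat where
  zero: "0 \<in> null_webs A n"
| add: "x \<in> null_webs A n \<Longrightarrow> y \<in> null_webs A n \<Longrightarrow> x + y \<in> null_webs A n"
| scale: "c \<in> A \<Longrightarrow> x \<in> null_webs A n \<Longrightarrow> scale c x \<in> null_webs A n"
| isotopy: "web n V \<Longrightarrow> web n W \<Longrightarrow> isotopic n V W \<Longrightarrow> vec n V - vec n W \<in> null_webs A n"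
| relation: "x \<in> relations n \<Longrightarrow> x \<in> null_webs A n"
| above: "web n W \<Longrightarrow> x \<in> null_webs A n \<Longrightarrow> lin_comp n (vec n W) x \<in> null_webs A n"
| below: "web n W \<Longrightarrow> x \<in> null_webs A n \<Longrightarrow> lin_comp n x (vec n W) \<in> null_webs A n"
| left: "web n W \<Longrightarrow> x \<in> null_webs A n \<Longrightarrow> lin_tens n (vec n W) x \<in> null_webs A n"
| right: "web n W \<Longrightarrow> x \<in> null_webs A n \<Longrightarrow> lin_tens n x (vec n W) \<in> null_webs A n"

definition nWeb_eq :: "scalar set \<Rightarrow> nat \<Rightarrow> lin \<Rightarrow> lin \<Rightarrow> bool" where
  "nWeb_eq A n x y \<longleftrightarrow> x - y \<in> null_webs A n"


section \<open>Crossings and vertices in arbitrary position\<close>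

text \<open>\<open>X s x y\<close> is a crossing from \<open>[x, y]\<close> to \<open>[y, x]\<close>; the strand joining the bottom left to the
  top right is the one over iff \<open>s\<close>, whatever its orientation. A quarter turn exchanges the two
  diagonals, whence the negated \<open>s\<close> when exactly one strand points down.\<close>

fun X :: "bool \<Rightarrow> strand \<Rightarrow> strand \<Rightarrow> diagram" where
  "X s (Up k) (Up l) = Cross s k l"
| "X s (Up k) (Dn l) =
     Comp (Tens (Ident [Dn l, Up k]) (Cap (Up l)))
    (Comp (Tens (Ident [Dn l]) (Tens (Cross (\<not> s) l k) (Ident [Dn l])))
          (Tens (Cup (Dn l)) (Ident [Up k, Dn l])))"
| "X s (Dn k) (Up l) =
     Comp (Tens (Cap (Dn k)) (Ident [Up l, Dn k]))
    (Comp (Tens (Ident [Dn k]) (Tens (Cross (\<not> s) l k) (Ident [Dn k])))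
          (Tens (Ident [Dn k, Up l]) (Cup (Up k))))"
| "X s (Dn k) (Dn l) = rot (Cross s k l)"

text \<open>\<open>fork z x y V\<close>: \<open>V\<close> is a trivalent vertex with bottom leg \<open>z\<close>, top left leg \<open>x\<close> and top
  right leg \<open>y\<close>. The six cases are the three rotations of a split and of a merge.\<close>

inductive fork :: "strand \<Rightarrow> strand \<Rightarrow> strand \<Rightarrow> diagram \<Rightarrow> bool" where
  "fork (Up (k + l)) (Up k) (Up l) (Split k l)"
| "fork (Up k) (Up (k + l)) (Dn l)
     (Comp (Tens (Merge k l) (Ident [Dn l])) (Tens (Ident [Up k]) (Cup (Up l))))"
| "fork (Up l) (Dn k) (Up (k + l))
     (Comp (Tens (Ident [Dn k]) (Merge k l)) (Tens (Cup (Dn k)) (Ident [Up l])))"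
| "fork (Dn (k + l)) (Dn k) (Dn l) (rot (Merge l k))"
| "fork (Dn l) (Dn (k + l)) (Up k)
     (Comp (Tens (Ident [Dn (k + l), Up k]) (Cap (Up l)))
     (Comp (Tens (Ident [Dn (k + l)]) (Tens (Split k l) (Ident [Dn l])))
           (Tens (Cup (Dn (k + l))) (Ident [Dn l]))))"
| "fork (Dn k) (Up l) (Dn (k + l))
     (Comp (Tens (Cap (Dn k)) (Ident [Up l, Dn (k + l)]))
     (Comp (Tens (Ident [Dn k]) (Tens (Split k l) (Ident [Dn (k + l)])))
           (Tens (Ident [Dn k]) (Cup (Up (k + l))))))"

text \<open>Curls: a kink in the strand \<open>x\<close>, running from bottom to top, with its loop on the right or
  on the left. The crossing is positive iff \<open>s\<close>, as both its strands point in the same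
  direction.\<close>

definition curl_right :: "bool \<Rightarrow> strand \<Rightarrow> diagram" where
  "curl_right s x =
     Comp (Tens (Ident [x]) (Cap x)) (Comp (Tens (X s x x) (Ident [opp x])) (Tens (Ident [x]) (Cup x)))"

definition curl_left :: "bool \<Rightarrow> strand \<Rightarrow> diagram" where
  "curl_left s x =
     Comp (Tens (Cap (opp x)) (Ident [x]))
    (Comp (Tens (Ident [opp x]) (X s x x)) (Tens (Cup (opp x)) (Ident [x])))"


section \<open>Kauffman brackets\<close>

inductive move :: "nat \<Rightarrow> diagram \<Rightarrow> diagram \<Rightarrow> bool" for n :: nat where
  opposite_curls_right: "x \<in> strands n \<Longrightarrow>
    move n (Comp (curl_right (\<not> s) x) (curl_right s x)) (Ident [x])"
| opposite_curls_left: "x \<in> strands n \<Longrightarrow>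
    move n (Comp (curl_left (\<not> s) x) (curl_left s x)) (Ident [x])"
| reidemeister2: "x \<in> strands n \<Longrightarrow> y \<in> strands n \<Longrightarrow>
    move n (Comp (X (\<not> s) y x) (X s x y)) (Ident [x, y])"
| reidemeister3: "x \<in> strands n \<Longrightarrow> y \<in> strands n \<Longrightarrow> z \<in> strands n \<Longrightarrow>
    move n
      (Comp (Tens (X s y z) (Ident [x]))
        (Comp (Tens (Ident [y]) (X False x z)) (Tens (X False x y) (Ident [z]))))
      (Comp (Tens (Ident [z]) (X False x y))
        (Comp (Tens (X False x z) (Ident [y])) (Tens (Ident [x]) (X s y z))))"
| vertex_slide: "fork z x y V \<Longrightarrow> admissible n V \<Longrightarrow> w \<in> strands n \<Longrightarrow>
    move n
      (Comp (Tens (Ident [x]) (X s w y)) (Comp (Tens (X s w x) (Ident [y])) (Tens (Ident [w]) V)))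
      (Comp (Tens V (Ident [w])) (X s w z))"
| vertex_twist: "fork z x y V \<Longrightarrow> fork z y x V' \<Longrightarrow> admissible n V \<Longrightarrow> admissible n V' \<Longrightarrow>
    move n
      (Comp (X True x y) V)
      (Comp (Tens (Mark False y) (Mark False x)) (Comp V' (Mark True z)))"
| above: "move n D D' \<Longrightarrow> admissible n (Comp C D) \<Longrightarrow> move n (Comp C D) (Comp C D')"
| below: "move n D D' \<Longrightarrow> admissible n (Comp D C) \<Longrightarrow> move n (Comp D C) (Comp D' C)"
| left: "move n D D' \<Longrightarrow> admissible n C \<Longrightarrow> move n (Tens C D) (Tens C D')"
| right: "move n D D' \<Longrightarrow> admissible n C \<Longrightarrow> move n (Tens D C) (Tens D' C)"

text \<open>Replacing every crossing \<open>Cross s k l\<close> of a diagram by \<open>c s k l\<close>, and every mark by its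
  scalar.\<close>

primrec resolve :: "nat \<Rightarrow> (bool \<Rightarrow> int \<Rightarrow> int \<Rightarrow> lin) \<Rightarrow> diagram \<Rightarrow> lin" where
  "resolve n c (Ident xs) = vec n (Ident xs)"
| "resolve n c (Cup x) = vec n (Cup x)"
| "resolve n c (Cap x) = vec n (Cap x)"
| "resolve n c (Merge k l) = vec n (Merge k l)"
| "resolve n c (Split k l) = vec n (Split k l)"
| "resolve n c (Cross s k l) = c s k l"
| "resolve n c (Mark s x) =
     scale (if s then framing n (label x) else inverse (framing n (label x))) (vec n (Ident [x]))"
| "resolve n c (Comp D E) = lin_comp n (resolve n c D) (resolve n c E)"
| "resolve n c (Tens D E) = lin_tens n (resolve n c D) (resolve n c E)"

text \<open>Values in \<open>nWeb\<close> are given by representatives. As diagrams are words here, the invariance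
  includes planar isotopy of diagrams. When no marks are involved, the equality is required in
  the module over \<open>Zq\<close>.\<close>

definition kauffman_bracket :: "nat \<Rightarrow> (diagram \<Rightarrow> lin) \<Rightarrow> bool" where
  "kauffman_bracket n \<Phi> \<longleftrightarrow>
     (\<exists>c. (\<forall>s. \<forall>k\<in>{1..int n}. \<forall>l\<in>{1..int n}.
              c s k l \<in> lin_webs Zq n [Up k, Up l] [Up l, Up k])
          \<and> (\<forall>D. admissible n D \<longrightarrow> \<Phi> D = resolve n c D))
     \<and> (\<forall>D D'. isotopic n D D' \<or> move n D D' \<longrightarrow>
          nWeb_eq Zq_ext n (\<Phi> D) (\<Phi> D')
          \<and> (unmarked D \<and> unmarked D' \<longrightarrow> nWeb_eq Zq n (\<Phi> D) (\<Phi> D')))"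


section \<open>The map\<close>

text \<open>Rung labels above \<open>n\<close> give 0, so the sums are taken over labels up to \<open>n\<close>.\<close>

definition ladder_crossing :: "nat \<Rightarrow> bool \<Rightarrow> int \<Rightarrow> int \<Rightarrow> lin" where
  "ladder_crossing n s k l =
     (if s then
        \<Sum>(a, b, c) \<in> {(a, b, c). a \<in> {0..int n} \<and> b \<in> {0..int n} \<and> c \<in> {0..int n}
                                \<and> a - b + c = k - l}.
          scale ((- 1) powi (b - l) * q powi (- a * c + b - l))
            (vec n (Comp (ladE a (k - c + b) (l + c - b)) (Comp (ladF b (k - c) (l + c)) (ladE c k l))))
      else
        \<Sum>(a, b, c) \<in> {(a, b, c). a \<in> {0..int n} \<and> b \<in> {0..int n} \<and> c \<in> {0..int n}
                                \<and> a - b + c = l - k}.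
          scale ((- 1) powi (b + k) * q powi (a * c - b + k))
            (vec n (Comp (ladF a (k + c - b) (l - c + b)) (Comp (ladE b (k + c) (l - c)) (ladF c k l)))))"

definition Psi_T :: "nat \<Rightarrow> diagram \<Rightarrow> lin" where
  "Psi_T n = resolve n (ladder_crossing n)"

end

(* Everything is reduced to upward strands. For these the triple sum defining the crossing of strands
   k and l collapses to the sum of (-v)^j P_j, where v is 1/q or q and P_j is the ladder that keeps a
   part j of the strand k on the left. Three identities between quantum binomials then show that
   crossings are invertible, that a strand can be moved across a merge, and that twisting a split
   multiplies it by a power of v. Crossings of antiparallel strands are invertible because a downward
   strand l next to an upward strand n is isomorphic to an upward strand n - l. Hence a strand can be
   moved across every web; this is (K3) and (K4). The same naturality reduces curls and twisted
   vertices of all orientations to the closed curl on one upward strand, which is evaluated by the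
   bubble relation and a quantum Vandermonde identity. *)

theory Submission
  imports Defs
begin


section \<open>Quantum binomials as elements of the ring of Laurent polynomials\<close>

text \<open>The delicate point is the antiparallel crossing. It is defined by bending a parallel
  crossing, for \<open>Up\<close>/\<open>Dn\<close> with one pair of arcs and for
  \<open>Dn\<close>/\<open>Up\<close> with the other. The zigzag identities make each of the two
  compatible with half of the arcs only; they do not make them inverse to each other. The missing
  inverse comes from (W6): a strand labelled n is invertible, so it can be placed next to a crossing
  and cancelled again, and beside it a downward strand behaves like an upward one, for which (W4)
  and (W5) are available. The square switch is also the origin of the binomial identities: it
  expands a product of ladders in a fixed family and turns the required equation into one between
  coefficients. Quantum binomials are unchanged when q and 1/q are exchanged, so a sign s with v =
  q^s serves both crossings at once. Marks bring in square roots, although unmarked diagrams must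
  agree over Laurent polynomials in q. Hence webs are computed over \<open>Zq\<close> and marks are
  collected in a separate factor; at a vertex the half powers cancel.\<close>

lemma q_nonzero [simp]: "q \<noteq> 0"
  by (simp add: q_def sqrtq_def)

text \<open>q is the square of the series variable, so q^m has subdegree 2m. Thus q is not a root of
  unity and the denominators in \<open>qbinom\<close> are invertible.\<close>

lemma q_power_neq_1: "m \<ge> 1 \<Longrightarrow> q ^ m \<noteq> 1"
proof
  assume "m \<ge> 1" "q ^ m = 1"
  then have "fls_subdegree ((fls_X :: scalar) ^ (2 * m)) = fls_subdegree (1 :: scalar)"
    by (simp add: q_def sqrtq_def power_mult)
  moreover have "fls_subdegree ((fls_X :: scalar) ^ (2 * m)) = int (2 * m)"
    by (simp add: fls_subdegree_pow)
  ultimately show False using \<open>m \<ge> 1\<close> by simp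
qed

lemma qint_nonzero: "m \<ge> 1 \<Longrightarrow> qint (int m) \<noteq> 0"
proof -
  assume m: "m \<ge> 1"
  have "q powi int m \<noteq> q powi - int m"
  proof
    assume "q powi int m = q powi - int m"
    then have "q ^ m * q ^ m = 1"
      by (simp add: power_int_minus field_simps)
    then have "q ^ (2 * m) = 1" by (simp add: mult_2 power_add)
    then show False using q_power_neq_1[of "2 * m"] m by simp
  qed
  moreover have "q \<noteq> inverse q"
  proof
    assume "q = inverse q"
    then have "q ^ 2 = 1" by (metis q_nonzero left_inverse power2_eq_square)
    then show False using q_power_neq_1[of 2] by simp
  qed
  ultimately show ?thesis by (simp add: qint_def)
qed

section \<open>Pascal's rule for quantum binomials\<close>

lemma qbinom_0 [simp]: "qbinom p 0 = 1"
  by (simp add: qbinom_def)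

lemma qbinom_Suc: "qbinom p (Suc t) = qbinom p t * (qint (p - int t) / qint (int (Suc t)))"
  by (simp add: qbinom_def)

lemma qbinom_Suc': "qbinom (p + 1) (Suc t) = qint (p + 1) / qint (int (Suc t)) * qbinom p t"
proof -
  have "(\<Prod>i=1..Suc t. qint (p + 1 - int i + 1)) = qint (p + 1) * (\<Prod>i=1..t. qint (p - int i + 1))"
    by (simp add: prod.atLeast_Suc_atMost prod.shift_bounds_cl_Suc_ivl del: prod.cl_ivl_Suc)
       (simp add: algebra_simps)
  then show ?thesis
    by (simp add: qbinom_def prod_dividef del: of_nat_Suc)
qed

text \<open>Quantum integers are invariant under exchange of q and 1/q, so the addition rule has two
  forms. The sign s keeps both available and later distinguishes the two crossings.\<close>

lemma qint_add: "s = 1 \<or> s = - 1 \<Longrightarrow>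
  qint (a + b) = q powi (s * b) * qint a + q powi (- s * a) * qint b"
  unfolding qint_def times_divide_eq_right add_divide_distrib[symmetric]
  by (rule arg_cong[where f = "\<lambda>x. x / (q - inverse q)"])
     (auto simp: right_diff_distrib power_int_add[symmetric] algebra_simps minus_diff_commute[of b a])

text \<open>Comes from [p + 1] = [(p - t) + (t + 1)].\<close>

lemma qbinom_pascal:
  assumes "s = 1 \<or> s = - 1"
  shows "qbinom (p + 1) (Suc t) =
    q powi (s * int (Suc t)) * qbinom p (Suc t) + q powi (s * (int t - p)) * qbinom p t"
proof -
  have "qint (p + 1) = q powi (s * int (Suc t)) * qint (p - int t) + q powi (s * (int t - p)) * qint (int (Suc t))"
    using qint_add[OF assms, of "p - int t" "int (Suc t)"] by (simp add: algebra_simps)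
  then show ?thesis
    using qint_nonzero[of "Suc t"]
    by (simp add: qbinom_Suc' qbinom_Suc[of p] add_divide_distrib distrib_right distrib_left del: of_nat_Suc)
qed

section \<open>The ring of Laurent polynomials in q\<close>

lemma Zq_1: "1 \<in> Zq" and Zq_diff: "x \<in> Zq \<Longrightarrow> y \<in> Zq \<Longrightarrow> x - y \<in> Zq"
  and Zq_mult: "x \<in> Zq \<Longrightarrow> y \<in> Zq \<Longrightarrow> x * y \<in> Zq"
  by (simp_all add: Zq_def ring_gen.intros)

lemma Zq_0: "0 \<in> Zq"
  using Zq_diff[OF Zq_1 Zq_1] by simp

lemma Zq_minus: "x \<in> Zq \<Longrightarrow> - x \<in> Zq"
  using Zq_diff[OF Zq_0, of x] by simp

lemma Zq_add: "x \<in> Zq \<Longrightarrow> y \<in> Zq \<Longrightarrow> x + y \<in> Zq"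
  using Zq_diff[OF _ Zq_minus, of x y] by simp

lemma Zq_q_powi: "q powi a \<in> Zq"
proof -
  have gen: "q \<in> Zq" "inverse q \<in> Zq" by (auto simp: Zq_def intro: ring_gen.gen)
  have pow: "x ^ m \<in> Zq" if "x \<in> Zq" for x m
    using that by (induction m) (auto intro: Zq_1 Zq_mult)
  show ?thesis by (auto simp: power_int_def intro: pow gen)
qed

lemma Zq_subset_Zq_ext: "Zq \<subseteq> Zq_ext"
proof
  fix x assume "x \<in> Zq"
  then have "x \<in> ring_gen {q, inverse q}" by (simp add: Zq_def)
  then show "x \<in> Zq_ext"
    unfolding Zq_ext_def
    by induction (auto simp: q_def power2_eq_square inverse_mult_distrib intro!: ring_gen.intros(2-4) intro: ring_gen.gen)
qed

lemma qbinom_0_Suc: "qbinom 0 (Suc t) = 0"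
  by (induction t) (simp_all only: qbinom_Suc, simp_all add: qint_def)

text \<open>Pascal's rule propagates integrality from p = 0 in both directions: upwards directly,
  downwards because the coefficient of the binomial with the smaller upper entry is a power of q and
  hence a unit.\<close>

lemma Zq_qbinom: "qbinom p t \<in> Zq"
proof (induction t arbitrary: p)
  case (Suc t)
  show ?case
  proof (induction p rule: int_induct[where k = 0])
    case base then show ?case by (simp add: qbinom_0_Suc Zq_0)
  next
    case (step1 i)
    then show ?case using qbinom_pascal[of 1 i t] by (auto intro!: Zq_add Zq_mult Zq_q_powi Suc)
  next
    case (step2 i)
    have "qbinom i (Suc t) = q powi (int (Suc t)) * qbinom (i - 1) (Suc t) + q powi (int t - (i - 1)) * qbinom (i - 1) t"
      using qbinom_pascal[of 1 "i - 1" t] by simp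
    then have "qbinom (i - 1) (Suc t) =
       q powi (- int (Suc t)) * (qbinom i (Suc t) - q powi (int t - (i - 1)) * qbinom (i - 1) t)"
      by (simp add: power_int_add[symmetric] mult.assoc[symmetric])
    then show ?case using step2 by (simp only:) (intro Zq_mult Zq_diff Zq_q_powi Suc)
  qed
qed (simp add: Zq_1)

text \<open>The coefficient ring is made a type so that ring simplification and sums work without
  membership conditions, now that the binomials are known to lie in it.\<close>

typedef zq = Zq
  using Zq_0 by blast

setup_lifting type_definition_zq

instantiation zq :: comm_ring_1
begin
lift_definition zero_zq :: zq is 0 by (rule Zq_0)
lift_definition one_zq :: zq is 1 by (rule Zq_1)
lift_definition plus_zq :: "zq \<Rightarrow> zq \<Rightarrow> zq" is "(+)" by (rule Zq_add)
lift_definition minus_zq :: "zq \<Rightarrow> zq \<Rightarrow> zq" is "(-)" by (rule Zq_diff)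
lift_definition uminus_zq :: "zq \<Rightarrow> zq" is "uminus" by (rule Zq_minus)
lift_definition times_zq :: "zq \<Rightarrow> zq \<Rightarrow> zq" is "(*)" by (rule Zq_mult)
instance by standard (transfer; simp add: algebra_simps)+
end

lift_definition qp :: "int \<Rightarrow> zq" is "\<lambda>a. q powi a" by (rule Zq_q_powi)

lift_definition qbz :: "int \<Rightarrow> nat \<Rightarrow> zq" is qbinom by (rule Zq_qbinom)

text \<open>Integer lower entries, with value 0 when negative, allow sums to be reindexed without
  watching their bounds.\<close>

definition qb :: "int \<Rightarrow> int \<Rightarrow> zq" where
  "qb p t = (if t < 0 then 0 else qbz p (nat t))"

definition par :: "int \<Rightarrow> zq" where
  "par j = (if even j then 1 else - 1)"

text \<open>The power (-v)^j of the overview, with v = q^s.\<close>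

definition mv :: "int \<Rightarrow> int \<Rightarrow> zq" where
  "mv s j = par j * qp (s * j)"

lemma qp_0 [simp]: "qp 0 = 1" by transfer simp
lemma qp_add: "qp (a + b) = qp a * qp b" by transfer (simp add: power_int_add)
lemma qp_mult: "qp a * qp b = qp (a + b)" by (simp add: qp_add)
lemma qp_mult': "qp a * (qp b * c) = qp (a + b) * c" by (simp add: qp_add mult.assoc)

lemma par_0 [simp]: "par 0 = 1" by (simp add: par_def)
lemma par_mult: "par a * par b = par (a + b)" by (simp add: par_def)
lemma par_cong: "even (a - b) \<Longrightarrow> par a = par b" by (auto simp: par_def)
lemma par_square [simp]: "par a * par a = 1" by (simp add: par_def)
lemma par_add: "par (a + b) = par a * par b" by (simp add: par_def)
lemma par_minus [simp]: "par (- a) = par a" by (simp add: par_def)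
lemma par_diff: "par (a - b) = par a * par b" by (simp add: par_def)
lemma par_1 [simp]: "par 1 = - 1" by (simp add: par_def)

lemma mv_0 [simp]: "mv s 0 = 1" by (simp add: mv_def)

lemma qb_neg [simp]: "t < 0 \<Longrightarrow> qb p t = 0" by (simp add: qb_def)
lemma qb_0 [simp]: "qb p 0 = 1" by (simp add: qb_def) (transfer, simp)

lemma qb_pascal:
  assumes s: "s = 1 \<or> s = - 1"
  shows "qb (p + 1) t = qp (s * t) * qb p t + qp (s * (t - 1 - p)) * qb p (t - 1)"
proof (cases "t \<le> 0")
  case True then show ?thesis by (cases "t = 0") simp_all
next
  case False
  then obtain u where u: "t = int (Suc u)" using that[of "nat (t - 1)"] by simp
  have "qbz (p + 1) (Suc u) = qp (s * int (Suc u)) * qbz p (Suc u) + qp (s * (int u - p)) * qbz p u"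
    using assms by transfer (rule qbinom_pascal)
  then show ?thesis by (simp add: qb_def u nat_add_distrib Suc_nat_eq_nat_zadd1)
qed

lemma qb_0_left: "t \<noteq> 0 \<Longrightarrow> qb 0 t = 0"
proof (cases "t < 0")
  case False
  moreover assume "t \<noteq> 0"
  ultimately obtain u where u: "nat t = Suc u" by (metis gr0_conv_Suc linorder_neqE_linordered_idom zero_less_nat_eq)
  have "qbz 0 (Suc u) = 0" by transfer (rule qbinom_0_Suc)
  with False u show ?thesis by (simp add: qb_def)
qed simp

lemma qb_zero: "0 \<le> p \<Longrightarrow> p < t \<Longrightarrow> qb p t = 0"
proof (induction p arbitrary: t rule: int_ge_induct)
  case (step i)
  then show ?case using qb_pascal[of 1 i t] by simp
qed (simp add: qb_0_left)

lemma qb_self: "0 \<le> p \<Longrightarrow> qb p p = 1"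
proof (induction p rule: int_ge_induct)
  case (step i)
  then show ?case using qb_pascal[of 1 i "i + 1"] by (simp add: qb_zero)
qed simp

text \<open>Pascal's rule with sign 1 on the left and with sign -1 on the right produces the same
  two terms.\<close>

lemma qb_sym: "0 \<le> p \<Longrightarrow> qb p (p - t) = qb p t"
proof (induction p arbitrary: t rule: int_ge_induct)
  case base then show ?case by (cases "t = 0") (simp_all add: qb_0_left)
next
  case (step i)
  have "i + 1 - t = i - (t - 1)" "i - (t - 1) - 1 = i - t" by simp_all
  then show ?case
    using qb_pascal[of 1 i "i + 1 - t"] qb_pascal[of "-1" i t] step.IH[of t] step.IH[of "t - 1"]
    by (simp add: algebra_simps)
qed

lemma qb_diff:
  assumes s: "s = 1 \<or> s = - 1"
  shows "qb m i - qp (s * i) * qb (m + 1) i = - qp (s * (m + 1)) * qb m (i - 1)"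
proof -
  have "qb (m + 1) i = qp ((-s) * i) * qb m i + qp ((-s) * (i - 1 - m)) * qb m (i - 1)"
    using s by (intro qb_pascal) auto
  then have "qp (s * i) * qb (m + 1) i = qb m i + qp (s * (m + 1)) * qb m (i - 1)"
    by (simp add: distrib_left qp_mult') (simp add: algebra_simps)
  then show ?thesis by simp
qed

section \<open>Alternating sums of quantum binomials\<close>

lemma sum_int_last: "0 \<le> (c::int) \<Longrightarrow> (\<Sum>t\<in>{0..c + 1}. f t) = (\<Sum>t\<in>{0..c}. f t) + (f (c + 1) :: 'a :: comm_monoid_add)"
proof -
  assume "0 \<le> c"
  then have "{0..c + 1} = insert (c + 1) {0..c}" by auto
  then show ?thesis by (simp add: add.commute)
qed

lemma sum_int_first: "0 \<le> (c::int) \<Longrightarrow> (\<Sum>t\<in>{0..c + 1}. f t) = f 0 + (\<Sum>t\<in>{0..c}. f (t + 1) :: 'a :: comm_monoid_add)"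
proof -
  assume "0 \<le> c"
  then have "{0..c + 1} = insert 0 {1..c + 1}" by auto
  moreover have "(\<Sum>t\<in>{1..c + 1}. f t) = (\<Sum>t\<in>{0..c}. f (t + 1))"
    by (rule sum.reindex_bij_witness[of _ "\<lambda>t. t + 1" "\<lambda>t. t - 1"]) auto
  ultimately show ?thesis by simp
qed

text \<open>Summation by parts along Pascal's rule.\<close>

lemma sum_qb_step:
  assumes s: "s = 1 \<or> s = - 1" and c: "0 \<le> c"
  shows "(\<Sum>t\<in>{0..c + 1}. f t * qb (c + 1) t) =
    (\<Sum>t\<in>{0..c}. (qp (s * t) * f t + qp (s * (t - c)) * f (t + 1)) * qb c t)"
proof -
  have "(\<Sum>t\<in>{0..c + 1}. f t * qb (c + 1) t) =
     (\<Sum>t\<in>{0..c + 1}. f t * qp (s * t) * qb c t) + (\<Sum>t\<in>{0..c + 1}. f t * qp (s * (t - 1 - c)) * qb c (t - 1))"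
    by (simp add: qb_pascal[OF s] distrib_left sum.distrib mult.assoc)
  also have "\<dots> = (\<Sum>t\<in>{0..c}. f t * qp (s * t) * qb c t) + (\<Sum>t\<in>{0..c}. f (t + 1) * qp (s * (t - c)) * qb c t)"
    using c by (subst sum_int_last, simp, subst sum_int_first, simp) (simp add: qb_zero)
  also have "\<dots> = (\<Sum>t\<in>{0..c}. (qp (s * t) * f t + qp (s * (t - c)) * f (t + 1)) * qb c t)"
    by (simp add: sum.distrib algebra_simps)
  finally show ?thesis .
qed

text \<open>The quantum binomial theorem at a zero of the product. The step from c to c + 1
  multiplies the sum by 1 - q^(2sc), which vanishes at c = 0, the only place where the previous sum
  is nonzero.\<close>

lemma qb_sum_alternating:
  assumes s: "s = 1 \<or> s = - 1" and "0 \<le> c"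
  shows "(\<Sum>t\<in>{0..c}. par t * qp (s * (t * (c - 1))) * qb c t) = (if c = 0 then 1 else 0)"
  using assms(2)
proof (induction c rule: int_ge_induct)
  case (step c)
  have "(\<Sum>t\<in>{0..c + 1}. par t * qp (s * (t * c)) * qb (c + 1) t) =
    (\<Sum>t\<in>{0..c}. (qp ((-s) * t) * (par t * qp (s * (t * c))) + qp ((-s) * (t - c)) * (par (t + 1) * qp (s * ((t + 1) * c)))) * qb c t)"
    using s step.hyps by (intro sum_qb_step) auto
  also have "\<dots> = (\<Sum>t\<in>{0..c}. (1 - qp (s * (2 * c))) * (par t * qp (s * (t * (c - 1))) * qb c t))"
  proof (intro sum.cong HOL.refl)
    fix t
    have "qp ((-s) * t) * qp (s * (t * c)) = qp (s * (t * (c - 1)))"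
      and "qp ((-s) * (t - c)) * qp (s * ((t + 1) * c)) = qp (s * (2 * c)) * qp (s * (t * (c - 1)))"
      by (simp_all add: qp_mult algebra_simps)
    then show "(qp ((-s) * t) * (par t * qp (s * (t * c))) + qp ((-s) * (t - c)) * (par (t + 1) * qp (s * ((t + 1) * c)))) * qb c t
      = (1 - qp (s * (2 * c))) * (par t * qp (s * (t * (c - 1))) * qb c t)"
      by (simp add: par_add mult.left_commute[of "qp _" "par _"] left_diff_distrib right_diff_distrib mult_ac)
  qed
  also have "\<dots> = 0"
    using step.IH by (simp flip: sum_distrib_left)
  finally show ?case using step.hyps by simp
qed simp

text \<open>A form of the quantum Vandermonde identity: by \<open>qb_diff\<close> each step
  contributes one factor -q^(s(m + 1)). It is used for the inverse crossing, for the twisted split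
  and for the curl.\<close>

lemma qb_sum_shifted:
  assumes s: "s = 1 \<or> s = - 1" and "0 \<le> i"
  shows "(\<Sum>t\<in>{0..i}. mv s t * qb (m + t) i * qb i t) = par i * qp (s * (i * (m + 1)))"
  using assms(2)
proof (induction i rule: int_ge_induct)
  case (step i)
  have "(\<Sum>t\<in>{0..i + 1}. mv s t * qb (m + t) (i + 1) * qb (i + 1) t) =
    (\<Sum>t\<in>{0..i}. (qp ((-s) * t) * (mv s t * qb (m + t) (i + 1)) + qp ((-s) * (t - i)) * (mv s (t + 1) * qb (m + (t + 1)) (i + 1))) * qb i t)"
    using s step.hyps by (intro sum_qb_step) auto
  also have "\<dots> = (\<Sum>t\<in>{0..i}. - qp (s * (m + 1)) * (mv s t * qb (m + t) i * qb i t))"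
  proof (rule sum.cong[OF HOL.refl])
    fix t
    have *: "qp ((-s) * t) * (mv s t * qb (m + t) (i + 1)) + qp ((-s) * (t - i)) * (mv s (t + 1) * qb (m + (t + 1)) (i + 1))
      = par t * (qb (m + t) (i + 1) - qp (s * (i + 1)) * qb (m + t + 1) (i + 1))"
      by (simp add: mv_def par_add mult.left_commute[of "qp _" "par _"] qp_mult qp_mult' algebra_simps)
    have **: "qb (m + t) (i + 1) - qp (s * (i + 1)) * qb (m + t + 1) (i + 1) = - qp (s * (m + t + 1)) * qb (m + t) i"
      by (simp add: qb_diff[OF s])
    show "(qp ((-s) * t) * (mv s t * qb (m + t) (i + 1)) + qp ((-s) * (t - i)) * (mv s (t + 1) * qb (m + (t + 1)) (i + 1))) * qb i t
      = - qp (s * (m + 1)) * (mv s t * qb (m + t) i * qb i t)"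
    proof -
      have "qp (s * (m + t + 1)) = qp (s * (m + 1)) * qp (s * t)" by (simp add: qp_mult algebra_simps)
      with * ** show ?thesis by (simp add: mv_def mult_ac)
    qed
  qed
  also have "\<dots> = - qp (s * (m + 1)) * (par i * qp (s * (i * (m + 1))))"
    by (simp only: step.IH flip: sum_distrib_left)
  also have "\<dots> = par (i + 1) * qp (s * ((i + 1) * (m + 1)))"
    by (simp add: par_add qp_mult mult.left_commute[of "qp _" "par _"] algebra_simps)
  finally show ?case .
qed simp

text \<open>As a function of t, a binomial with upper entry m + t and lower entry i - 1 behaves like
  a polynomial of degree i - 1, and the i-th alternating difference kills it. The induction lowers
  both numbers by one at the cost of a unit.\<close>

lemma qb_sum_vanishing:
  assumes "1 \<le> i"
  shows "(\<Sum>t\<in>{0..i}. par t * qb (m + t) (i - 1) * qb i t) = 0"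
  using assms
proof (induction i rule: int_ge_induct)
  case base
  have "{0..1::int} = {0, 1}" by auto
  then show ?case using qb_self[of 1] by simp
next
  case (step i)
  have "(\<Sum>t\<in>{0..i + 1}. par t * qb (m + t) i * qb (i + 1) t) =
    (\<Sum>t\<in>{0..i}. (qp (1 * t) * (par t * qb (m + t) i) + qp (1 * (t - i)) * (par (t + 1) * qb (m + (t + 1)) i)) * qb i t)"
    using step.hyps by (intro sum_qb_step) auto
  also have "\<dots> = (\<Sum>t\<in>{0..i}. - qp (- m - 1) * (par t * qb (m + t) (i - 1) * qb i t))"
  proof (intro sum.cong HOL.refl)
    fix t
    have "qp (1 * t) * (par t * qb (m + t) i) + qp (1 * (t - i)) * (par (t + 1) * qb (m + (t + 1)) i)
      = par t * qp t * (qb (m + t) i - qp ((-1) * i) * qb (m + t + 1) i)"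
      by (simp add: par_add mult.left_commute[of "qp _" "par _"] qp_mult qp_mult' algebra_simps)
    also have "\<dots> = par t * qp t * (- qp ((-1) * (m + t + 1)) * qb (m + t) (i - 1))"
      by (subst qb_diff) simp_all
    also have "\<dots> = - qp (- m - 1) * (par t * qb (m + t) (i - 1))"
    proof -
      have "qp t * qp ((-1) * (m + t + 1)) = qp (- m - 1)" by (simp add: qp_mult minus_diff_commute[of 1])
      then have "qp t * qp ((-1) * (m + t + 1)) * (par t * qb (m + t) (i - 1)) = qp (- m - 1) * (par t * qb (m + t) (i - 1))"
        by (rule arg_cong)
      then show ?thesis by (simp add: mult_ac del: mult_minus1)
    qed
    finally show "(qp (1 * t) * (par t * qb (m + t) i) + qp (1 * (t - i)) * (par (t + 1) * qb (m + (t + 1)) i)) * qb i t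
      = - qp (- m - 1) * (par t * qb (m + t) (i - 1) * qb i t)"
      by (simp add: mult.assoc)
  qed
  also have "\<dots> = 0" by (simp only: step.IH mult_zero_right flip: sum_distrib_left)
  finally show ?case by simp
qed


section \<open>Linear extension\<close>

lemma lookup_scale [simp]: "Poly_Mapping.lookup (scale c x) W = c * Poly_Mapping.lookup x W"
  by (cases "Poly_Mapping.lookup x W = 0") (simp_all add: scale_def Poly_Mapping.map.rep_eq when_def)

lemma scale_add: "scale c (x + y) = scale c x + scale c y"
  by (rule poly_mapping_eqI) (simp add: lookup_add distrib_left)

lemma scale_diff: "scale c (x - y) = scale c x - scale c y"
  by (rule poly_mapping_eqI) (simp add: lookup_minus right_diff_distrib)

lemma scale_add_left: "scale (c + d) x = scale c x + scale d x"
  by (rule poly_mapping_eqI) (simp add: lookup_add distrib_right)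

lemma scale_scale [simp]: "scale c (scale d x) = scale (c * d) x"
  by (rule poly_mapping_eqI) simp

lemma scale_1 [simp]: "scale 1 x = x"
  by (rule poly_mapping_eqI) simp

lemma scale_0 [simp]: "scale c 0 = 0" and scale_0_left [simp]: "scale 0 x = 0"
  by (rule poly_mapping_eqI, simp)+

lemma scale_minus_1: "scale (- 1) x = - x"
  by (rule poly_mapping_eqI) simp

lemma scale_sum: "scale c (\<Sum>i\<in>S. f i) = (\<Sum>i\<in>S. scale c (f i))"
  by (induction S rule: infinite_finite_induct) (simp_all add: scale_add)

lemma linear_ext_superset:
  assumes "finite S" "Poly_Mapping.keys x \<subseteq> S"
  shows "linear_ext f x = (\<Sum>W\<in>S. scale (Poly_Mapping.lookup x W) (f W))"
  unfolding linear_ext_def using assms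
  by (intro sum.mono_neutral_left) (auto simp: in_keys_iff)

lemma linear_ext_add: "linear_ext f (x + y) = linear_ext f x + linear_ext f y"
proof -
  let ?S = "Poly_Mapping.keys x \<union> Poly_Mapping.keys y"
  have "Poly_Mapping.keys (x + y) \<subseteq> ?S" by (rule keys_add)
  then show ?thesis
    by (simp add: linear_ext_superset[of ?S] lookup_add scale_add_left sum.distrib)
qed

lemma linear_ext_scale: "linear_ext f (scale c x) = scale c (linear_ext f x)"
proof -
  have "Poly_Mapping.keys (scale c x) \<subseteq> Poly_Mapping.keys x" by (auto simp: in_keys_iff)
  then show ?thesis
    by (simp add: linear_ext_superset[of "Poly_Mapping.keys x"] scale_sum)
qed

lemma linear_ext_0 [simp]: "linear_ext f 0 = 0"
  by (simp add: linear_ext_def)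

lemma linear_ext_diff: "linear_ext f (x - y) = linear_ext f x - linear_ext f y"
  using linear_ext_add[of f "x - y" y] by simp

lemma linear_ext_add_fun: "linear_ext (\<lambda>W. f W + g W) x = linear_ext f x + linear_ext g x"
  by (simp add: linear_ext_def scale_add sum.distrib)

lemma linear_ext_scale_fun: "linear_ext (\<lambda>W. scale c (f W)) x = scale c (linear_ext f x)"
  by (simp add: linear_ext_def scale_sum mult.commute)

lemma linear_ext_zero_fun: "linear_ext (\<lambda>W. 0) x = 0"
  by (simp add: linear_ext_def)

lemma linear_ext_vec: "linear_ext f (vec n W) = (if web n W then f W else 0)"
  by (simp add: linear_ext_def vec_def)

lemma
  shows lin_comp_add_left: "lin_comp n (x + y) z = lin_comp n x z + lin_comp n y z"
    and lin_comp_add_right: "lin_comp n z (x + y) = lin_comp n z x + lin_comp n z y"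
    and lin_comp_scale_left: "lin_comp n (scale c x) z = scale c (lin_comp n x z)"
    and lin_comp_scale_right: "lin_comp n z (scale c x) = scale c (lin_comp n z x)"
    and lin_comp_0 [simp]: "lin_comp n 0 z = 0" "lin_comp n z 0 = 0"
  by (simp_all add: lin_comp_def linear_ext_add linear_ext_scale linear_ext_add_fun linear_ext_scale_fun
      linear_ext_zero_fun)

lemma
  shows lin_tens_add_left: "lin_tens n (x + y) z = lin_tens n x z + lin_tens n y z"
    and lin_tens_add_right: "lin_tens n z (x + y) = lin_tens n z x + lin_tens n z y"
    and lin_tens_scale_left: "lin_tens n (scale c x) z = scale c (lin_tens n x z)"
    and lin_tens_scale_right: "lin_tens n z (scale c x) = scale c (lin_tens n z x)"
    and lin_tens_0 [simp]: "lin_tens n 0 z = 0" "lin_tens n z 0 = 0"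
  by (simp_all add: lin_tens_def linear_ext_add linear_ext_scale linear_ext_add_fun linear_ext_scale_fun
      linear_ext_zero_fun)

lemma lin_comp_diff_left: "lin_comp n (x - y) z = lin_comp n x z - lin_comp n y z"
  and lin_comp_diff_right: "lin_comp n z (x - y) = lin_comp n z x - lin_comp n z y"
  using lin_comp_add_left[of n "x - y" y z] lin_comp_add_right[of n z "x - y" y] by simp_all

lemma lin_tens_diff_left: "lin_tens n (x - y) z = lin_tens n x z - lin_tens n y z"
  and lin_tens_diff_right: "lin_tens n z (x - y) = lin_tens n z x - lin_tens n z y"
  using lin_tens_add_left[of n "x - y" y z] lin_tens_add_right[of n z "x - y" y] by simp_all

lemma web_Comp: "web n (Comp V W) \<longleftrightarrow> web n V \<and> web n W \<and> src V = tgt W"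
  and web_Tens: "web n (Tens V W) \<longleftrightarrow> web n V \<and> web n W"
  by (auto simp: web_def)

lemma lin_comp_vec: "lin_comp n (vec n V) (vec n W) = vec n (Comp V W)"
  by (auto simp: lin_comp_def linear_ext_vec) (auto simp: vec_def web_Comp)

lemma lin_tens_vec: "lin_tens n (vec n V) (vec n W) = vec n (Tens V W)"
  by (auto simp: lin_tens_def linear_ext_vec) (auto simp: vec_def web_Tens)

text \<open>Unlike in \<open>lin_webs\<close>, the boundary is not fixed. This makes sums and
  products total, as a ring structure requires.\<close>

definition free_webs :: "nat \<Rightarrow> lin set" where
  "free_webs n = {x. \<forall>W\<in>Poly_Mapping.keys x. web n W \<and> Poly_Mapping.lookup x W \<in> Zq}"

lemma free_webs_0: "0 \<in> free_webs n"
  by (simp add: free_webs_def)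

lemma free_webs_add: "x \<in> free_webs n \<Longrightarrow> y \<in> free_webs n \<Longrightarrow> x + y \<in> free_webs n"
proof -
  assume *: "x \<in> free_webs n" "y \<in> free_webs n"
  then have "Poly_Mapping.lookup x W \<in> Zq" "Poly_Mapping.lookup y W \<in> Zq" for W
    by (cases "W \<in> Poly_Mapping.keys x"; cases "W \<in> Poly_Mapping.keys y";
        auto simp: free_webs_def in_keys_iff Zq_0)+
  moreover have "web n W" if "W \<in> Poly_Mapping.keys (x + y)" for W
    using * that keys_add[of x y] by (auto simp: free_webs_def)
  ultimately show ?thesis by (auto simp: free_webs_def lookup_add intro: Zq_add)
qed

lemma free_webs_scale: "c \<in> Zq \<Longrightarrow> x \<in> free_webs n \<Longrightarrow> scale c x \<in> free_webs n"
  by (auto simp: free_webs_def in_keys_iff intro: Zq_mult)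

lemma free_webs_vec: "vec n W \<in> free_webs n"
  by (auto simp: free_webs_def vec_def Zq_1)

lemma free_webs_minus: "x \<in> free_webs n \<Longrightarrow> - x \<in> free_webs n"
  using free_webs_scale[of "-1" x n] Zq_minus[OF Zq_1] by (simp add: scale_minus_1)

lemma free_webs_diff: "x \<in> free_webs n \<Longrightarrow> y \<in> free_webs n \<Longrightarrow> x - y \<in> free_webs n"
  using free_webs_add[OF _ free_webs_minus, of x n y] by simp

lemma free_webs_sum: "(\<And>i. i \<in> S \<Longrightarrow> f i \<in> free_webs n) \<Longrightarrow> (\<Sum>i\<in>S. f i) \<in> free_webs n"
  by (induction S rule: infinite_finite_induct) (auto intro: free_webs_0 free_webs_add)

text \<open>The partial sums keep the property R of their webs, so that a condition on the boundary
  is available in the induction step.\<close>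

lemma web_combination_induct:
  assumes x: "\<forall>W\<in>Poly_Mapping.keys x. web n W \<and> R W \<and> Poly_Mapping.lookup x W \<in> Zq"
    and "P 0"
    and "\<And>y c W. P y \<Longrightarrow> \<forall>W\<in>Poly_Mapping.keys y. web n W \<and> R W \<and> Poly_Mapping.lookup y W \<in> Zq \<Longrightarrow>
      c \<in> Zq \<Longrightarrow> web n W \<Longrightarrow> R W \<Longrightarrow> P (y + scale c (vec n W))"
  shows "P x"
proof -
  have dec: "x = (\<Sum>W\<in>Poly_Mapping.keys x. scale (Poly_Mapping.lookup x W) (vec n W))"
  proof (rule poly_mapping_eqI)
    fix V
    have "Poly_Mapping.lookup (\<Sum>W\<in>Poly_Mapping.keys x. scale (Poly_Mapping.lookup x W) (vec n W)) V
       = (\<Sum>W\<in>Poly_Mapping.keys x. if V = W then Poly_Mapping.lookup x V else 0)"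
      unfolding lookup_sum by (rule sum.cong) (use x in \<open>auto simp: vec_def lookup_single when_def\<close>)
    then show "Poly_Mapping.lookup x V =
        Poly_Mapping.lookup (\<Sum>W\<in>Poly_Mapping.keys x. scale (Poly_Mapping.lookup x W) (vec n W)) V"
      by (auto simp: in_keys_iff)
  qed
  let ?G = "\<lambda>y. \<forall>W\<in>Poly_Mapping.keys y. web n W \<and> R W \<and> Poly_Mapping.lookup y W \<in> Zq"
  have "P (\<Sum>W\<in>S. scale (Poly_Mapping.lookup x W) (vec n W)) \<and> ?G (\<Sum>W\<in>S. scale (Poly_Mapping.lookup x W) (vec n W))"
    if "finite S" "S \<subseteq> Poly_Mapping.keys x" for S
    using that
  proof (induction S)
    case empty then show ?case using assms(2) by simp
  next
    case (insert W S)
    let ?y = "\<Sum>W\<in>S. scale (Poly_Mapping.lookup x W) (vec n W)"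
    let ?c = "Poly_Mapping.lookup x W"
    have y: "P ?y" "?G ?y" and W: "web n W" "R W" "?c \<in> Zq" using insert x by auto
    have "?G (?y + scale ?c (vec n W))"
    proof
      fix V assume "V \<in> Poly_Mapping.keys (?y + scale ?c (vec n W))"
      then consider "V \<in> Poly_Mapping.keys ?y" | "V = W"
        by (auto simp: in_keys_iff lookup_add vec_def lookup_single when_def split: if_splits)
      moreover have "Poly_Mapping.lookup ?y V \<in> Zq" using y(2) Zq_0 by (cases "V \<in> Poly_Mapping.keys ?y") (auto simp: in_keys_iff)
      then have "Poly_Mapping.lookup (?y + scale ?c (vec n W)) V \<in> Zq"
        using W by (auto simp: lookup_add vec_def lookup_single when_def Zq_0 Zq_add Zq_mult Zq_1)
      ultimately show "web n V \<and> R V \<and> Poly_Mapping.lookup (?y + scale ?c (vec n W)) V \<in> Zq"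
        using y W by cases auto
    qed
    moreover have "P (?y + scale ?c (vec n W))" using assms(3) y W by blast
    ultimately show ?case using insert by (simp add: add.commute)
  qed
  from this[of "Poly_Mapping.keys x"] dec show ?thesis by simp
qed

lemma free_webs_induct [consumes 1, case_names zero add]:
  assumes "x \<in> free_webs n" "P 0"
    and "\<And>y c W. P y \<Longrightarrow> y \<in> free_webs n \<Longrightarrow> c \<in> Zq \<Longrightarrow> web n W \<Longrightarrow> P (y + scale c (vec n W))"
  shows "P x"
  using web_combination_induct[of x n "\<lambda>_. True" P] assms unfolding free_webs_def by auto

lemma free_webs_lin_comp: "x \<in> free_webs n \<Longrightarrow> y \<in> free_webs n \<Longrightarrow> lin_comp n x y \<in> free_webs n"
proof (induction x rule: free_webs_induct)
  case (add z c V)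
  have "lin_comp n (vec n V) y \<in> free_webs n"
    using add.prems
    by (induction y rule: free_webs_induct)
      (auto simp: lin_comp_add_right lin_comp_scale_right lin_comp_vec intro!: free_webs_0 free_webs_add free_webs_scale free_webs_vec)
  with add show ?case by (auto simp: lin_comp_add_left lin_comp_scale_left intro: free_webs_add free_webs_scale)
qed (auto intro: free_webs_0)

lemma free_webs_lin_tens: "x \<in> free_webs n \<Longrightarrow> y \<in> free_webs n \<Longrightarrow> lin_tens n x y \<in> free_webs n"
proof (induction x rule: free_webs_induct)
  case (add z c V)
  have "lin_tens n (vec n V) y \<in> free_webs n"
    using add.prems
    by (induction y rule: free_webs_induct)
      (auto simp: lin_tens_add_right lin_tens_scale_right lin_tens_vec intro!: free_webs_0 free_webs_add free_webs_scale free_webs_vec)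
  with add show ?case by (auto simp: lin_tens_add_left lin_tens_scale_left intro: free_webs_add free_webs_scale)
qed (auto intro: free_webs_0)

section \<open>The submodule of null combinations as a two-sided ideal\<close>

abbreviation nulls :: "nat \<Rightarrow> lin set" where
  "nulls n \<equiv> null_webs Zq n"

lemma nulls_minus: "x \<in> nulls n \<Longrightarrow> - x \<in> nulls n"
  using null_webs.scale[of "-1" Zq x n] Zq_minus[OF Zq_1] by (simp add: scale_minus_1)

lemma nulls_diff: "x \<in> nulls n \<Longrightarrow> y \<in> nulls n \<Longrightarrow> x - y \<in> nulls n"
  using null_webs.add[OF _ nulls_minus, of x n y] by simp

lemma nulls_comp_left: "y \<in> free_webs n \<Longrightarrow> x \<in> nulls n \<Longrightarrow> lin_comp n y x \<in> nulls n"
  by (induction y rule: free_webs_induct)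
    (auto simp: lin_comp_add_left lin_comp_scale_left intro: null_webs.intros)

lemma nulls_comp_right: "y \<in> free_webs n \<Longrightarrow> x \<in> nulls n \<Longrightarrow> lin_comp n x y \<in> nulls n"
  by (induction y rule: free_webs_induct)
    (auto simp: lin_comp_add_right lin_comp_scale_right intro: null_webs.intros)

lemma nulls_tens_left: "y \<in> free_webs n \<Longrightarrow> x \<in> nulls n \<Longrightarrow> lin_tens n y x \<in> nulls n"
  by (induction y rule: free_webs_induct)
    (auto simp: lin_tens_add_left lin_tens_scale_left intro: null_webs.intros)

lemma nulls_tens_right: "y \<in> free_webs n \<Longrightarrow> x \<in> nulls n \<Longrightarrow> lin_tens n x y \<in> nulls n"
  by (induction y rule: free_webs_induct)
    (auto simp: lin_tens_add_right lin_tens_scale_right intro: null_webs.intros)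

lemma nulls_trans: "x - y \<in> nulls n \<Longrightarrow> y - z \<in> nulls n \<Longrightarrow> x - z \<in> nulls n"
  using null_webs.add[of "x - y" Zq n "y - z"] by simp

lemma vec_isotopic:
  assumes "isotopic n V W" "web n V" "web n W"
  shows "vec n V - vec n W \<in> nulls n"
  using assms by (rule null_webs.isotopy[rotated 2])

text \<open>Both products are associative only up to isotopy, and the failure is trilinear; it
  therefore suffices to test it on webs.\<close>

lemma nulls_trilinear:
  assumes add: "\<And>x x' y z. G (x + x') y z = G x y z + G x' y z" "\<And>x y y' z. G x (y + y') z = G x y z + G x y' z"
      "\<And>x y z z'. G x y (z + z') = G x y z + G x y z'"
    and scale: "\<And>c x y z. G (scale c x) y z = scale c (G x y z)" "\<And>c x y z. G x (scale c y) z = scale c (G x y z)"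
      "\<And>c x y z. G x y (scale c z) = scale c (G x y z)"
    and webs: "\<And>U V W. G (vec n U) (vec n V) (vec n W) \<in> nulls n"
    and "x \<in> free_webs n" "y \<in> free_webs n" "z \<in> free_webs n"
  shows "G x y z \<in> nulls n"
proof -
  have G0: "G 0 y z = 0" "G x 0 z = 0" "G x y 0 = 0" for x y z
    using add(1)[of 0 0 y z] add(2)[of x 0 0 z] add(3)[of x y 0 0] by simp_all
  have 1: "G (vec n U) (vec n V) z \<in> nulls n" if "z \<in> free_webs n" for U V z
    using that by (induction z rule: free_webs_induct) (simp_all add: G0 add scale webs null_webs.intros)
  have 2: "G (vec n U) y z \<in> nulls n" if "y \<in> free_webs n" "z \<in> free_webs n" for U y z
    using that by (induction y rule: free_webs_induct) (simp_all add: G0 add scale 1 null_webs.intros)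
  show ?thesis
    using assms(8) by (induction x rule: free_webs_induct) (simp_all add: G0 add scale 2 assms(9,10) null_webs.intros)
qed

lemma nulls_comp_assoc:
  assumes "x \<in> free_webs n" "y \<in> free_webs n" "z \<in> free_webs n"
  shows "lin_comp n (lin_comp n x y) z - lin_comp n x (lin_comp n y z) \<in> nulls n"
proof (rule nulls_trilinear[OF _ _ _ _ _ _ _ assms])
  fix U V W
  have "vec n (Comp (Comp U V) W) - vec n (Comp U (Comp V W)) \<in> nulls n"
  proof (cases "web n (Comp U (Comp V W))")
    case True
    then have "isotopic n (Comp U (Comp V W)) (Comp (Comp U V) W)"
      by (intro isotopic.comp_assoc) (simp add: web_def)
    with True show ?thesis by (intro vec_isotopic isotopic.sym[of n "Comp U (Comp V W)"]) (auto simp: web_Comp)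
  next
    case False
    then have "\<not> web n (Comp (Comp U V) W)" by (auto simp: web_Comp)
    with False show ?thesis by (simp add: vec_def null_webs.zero)
  qed
  then show "lin_comp n (lin_comp n (vec n U) (vec n V)) (vec n W) - lin_comp n (vec n U) (lin_comp n (vec n V) (vec n W)) \<in> nulls n"
    by (simp add: lin_comp_vec)
qed (simp_all add: lin_comp_add_left lin_comp_add_right lin_comp_scale_left lin_comp_scale_right scale_diff add_diff_add)

lemma nulls_tens_assoc:
  assumes "x \<in> free_webs n" "y \<in> free_webs n" "z \<in> free_webs n"
  shows "lin_tens n (lin_tens n x y) z - lin_tens n x (lin_tens n y z) \<in> nulls n"
proof (rule nulls_trilinear[OF _ _ _ _ _ _ _ assms])
  fix U V W
  have "vec n (Tens (Tens U V) W) - vec n (Tens U (Tens V W)) \<in> nulls n"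
  proof (cases "web n (Tens U (Tens V W))")
    case True
    then have "isotopic n (Tens U (Tens V W)) (Tens (Tens U V) W)"
      by (intro isotopic.tens_assoc) (simp add: web_def)
    with True show ?thesis by (intro vec_isotopic isotopic.sym[of n "Tens U (Tens V W)"]) (auto simp: web_Tens)
  next
    case False
    then have "\<not> web n (Tens (Tens U V) W)" by (auto simp: web_Tens)
    with False show ?thesis by (simp add: vec_def null_webs.zero)
  qed
  then show "lin_tens n (lin_tens n (vec n U) (vec n V)) (vec n W) - lin_tens n (vec n U) (lin_tens n (vec n V) (vec n W)) \<in> nulls n"
    by (simp add: lin_tens_vec)
qed (simp_all add: lin_tens_add_left lin_tens_add_right lin_tens_scale_left lin_tens_scale_right scale_diff add_diff_add)


section \<open>The web module as a ring\<close>

text \<open>A type cannot depend on \<open>n\<close>, so the quotients for all \<open>n\<close> are put together in one product;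
  \<open>cls n\<close> is the inclusion of the factor with index \<open>n\<close>. Composition is total on this product: it
  is 0 for webs with different boundaries.\<close>

definition web_rel :: "(nat \<Rightarrow> lin) \<Rightarrow> (nat \<Rightarrow> lin) \<Rightarrow> bool" where
  "web_rel f g \<longleftrightarrow> (\<forall>n. f n \<in> free_webs n \<and> g n \<in> free_webs n \<and> f n - g n \<in> nulls n)"

lemma web_rel_part_equivp: "part_equivp web_rel"
proof (rule part_equivpI)
  show "\<exists>x. web_rel x x"
    by (rule exI[of _ "\<lambda>_. 0"]) (simp add: web_rel_def free_webs_0 null_webs.zero)
  show "symp web_rel"
    unfolding symp_def web_rel_def by (metis minus_diff_eq nulls_minus)
  show "transp web_rel"
    unfolding transp_def web_rel_def by (meson nulls_trans)
qed

quotient_type webmod = "nat \<Rightarrow> lin" / partial: web_rel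
  by (rule web_rel_part_equivp)

instantiation webmod :: ring
begin

lift_definition zero_webmod :: webmod is "\<lambda>_. 0"
  by (simp add: web_rel_def free_webs_0 null_webs.zero)

lift_definition plus_webmod :: "webmod \<Rightarrow> webmod \<Rightarrow> webmod" is "\<lambda>f g n. f n + g n"
  unfolding web_rel_def by (auto simp: add_diff_add intro: free_webs_add null_webs.add)

lift_definition minus_webmod :: "webmod \<Rightarrow> webmod \<Rightarrow> webmod" is "\<lambda>f g n. f n - g n"
proof -
  fix f f' g g' assume *: "web_rel f f'" "web_rel g g'"
  have "f n - g n - (f' n - g' n) = (f n - f' n) - (g n - g' n)" for n by simp
  with * show "web_rel (\<lambda>n. f n - g n) (\<lambda>n. f' n - g' n)"
    unfolding web_rel_def by (metis free_webs_diff nulls_diff)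
qed

lift_definition uminus_webmod :: "webmod \<Rightarrow> webmod" is "\<lambda>f n. - f n"
proof -
  fix f f' assume *: "web_rel f f'"
  have "- f n - (- f' n) = - (f n - f' n)" for n by simp
  with * show "web_rel (\<lambda>n. - f n) (\<lambda>n. - f' n)"
    unfolding web_rel_def by (metis free_webs_minus nulls_minus)
qed

lift_definition times_webmod :: "webmod \<Rightarrow> webmod \<Rightarrow> webmod" is "\<lambda>f g n. lin_comp n (f n) (g n)"
proof -
  fix f f' g g' assume "web_rel f f'" "web_rel g g'"
  then have *: "f n \<in> free_webs n" "f' n \<in> free_webs n" "f n - f' n \<in> nulls n"
    "g n \<in> free_webs n" "g' n \<in> free_webs n" "g n - g' n \<in> nulls n" for n
    by (auto simp: web_rel_def)
  have "lin_comp n (f n) (g n) - lin_comp n (f' n) (g' n) =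
    lin_comp n (f n - f' n) (g n) + lin_comp n (f' n) (g n - g' n)" for n
    by (simp add: lin_comp_diff_left lin_comp_diff_right)
  then show "web_rel (\<lambda>n. lin_comp n (f n) (g n)) (\<lambda>n. lin_comp n (f' n) (g' n))"
    unfolding web_rel_def using *
    by (metis free_webs_lin_comp null_webs.add nulls_comp_left nulls_comp_right)
qed

instance
proof
  fix a b c :: webmod
  show "a * b * c = a * (b * c)"
    by transfer (auto simp: web_rel_def intro!: free_webs_lin_comp nulls_comp_assoc)
  show "(a + b) * c = a * c + b * c" "a * (b + c) = a * b + a * c"
    by (transfer; auto simp: web_rel_def lin_comp_add_left lin_comp_add_right
      intro!: free_webs_lin_comp free_webs_add null_webs.zero)+
  show "a + b + c = a + (b + c)" "a + b = b + a" "0 + a = a" "- a + a = 0" "a - b = a + - b"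
    by (transfer; auto simp: web_rel_def algebra_simps
      intro!: free_webs_0 free_webs_add free_webs_minus free_webs_diff null_webs.zero)+
qed

end

lift_definition tens :: "webmod \<Rightarrow> webmod \<Rightarrow> webmod" (infixr \<open>\<otimes>\<close> 75) is "\<lambda>f g n. lin_tens n (f n) (g n)"
proof -
  fix f f' g g' assume "web_rel f f'" "web_rel g g'"
  then have *: "f n \<in> free_webs n" "f' n \<in> free_webs n" "f n - f' n \<in> nulls n"
    "g n \<in> free_webs n" "g' n \<in> free_webs n" "g n - g' n \<in> nulls n" for n
    by (auto simp: web_rel_def)
  have "lin_tens n (f n) (g n) - lin_tens n (f' n) (g' n) =
    lin_tens n (f n - f' n) (g n) + lin_tens n (f' n) (g n - g' n)" for n
    by (simp add: lin_tens_diff_left lin_tens_diff_right)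
  then show "web_rel (\<lambda>n. lin_tens n (f n) (g n)) (\<lambda>n. lin_tens n (f' n) (g' n))"
    unfolding web_rel_def using *
    by (metis free_webs_lin_tens null_webs.add nulls_tens_left nulls_tens_right)
qed

lift_definition smult :: "zq \<Rightarrow> webmod \<Rightarrow> webmod" (infixr \<open>\<cdot>\<close> 76) is "\<lambda>c f n. scale c (f n)"
  by (auto simp: web_rel_def scale_diff[symmetric] intro: free_webs_scale null_webs.scale)

text \<open>Combinations with coefficients outside \<open>Zq\<close> are sent to 0, which makes the
  map total.\<close>

lift_definition cls :: "nat \<Rightarrow> lin \<Rightarrow> webmod" is "\<lambda>n x m. if m = n \<and> x \<in> free_webs n then x else 0"
  by (auto simp: web_rel_def free_webs_0 null_webs.zero)

lemma tens_assoc: "(f \<otimes> g) \<otimes> h = f \<otimes> (g \<otimes> h)"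
  by transfer (auto simp: web_rel_def intro!: free_webs_lin_tens nulls_tens_assoc)

lemma tens_add_left: "(f + g) \<otimes> h = f \<otimes> h + g \<otimes> h"
  and tens_add_right: "h \<otimes> (f + g) = h \<otimes> f + h \<otimes> g"
  by (transfer; auto simp: web_rel_def lin_tens_add_left lin_tens_add_right
      intro!: free_webs_lin_tens free_webs_add null_webs.zero)+

lemma tens_0 [simp]: "0 \<otimes> f = 0" "f \<otimes> 0 = 0"
  by (transfer; auto simp: web_rel_def free_webs_0 null_webs.zero)+

lemma tens_sum_left: "(\<Sum>i\<in>S. f i) \<otimes> h = (\<Sum>i\<in>S. f i \<otimes> h)"
  and tens_sum_right: "h \<otimes> (\<Sum>i\<in>S. f i) = (\<Sum>i\<in>S. h \<otimes> f i)"
  by (induction S rule: infinite_finite_induct) (simp_all add: tens_add_left tens_add_right)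

lemma smult_add: "c \<cdot> (f + g) = c \<cdot> f + c \<cdot> g"
  and smult_add_left: "(c + d) \<cdot> f = c \<cdot> f + d \<cdot> f"
  and smult_smult [simp]: "c \<cdot> (d \<cdot> f) = (c * d) \<cdot> f"
  and smult_1 [simp]: "1 \<cdot> f = f"
  and smult_0_left [simp]: "0 \<cdot> f = 0"
  and smult_0 [simp]: "c \<cdot> 0 = 0"
  by (transfer; auto simp: web_rel_def scale_add scale_add_left null_webs.zero
      intro!: free_webs_add free_webs_scale free_webs_0 Zq_mult Zq_add)+

lemma smult_minus: "(- c) \<cdot> f = - (c \<cdot> f)"
  using smult_add_left[of "- c" c f] by (simp add: eq_neg_iff_add_eq_0)

lemma smult_diff_left: "(c - d) \<cdot> f = c \<cdot> f - d \<cdot> f"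
  using smult_add_left[of "c - d" d f] by (simp add: eq_diff_eq)

lemma smult_sum: "c \<cdot> (\<Sum>i\<in>S. f i) = (\<Sum>i\<in>S. c \<cdot> f i)"
  by (induction S rule: infinite_finite_induct) (simp_all add: smult_add)

lemma smult_sum_left: "(\<Sum>i\<in>S. c i) \<cdot> f = (\<Sum>i\<in>S. c i \<cdot> f)"
  by (induction S rule: infinite_finite_induct) (simp_all add: smult_add_left)

lemma smult_mult_left [simp]: "(c \<cdot> f) * g = c \<cdot> (f * g)"
  and smult_mult_right [simp]: "f * (c \<cdot> g) = c \<cdot> (f * g)"
  and smult_tens_left [simp]: "(c \<cdot> f) \<otimes> g = c \<cdot> (f \<otimes> g)"
  and smult_tens_right [simp]: "f \<otimes> (c \<cdot> g) = c \<cdot> (f \<otimes> g)"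
  by (transfer; auto simp: web_rel_def lin_comp_scale_left lin_comp_scale_right lin_tens_scale_left
      lin_tens_scale_right null_webs.zero
      intro!: free_webs_scale free_webs_lin_comp free_webs_lin_tens)+

text \<open>The bridge in both directions: relations of webs become equations in the ring, and
  equations derived there become statements about \<open>null_webs\<close>.\<close>

lemma cls_eq_iff:
  assumes "x \<in> free_webs n" "y \<in> free_webs n"
  shows "cls n x = cls n y \<longleftrightarrow> x - y \<in> nulls n"
proof -
  have "web_rel (\<lambda>m. if m = n \<and> x \<in> free_webs n then x else 0) (\<lambda>m. if m = n \<and> y \<in> free_webs n then y else 0)
    \<longleftrightarrow> x - y \<in> nulls n" (is "?L \<longleftrightarrow> ?R")
  proof
    assume ?L
    then show ?R using assms unfolding web_rel_def by (auto dest: spec[of _ n])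
  next
    assume ?R
    then show ?L using assms unfolding web_rel_def by (simp add: free_webs_0 null_webs.zero)
  qed
  then show ?thesis by (transfer fixing: x y n)
qed

lemma cls_0: "cls n 0 = 0"
  by transfer (auto simp: web_rel_def free_webs_0 null_webs.zero)

lemma cls_add: "x \<in> free_webs n \<Longrightarrow> y \<in> free_webs n \<Longrightarrow> cls n (x + y) = cls n x + cls n y"
  by transfer (auto simp: web_rel_def free_webs_0 free_webs_add null_webs.zero)

lemma cls_scale_Rep: "x \<in> free_webs n \<Longrightarrow> cls n (scale (Rep_zq d) x) = d \<cdot> cls n x"
  by transfer (auto simp: web_rel_def free_webs_0 free_webs_scale null_webs.zero)

lemma cls_scale: "c \<in> Zq \<Longrightarrow> x \<in> free_webs n \<Longrightarrow> cls n (scale c x) = Abs_zq c \<cdot> cls n x"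
  using cls_scale_Rep[of x n "Abs_zq c"] by (simp add: Abs_zq_inverse)

lemma cls_lin_comp: "x \<in> free_webs n \<Longrightarrow> y \<in> free_webs n \<Longrightarrow> cls n (lin_comp n x y) = cls n x * cls n y"
  by transfer (auto simp: web_rel_def free_webs_0 free_webs_lin_comp null_webs.zero)

lemma cls_lin_tens: "x \<in> free_webs n \<Longrightarrow> y \<in> free_webs n \<Longrightarrow> cls n (lin_tens n x y) = cls n x \<otimes> cls n y"
  by transfer (auto simp: web_rel_def free_webs_0 free_webs_lin_tens null_webs.zero)

lemma cls_sum: "(\<And>i. i \<in> S \<Longrightarrow> f i \<in> free_webs n) \<Longrightarrow> cls n (\<Sum>i\<in>S. f i) = (\<Sum>i\<in>S. cls n (f i))"
  by (induction S rule: infinite_finite_induct) (auto simp: cls_0 cls_add free_webs_sum)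


section \<open>The strict monoidal structure\<close>

lemma opp_opp [simp]: "opp (opp x) = x"
  by (cases x) simp_all

lemma label_opp [simp]: "label (opp x) = label x"
  by (cases x) simp_all

lemma opp_strands [simp]: "opp x \<in> strands n \<longleftrightarrow> x \<in> strands n"
  by (simp add: strands_def)

lemma dual_Nil [simp]: "dual [] = []"
  and dual_Cons [simp]: "dual (x # xs) = dual xs @ [opp x]"
  and dual_append [simp]: "dual (xs @ ys) = dual ys @ dual xs"
  and dual_dual [simp]: "dual (dual xs) = xs"
  by (simp_all add: dual_def rev_map comp_def)

lemma set_dual [simp]: "set (dual xs) \<subseteq> strands n \<longleftrightarrow> set xs \<subseteq> strands n"
  by (induction xs) auto

lemma src_cups [simp]: "src (cups xs) = []" and tgt_cups [simp]: "tgt (cups xs) = xs @ dual xs"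
  by (induction xs) auto

lemma src_caps [simp]: "src (caps xs) = xs @ dual xs" and tgt_caps [simp]: "tgt (caps xs) = []"
  by (induction xs) auto

lemma web_cups [simp]: "web n (cups xs) \<longleftrightarrow> set xs \<subseteq> strands n"
  by (induction xs) (auto simp: web_def)

lemma web_caps [simp]: "web n (caps xs) \<longleftrightarrow> set xs \<subseteq> strands n"
  by (induction xs) (auto simp: web_def)

lemma admissible_cups [simp]: "admissible n (cups xs) \<longleftrightarrow> set xs \<subseteq> strands n"
  by (induction xs) auto

lemma admissible_caps [simp]: "admissible n (caps xs) \<longleftrightarrow> set xs \<subseteq> strands n"
  by (induction xs) auto

lemma admissible_boundary: "admissible n D \<Longrightarrow> set (src D) \<subseteq> strands n \<and> set (tgt D) \<subseteq> strands n"
  by (induction D) (auto simp: strands_def)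

lemma src_rot [simp]: "src (rot D) = dual (tgt D)" and tgt_rot [simp]: "tgt (rot D) = dual (src D)"
  and src_rot' [simp]: "src (rot' D) = dual (tgt D)" and tgt_rot' [simp]: "tgt (rot' D) = dual (src D)"
  by (simp_all add: rot_def rot'_def)

lemma admissible_rot: "admissible n D \<Longrightarrow> admissible n (rot D)"
  and admissible_rot': "admissible n D \<Longrightarrow> admissible n (rot' D)"
  using admissible_boundary[of n D] by (auto simp: rot_def rot'_def)

lemma uncrossed_cups [simp]: "uncrossed (cups xs)" and uncrossed_caps [simp]: "uncrossed (caps xs)"
  and unmarked_cups [simp]: "unmarked (cups xs)" and unmarked_caps [simp]: "unmarked (caps xs)"
  by (induction xs) auto

lemma web_rot: "web n D \<Longrightarrow> web n (rot D)" and web_rot': "web n D \<Longrightarrow> web n (rot' D)"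
  using admissible_rot[of n D] admissible_rot'[of n D] by (auto simp: web_def rot_def rot'_def)

lemma lin_webs_subset: "lin_webs Zq n xs ys \<subseteq> free_webs n"
  by (auto simp: lin_webs_def free_webs_def)

lemma lin_webs_iff: "x \<in> lin_webs Zq n xs ys \<longleftrightarrow>
  x \<in> free_webs n \<and> (\<forall>W\<in>Poly_Mapping.keys x. src W = xs \<and> tgt W = ys)"
  by (auto simp: lin_webs_def free_webs_def)

lemma lin_webs_0: "0 \<in> lin_webs Zq n xs ys"
  by (simp add: lin_webs_def)

lemma lin_webs_add: "x \<in> lin_webs Zq n xs ys \<Longrightarrow> y \<in> lin_webs Zq n xs ys \<Longrightarrow> x + y \<in> lin_webs Zq n xs ys"
  using keys_add[of x y] by (auto simp: lin_webs_iff intro: free_webs_add)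

lemma lin_webs_scale: "c \<in> Zq \<Longrightarrow> x \<in> lin_webs Zq n xs ys \<Longrightarrow> scale c x \<in> lin_webs Zq n xs ys"
  by (auto simp: lin_webs_iff in_keys_iff intro: free_webs_scale)

lemma lin_webs_vec: "(web n W \<Longrightarrow> src W = xs \<and> tgt W = ys) \<Longrightarrow> vec n W \<in> lin_webs Zq n xs ys"
  by (auto simp: lin_webs_iff free_webs_vec) (auto simp: vec_def split: if_splits)

lemma lin_webs_sum: "(\<And>i. i \<in> S \<Longrightarrow> f i \<in> lin_webs Zq n xs ys) \<Longrightarrow> (\<Sum>i\<in>S. f i) \<in> lin_webs Zq n xs ys"
  by (induction S rule: infinite_finite_induct) (auto intro: lin_webs_0 lin_webs_add)

locale webs =
  fixes n :: nat
begin

definition wb :: "diagram \<Rightarrow> webmod" where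
  "wb D = cls n (vec n D)"

text \<open>Since products are total, unit and interchange laws hold only for factors with matching
  boundaries; \<open>homs\<close> supplies this typing.\<close>

definition homs :: "strand list \<Rightarrow> strand list \<Rightarrow> webmod set" where
  "homs xs ys = cls n ` lin_webs Zq n xs ys"

abbreviation Id :: "strand list \<Rightarrow> webmod" where
  "Id xs \<equiv> wb (Ident xs)"

lemma wb_Comp: "wb (Comp D E) = wb D * wb E"
  by (simp add: wb_def free_webs_vec flip: lin_comp_vec cls_lin_comp)

lemma wb_Tens: "wb (Tens D E) = wb D \<otimes> wb E"
  by (simp add: wb_def free_webs_vec flip: lin_tens_vec cls_lin_tens)

lemma wb_not_web: "\<not> web n D \<Longrightarrow> wb D = 0"
  by (simp add: wb_def vec_def cls_0)

lemma wb_isotopic: "isotopic n D E \<Longrightarrow> web n D \<Longrightarrow> web n E \<Longrightarrow> wb D = wb E"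
  by (simp add: wb_def cls_eq_iff free_webs_vec vec_isotopic)

lemma homs_0 [simp]: "0 \<in> homs xs ys"
  unfolding homs_def using lin_webs_0 by (metis cls_0 image_eqI)

lemma homs_add: "f \<in> homs xs ys \<Longrightarrow> g \<in> homs xs ys \<Longrightarrow> f + g \<in> homs xs ys"
  unfolding homs_def using lin_webs_add lin_webs_subset
  by (auto simp: image_iff Bex_def) (metis cls_add subsetD)

lemma homs_smult: "f \<in> homs xs ys \<Longrightarrow> c \<cdot> f \<in> homs xs ys"
  unfolding homs_def using lin_webs_subset
  by (auto simp: image_iff Bex_def) (metis cls_scale_Rep lin_webs_scale Rep_zq subsetD)

lemma homs_sum: "(\<And>i. i \<in> S \<Longrightarrow> f i \<in> homs xs ys) \<Longrightarrow> (\<Sum>i\<in>S. f i) \<in> homs xs ys"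
  by (induction S rule: infinite_finite_induct) (auto intro: homs_add)

lemma homs_wb: "(web n D \<Longrightarrow> src D = xs \<and> tgt D = ys) \<Longrightarrow> wb D \<in> homs xs ys"
  unfolding homs_def wb_def using lin_webs_vec by blast

lemma homs_induct [consumes 1, case_names zero add]:
  assumes "f \<in> homs xs ys" "P 0"
    and "\<And>g c D. P g \<Longrightarrow> g \<in> homs xs ys \<Longrightarrow> web n D \<Longrightarrow> src D = xs \<Longrightarrow> tgt D = ys \<Longrightarrow> P (g + c \<cdot> wb D)"
  shows "P f"
proof -
  obtain x where x: "f = cls n x" "x \<in> lin_webs Zq n xs ys" using assms(1) by (auto simp: homs_def)
  have "P (cls n x)"
  proof (rule web_combination_induct[where R = "\<lambda>W. src W = xs \<and> tgt W = ys"])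
    show "\<forall>W\<in>Poly_Mapping.keys x. web n W \<and> (src W = xs \<and> tgt W = ys) \<and> Poly_Mapping.lookup x W \<in> Zq"
      using x(2) by (auto simp: lin_webs_def)
    show "P (cls n 0)" by (simp add: cls_0 assms)
  next
    fix y c W
    assume y: "P (cls n y)" "\<forall>W\<in>Poly_Mapping.keys y. web n W \<and> (src W = xs \<and> tgt W = ys) \<and> Poly_Mapping.lookup y W \<in> Zq"
      and c: "c \<in> Zq" and W: "web n W" "src W = xs \<and> tgt W = ys"
    then have "y \<in> lin_webs Zq n xs ys" by (auto simp: lin_webs_def)
    then have "cls n y \<in> homs xs ys" "y \<in> free_webs n" using lin_webs_subset by (auto simp: homs_def)
    then show "P (cls n (y + scale c (vec n W)))"
      using y W c assms(3)[of "cls n y" W "Abs_zq c"]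
      by (simp add: cls_add cls_scale free_webs_vec free_webs_scale wb_def)
  qed
  with x show ?thesis by simp
qed

lemma Id_homs [simp]: "Id xs \<in> homs xs xs"
  by (rule homs_wb) simp

lemma Id_comp [simp]: "f \<in> homs xs ys \<Longrightarrow> Id ys * f = f"
proof (induction f rule: homs_induct)
  case (add g c D)
  have "wb (Comp (Ident (tgt D)) D) = wb D"
    using add admissible_boundary[of n D]
    by (intro wb_isotopic isotopic.comp_Id_left) (auto simp: web_def)
  with add show ?case by (simp add: distrib_left wb_Comp)
qed simp

lemma Id_Id [simp]: "Id xs * Id xs = Id xs"
  by (rule Id_comp[OF Id_homs])

lemma comp_Id [simp]: "f \<in> homs xs ys \<Longrightarrow> f * Id xs = f"
proof (induction f rule: homs_induct)
  case (add g c D)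
  have "wb (Comp D (Ident (src D))) = wb D"
    using add admissible_boundary[of n D]
    by (intro wb_isotopic isotopic.comp_Id_right) (auto simp: web_def)
  with add show ?case by (simp add: distrib_right wb_Comp)
qed simp

lemma homs_comp: "f \<in> homs ys zs \<Longrightarrow> g \<in> homs xs ys \<Longrightarrow> f * g \<in> homs xs zs"
proof (induction f rule: homs_induct)
  case (add f c D)
  have "wb D * g \<in> homs xs zs"
    using add.prems
    by (induction g rule: homs_induct)
      (use add in \<open>auto simp: distrib_left wb_Comp[symmetric] web_Comp intro!: homs_add homs_smult homs_wb\<close>)
  with add show ?case by (simp add: distrib_right homs_add homs_smult)
qed simp

lemma homs_tens: "f \<in> homs xs ys \<Longrightarrow> g \<in> homs us vs \<Longrightarrow> f \<otimes> g \<in> homs (xs @ us) (ys @ vs)"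
proof (induction f rule: homs_induct)
  case (add f c D)
  have "wb D \<otimes> g \<in> homs (xs @ us) (ys @ vs)"
    using add.prems
    by (induction g rule: homs_induct)
      (use add in \<open>auto simp: tens_add_right wb_Tens[symmetric] web_Tens intro!: homs_add homs_smult homs_wb\<close>)
  with add show ?case by (simp add: tens_add_left homs_add homs_smult)
qed simp

lemma homs_tens': "f \<in> homs xs ys \<Longrightarrow> g \<in> homs us vs \<Longrightarrow> as = xs @ us \<Longrightarrow> bs = ys @ vs \<Longrightarrow> f \<otimes> g \<in> homs as bs"
  by (simp add: homs_tens)

lemma Id_tens_Id [simp]: "Id xs \<otimes> Id ys = Id (xs @ ys)"
proof (cases "set (xs @ ys) \<subseteq> strands n")
  case True
  then show ?thesis unfolding wb_Tens[symmetric]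
    by (intro wb_isotopic isotopic.tens_Id_Id) (auto simp: web_def)
next
  case False
  then have "\<not> web n (Tens (Ident xs) (Ident ys))" "\<not> web n (Ident (xs @ ys))" by (auto simp: web_def)
  then show ?thesis by (simp add: wb_not_web flip: wb_Tens)
qed

lemma Id_tens_Id' [simp]: "Id xs \<otimes> (Id ys \<otimes> f) = Id (xs @ ys) \<otimes> f"
  by (simp flip: tens_assoc)

lemma Id_Nil_tens [simp]: "f \<in> homs xs ys \<Longrightarrow> Id [] \<otimes> f = f"
proof (induction f rule: homs_induct)
  case (add g c D)
  have "wb (Tens (Ident []) D) = wb D"
    using add by (intro wb_isotopic isotopic.tens_Id_left) (auto simp: web_def)
  with add show ?case by (simp add: tens_add_right wb_Tens)
qed simp

lemma tens_Id_Nil [simp]: "f \<in> homs xs ys \<Longrightarrow> f \<otimes> Id [] = f"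
proof (induction f rule: homs_induct)
  case (add g c D)
  have "wb (Tens D (Ident [])) = wb D"
    using add by (intro wb_isotopic isotopic.tens_Id_right) (auto simp: web_def)
  with add show ?case by (simp add: tens_add_left wb_Tens)
qed simp

text \<open>Linear in each of the four arguments, hence four nested inductions down to the isotopy
  between webs.\<close>

lemma tens_interchange:
  assumes "f \<in> homs ys zs" "f' \<in> homs xs ys" "g \<in> homs vs ws" "g' \<in> homs us vs"
  shows "(f \<otimes> g) * (f' \<otimes> g') = (f * f') \<otimes> (g * g')"
  using assms
proof (induction f rule: homs_induct)
  case (add f c D)
  have "(wb D \<otimes> g) * (f' \<otimes> g') = (wb D * f') \<otimes> (g * g')"
    using add.prems
  proof (induction f' rule: homs_induct)
    case (add f' c D')
    have "(wb D \<otimes> g) * (wb D' \<otimes> g') = (wb D * wb D') \<otimes> (g * g')"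
      using add.prems
    proof (induction g rule: homs_induct)
      case (add g c E)
      have "(wb D \<otimes> wb E) * (wb D' \<otimes> g') = (wb D * wb D') \<otimes> (wb E * g')"
        using add.prems
      proof (induction g' rule: homs_induct)
        case (add g' c E')
        have "wb (Comp (Tens D E) (Tens D' E')) = wb (Tens (Comp D D') (Comp E E'))"
          using \<open>web n D\<close> \<open>web n D'\<close> \<open>web n E\<close> \<open>web n E'\<close> \<open>src D = ys\<close> \<open>tgt D' = ys\<close> \<open>src E = vs\<close> \<open>tgt E' = vs\<close>
          by (intro wb_isotopic isotopic.interchange) (auto simp: web_def)
        with add show ?case by (simp add: distrib_left tens_add_right wb_Comp wb_Tens)
      qed simp
      with add show ?case by (simp add: distrib_right tens_add_right tens_add_left)
    qed simp
    with add show ?case by (simp add: distrib_left tens_add_left)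
  qed simp
  with add show ?case by (simp add: distrib_right tens_add_left)
qed simp

text \<open>Every later picture is a product of padded elementary pieces, one for each horizontal
  level.\<close>

definition pad :: "strand list \<Rightarrow> webmod \<Rightarrow> strand list \<Rightarrow> webmod" where
  "pad xs f ys = Id xs \<otimes> f \<otimes> Id ys"

lemma pad_homs: "f \<in> homs as bs \<Longrightarrow> us = xs @ as @ ys \<Longrightarrow> vs = xs @ bs @ ys \<Longrightarrow> pad xs f ys \<in> homs us vs"
  unfolding pad_def by (auto intro!: homs_tens')

lemma pad_pad [simp]: "pad xs (pad us f vs) ys = pad (xs @ us) f (vs @ ys)"
  by (simp add: pad_def tens_assoc)

lemma pad_Nil: "f \<in> homs as bs \<Longrightarrow> pad [] f [] = f"
  by (simp add: pad_def)

lemma pad_Id [simp]: "pad xs (Id us) ys = Id (xs @ us @ ys)"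
  by (simp add: pad_def)

lemma pad_comp: "f \<in> homs bs cs \<Longrightarrow> g \<in> homs as bs \<Longrightarrow> pad xs (f * g) ys = pad xs f ys * pad xs g ys"
proof -
  assume *: "f \<in> homs bs cs" "g \<in> homs as bs"
  then have "(f \<otimes> Id ys) * (g \<otimes> Id ys) = (f * g) \<otimes> Id ys"
    by (subst tens_interchange[OF _ _ Id_homs Id_homs]) auto
  moreover have "(Id xs \<otimes> (f \<otimes> Id ys)) * (Id xs \<otimes> (g \<otimes> Id ys)) = Id xs \<otimes> ((f \<otimes> Id ys) * (g \<otimes> Id ys))"
    using * by (subst tens_interchange[OF Id_homs Id_homs homs_tens[OF _ Id_homs] homs_tens[OF _ Id_homs]]) auto
  ultimately show ?thesis by (simp add: pad_def)
qed

lemma pad_0 [simp]: "pad xs 0 ys = 0"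
  and pad_add: "pad xs (f + g) ys = pad xs f ys + pad xs g ys"
  and pad_smult [simp]: "pad xs (c \<cdot> f) ys = c \<cdot> pad xs f ys"
  and pad_sum: "pad xs (\<Sum>i\<in>S. h i) ys = (\<Sum>i\<in>S. pad xs (h i) ys)"
  by (simp_all add: pad_def tens_add_left tens_add_right tens_sum_left tens_sum_right)

lemma tens_eq_pad:
  assumes "f \<in> homs as bs" "g \<in> homs cs ds"
  shows "f \<otimes> g = pad [] f ds * pad as g []" and "f \<otimes> g = pad bs g [] * pad [] f cs"
proof -
  have 1: "pad [] f xs = f \<otimes> Id xs" "pad xs g [] = Id xs \<otimes> g" for xs
    using assms by (auto simp: pad_def) (metis Id_Nil_tens assms(1) Id_homs homs_tens)
  show "f \<otimes> g = pad [] f ds * pad as g []" "f \<otimes> g = pad bs g [] * pad [] f cs"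
    unfolding 1 using assms
    by (simp_all add: tens_interchange[OF _ Id_homs Id_homs] tens_interchange[OF Id_homs _ _ Id_homs])
qed

text \<open>Two pieces at different levels, separated by the strands \<open>ms\<close>, slide past
  each other: \<open>ms\<close> is absorbed into g, and then this is the interchange law.\<close>

lemma pad_swap:
  assumes "f \<in> homs as bs" "g \<in> homs cs ds"
  shows "pad xs f (ms @ ds @ ys) * pad (xs @ as @ ms) g ys = pad (xs @ bs @ ms) g ys * pad xs f (ms @ cs @ ys)"
proof -
  let ?g = "pad ms g []"
  have g: "?g \<in> homs (ms @ cs) (ms @ ds)" using assms by (auto intro: pad_homs)
  have "pad [] f (ms @ ds) * pad as ?g [] = pad bs ?g [] * pad [] f (ms @ cs)"
    using tens_eq_pad[OF assms(1) g] by simp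
  then have "pad xs (pad [] f (ms @ ds) * pad as ?g []) ys = pad xs (pad bs ?g [] * pad [] f (ms @ cs)) ys"
    by simp
  moreover have "pad xs (pad [] f (ms @ ds) * pad as ?g []) ys = pad xs f (ms @ ds @ ys) * pad (xs @ as @ ms) g ys"
    by (subst pad_comp[of _ "as @ ms @ ds" "bs @ ms @ ds" _ "as @ ms @ cs"]) (auto intro!: pad_homs assms)
  moreover have "pad xs (pad bs ?g [] * pad [] f (ms @ cs)) ys = pad (xs @ bs @ ms) g ys * pad xs f (ms @ cs @ ys)"
    by (subst pad_comp[of _ "bs @ ms @ cs" "bs @ ms @ ds" _ "as @ ms @ cs"]) (auto intro!: pad_homs assms)
  ultimately show ?thesis by simp
qed

text \<open>In right-nested products two neighbouring factors do not form a subterm. These rules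
  apply an equation between such pairs in front of any remainder r.\<close>

lemma mult_extend: "a * b = c * d \<Longrightarrow> a * (b * r) = c * (d * (r :: webmod))"
  and mult_extend1: "a * b = c \<Longrightarrow> a * (b * r) = c * (r :: webmod)"
  by (metis mult.assoc)+

abbreviation cup :: "strand \<Rightarrow> webmod" where "cup x \<equiv> wb (Cup x)"
abbreviation cap :: "strand \<Rightarrow> webmod" where "cap x \<equiv> wb (Cap x)"

lemma cup_homs [simp]: "cup x \<in> homs [] [x, opp x]" "cup (Up k) \<in> homs [] [Up k, Dn k]" "cup (Dn k) \<in> homs [] [Dn k, Up k]"
  and cap_homs [simp]: "cap x \<in> homs [x, opp x] []" "cap (Up k) \<in> homs [Up k, Dn k] []" "cap (Dn k) \<in> homs [Dn k, Up k] []"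
  by (auto intro: homs_wb)

lemma zigzag_left: "pad xs (cap x) (x # ys) * pad (xs @ [x]) (cup (opp x)) ys = Id (xs @ x # ys)"
proof -
  have "wb (Comp (Tens (Cap x) (Ident [x])) (Tens (Ident [x]) (Cup (opp x)))) = Id [x]"
  proof (cases "x \<in> strands n")
    case True
    then show ?thesis by (intro wb_isotopic isotopic.zigzag_left) (auto simp: web_def)
  next
    case False
    then show ?thesis by (simp add: wb_not_web web_def)
  qed
  then have *: "pad [] (cap x) [x] * pad [x] (cup (opp x)) [] = Id [x]"
    by (simp add: wb_Comp wb_Tens pad_def) (metis Id_Nil_tens cap_homs(1) Id_homs homs_tens cup_homs(1) tens_Id_Nil)
  have "pad xs (cap x) (x # ys) * pad (xs @ [x]) (cup (opp x)) ys = pad xs (pad [] (cap x) [x] * pad [x] (cup (opp x)) []) ys"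
    using cup_homs(1)[of "opp x"]
    by (subst pad_comp[of _ "[x, opp x, x]" "[x]" _ "[x]"]) (auto intro!: pad_homs cap_homs cup_homs(1))
  then show ?thesis by (simp add: *)
qed

lemma zigzag_right: "pad (xs @ [x]) (cap (opp x)) ys * pad xs (cup x) (x # ys) = Id (xs @ x # ys)"
proof -
  have "wb (Comp (Tens (Ident [x]) (Cap (opp x))) (Tens (Cup x) (Ident [x]))) = Id [x]"
  proof (cases "x \<in> strands n")
    case True
    then show ?thesis by (intro wb_isotopic isotopic.zigzag_right) (auto simp: web_def)
  next
    case False
    then show ?thesis by (simp add: wb_not_web web_def)
  qed
  then have *: "pad [x] (cap (opp x)) [] * pad [] (cup x) [x] = Id [x]"
    by (simp add: wb_Comp wb_Tens pad_def) (metis Id_Nil_tens cap_homs(1) Id_homs homs_tens cup_homs(1) tens_Id_Nil)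
  have "pad (xs @ [x]) (cap (opp x)) ys * pad xs (cup x) (x # ys) = pad xs (pad [x] (cap (opp x)) [] * pad [] (cup x) [x]) ys"
    using cap_homs(1)[of "opp x"]
    by (subst pad_comp[of _ "[x, opp x, x]" "[x]" _ "[x]"]) (auto intro!: pad_homs cap_homs(1) cup_homs(1))
  then show ?thesis by (simp add: *)
qed

end


section \<open>Reflection\<close>

lemma src_flip [simp]: "src (flip D) = tgt D" and tgt_flip [simp]: "tgt (flip D) = src D"
  by (induction D) auto

lemma admissible_flip [simp]: "admissible n (flip D) \<longleftrightarrow> admissible n D"
  by (induction D) (auto simp: algebra_simps)

lemma web_flip [simp]: "web n (flip D) \<longleftrightarrow> web n D"
proof -
  have "uncrossed (flip D) = uncrossed D" "unmarked (flip D) = unmarked D"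
    by (induction D) auto
  then show ?thesis by (simp add: web_def)
qed

lemma src_mirror [simp]: "src (mirror D) = rev (src D)" and tgt_mirror [simp]: "tgt (mirror D) = rev (tgt D)"
  by (induction D) (auto simp: algebra_simps)

lemma admissible_mirror [simp]: "admissible n (mirror D) \<longleftrightarrow> admissible n D"
  by (induction D) (auto simp: algebra_simps)

lemma web_mirror [simp]: "web n (mirror D) \<longleftrightarrow> web n D"
proof -
  have "uncrossed (mirror D) = uncrossed D" "unmarked (mirror D) = unmarked D"
    by (induction D) auto
  then show ?thesis by (simp add: web_def)
qed

lemma flip_cups [simp]: "flip (cups xs) = caps xs" and flip_caps [simp]: "flip (caps xs) = cups xs"
  by (induction xs) auto

lemma isotopic_boundary:
  "isotopic n D E \<Longrightarrow> admissible n D \<and> admissible n E \<and> src D = src E \<and> tgt D = tgt E"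
proof (induction rule: isotopic.induct)
  case (comp_Id_left D)
  then show ?case using admissible_boundary by auto
next
  case (comp_Id_right D)
  then show ?case using admissible_boundary by auto
next
  case (rotation D)
  then show ?case by (simp add: admissible_rot admissible_rot')
qed auto

lemma isotopic_flip: "isotopic n D E \<Longrightarrow> isotopic n (flip D) (flip E)"
proof (induction rule: isotopic.induct)
  case (comp_assoc D E F)
  then have "isotopic n (Comp (flip F) (Comp (flip E) (flip D))) (Comp (Comp (flip F) (flip E)) (flip D))"
    by (intro isotopic.comp_assoc) auto
  then show ?case by (simp add: isotopic.sym)
next
  case (comp_Id_left D)
  then show ?case using isotopic.comp_Id_right[of n "flip D"] by simp
next
  case (comp_Id_right D)
  then show ?case using isotopic.comp_Id_left[of n "flip D"] by simp
next
  case (zigzag_left x)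
  then show ?case using isotopic.zigzag_right[of "opp x" n] isotopic.zigzag_left[of x n]
    by simp (metis isotopic.zigzag_right opp_opp)
next
  case (zigzag_right x)
  then show ?case by simp (metis isotopic.zigzag_left opp_opp)
next
  case (rotation D)
  \<comment> \<open>Reflection exchanges \<open>rot\<close> and \<open>rot'\<close>, up to the
    bracketing of the three levels.\<close>
  define A where "A = Tens (caps (dual (src D))) (Ident (dual (tgt D)))"
  define B where "B = Tens (Ident (dual (src D))) (Tens (flip D) (Ident (dual (tgt D))))"
  define C where "C = Tens (Ident (dual (src D))) (cups (tgt D))"
  define A' where "A' = Tens (Ident (dual (tgt D))) (caps (src D))"
  define B' where "B' = Tens (Ident (dual (tgt D))) (Tens (flip D) (Ident (dual (src D))))"
  define C' where "C' = Tens (cups (dual (tgt D))) (Ident (dual (src D)))"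
  have bd: "set (src D) \<subseteq> strands n" "set (tgt D) \<subseteq> strands n"
    using admissible_boundary[OF rotation] by auto
  have f: "flip (rot D) = Comp (Comp A B) C" "flip (rot' D) = Comp (Comp A' B') C'"
    "rot' (flip D) = Comp A (Comp B C)" "rot (flip D) = Comp A' (Comp B' C')"
    by (simp_all add: rot_def rot'_def A_def B_def C_def A'_def B'_def C'_def)
  have "admissible n (Comp A (Comp B C))" "admissible n (Comp A' (Comp B' C'))"
    using bd rotation by (auto simp: A_def B_def C_def A'_def B'_def C'_def)
  then have "isotopic n (flip (rot D)) (rot' (flip D))" "isotopic n (rot (flip D)) (flip (rot' D))"
    unfolding f by (auto simp del: admissible.simps intro: isotopic.comp_assoc isotopic.sym[OF isotopic.comp_assoc])
  moreover have "isotopic n (rot' (flip D)) (rot (flip D))"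
    using rotation by (intro isotopic.sym[OF isotopic.rotation]) simp
  ultimately show ?case by (blast intro: isotopic.trans)
next
  case (mark_Cup x s)
  then show ?case using isotopic.mark_Cap by simp
next
  case (mark_Cap x s)
  then show ?case using isotopic.mark_Cup by simp
qed (auto intro: isotopic.intros)

lemma linear_ext_compose:
  assumes "\<And>x y. G (x + y) = G x + G y" "\<And>c x. G (scale c x) = scale c (G x)"
  shows "G (linear_ext f x) = linear_ext (\<lambda>W. G (f W)) x"
proof -
  have G0: "G 0 = 0" using assms(2)[of 0 0] by simp
  have "G (\<Sum>W\<in>S. h W) = (\<Sum>W\<in>S. G (h W))" for h and S :: "diagram set"
    by (induction S rule: infinite_finite_induct) (simp_all add: G0 assms)
  then show ?thesis by (simp add: linear_ext_def assms)
qed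

definition lin_flip :: "nat \<Rightarrow> lin \<Rightarrow> lin" where
  "lin_flip n = linear_ext (\<lambda>W. vec n (flip W))"

lemma lin_flip_vec: "lin_flip n (vec n W) = vec n (flip W)"
  by (auto simp: lin_flip_def linear_ext_vec) (simp add: vec_def)

lemma lin_flip_add: "lin_flip n (x + y) = lin_flip n x + lin_flip n y"
  and lin_flip_scale: "lin_flip n (scale c x) = scale c (lin_flip n x)"
  and lin_flip_diff: "lin_flip n (x - y) = lin_flip n x - lin_flip n y"
  and lin_flip_0 [simp]: "lin_flip n 0 = 0"
  by (simp_all add: lin_flip_def linear_ext_add linear_ext_scale linear_ext_diff)

lemma lin_flip_comp: "lin_flip n (lin_comp n x y) = lin_comp n (lin_flip n y) (lin_flip n x)"
proof -
  have "lin_flip n (lin_comp n x y) = linear_ext (\<lambda>V. linear_ext (\<lambda>W. vec n (Comp (flip W) (flip V))) y) x"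
    by (simp add: lin_comp_def linear_ext_compose[of "lin_flip n"] lin_flip_add lin_flip_scale lin_flip_vec)
  also have "\<dots> = linear_ext (\<lambda>V. linear_ext (\<lambda>W. lin_comp n (vec n (flip W)) (vec n (flip V))) y) x"
    by (simp add: lin_comp_vec)
  also have "\<dots> = linear_ext (\<lambda>V. lin_comp n (lin_flip n y) (vec n (flip V))) x"
    unfolding lin_flip_def
    by (subst linear_ext_compose[of "\<lambda>z. lin_comp n z _"]) (simp_all add: lin_comp_add_left lin_comp_scale_left)
  also have "\<dots> = lin_comp n (lin_flip n y) (lin_flip n x)"
    using linear_ext_compose[of "\<lambda>z. lin_comp n (lin_flip n y) z" "\<lambda>W. vec n (flip W)" x]
    by (simp add: lin_comp_add_right lin_comp_scale_right lin_flip_def)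
  finally show ?thesis .
qed

lemma lin_flip_tens: "lin_flip n (lin_tens n x y) = lin_tens n (lin_flip n x) (lin_flip n y)"
proof -
  have "lin_flip n (lin_tens n x y) = linear_ext (\<lambda>V. linear_ext (\<lambda>W. vec n (Tens (flip V) (flip W))) y) x"
    by (simp add: lin_tens_def linear_ext_compose[of "lin_flip n"] lin_flip_add lin_flip_scale lin_flip_vec)
  also have "\<dots> = linear_ext (\<lambda>V. linear_ext (\<lambda>W. lin_tens n (vec n (flip V)) (vec n (flip W))) y) x"
    by (simp add: lin_tens_vec)
  also have "\<dots> = linear_ext (\<lambda>V. lin_tens n (vec n (flip V)) (lin_flip n y)) x"
    unfolding lin_flip_def
    by (subst linear_ext_compose[of "\<lambda>z. lin_tens n _ z"]) (simp_all add: lin_tens_add_right lin_tens_scale_right)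
  also have "\<dots> = lin_tens n (lin_flip n x) (lin_flip n y)"
    using linear_ext_compose[of "\<lambda>z. lin_tens n z (lin_flip n y)" "\<lambda>W. vec n (flip W)" x]
    by (simp add: lin_tens_add_left lin_tens_scale_left lin_flip_def)
  finally show ?thesis .
qed

lemma nulls_lin_flip: "x \<in> nulls n \<Longrightarrow> lin_flip n x \<in> nulls n"
proof (induction rule: null_webs.induct)
  case (isotopy V W)
  then show ?case by (simp add: lin_flip_diff lin_flip_vec vec_isotopic isotopic_flip)
next
  case (relation x)
  then show ?case unfolding lin_flip_def by (intro null_webs.relation relations.flip)
qed (simp_all add: null_webs.intros lin_flip_add lin_flip_scale lin_flip_comp lin_flip_tens lin_flip_vec)

lemma free_webs_lin_flip: "x \<in> free_webs n \<Longrightarrow> lin_flip n x \<in> free_webs n"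
  by (induction x rule: free_webs_induct)
    (auto simp: lin_flip_add lin_flip_scale lin_flip_vec intro!: free_webs_0 free_webs_add free_webs_scale free_webs_vec)

text \<open>A linear anti-automorphism for the product; it carries each result about merges over to
  splits.\<close>

lift_definition flp :: "webmod \<Rightarrow> webmod" is "\<lambda>f n. lin_flip n (f n)"
  by (auto simp: web_rel_def lin_flip_diff[symmetric] intro: free_webs_lin_flip nulls_lin_flip)

lemma flp_add: "flp (f + g) = flp f + flp g"
  and flp_mult: "flp (f * g) = flp g * flp f"
  and flp_tens: "flp (f \<otimes> g) = flp f \<otimes> flp g"
  and flp_smult [simp]: "flp (c \<cdot> f) = c \<cdot> flp f"
  and flp_0 [simp]: "flp 0 = 0"
  by (transfer; auto simp: web_rel_def lin_flip_add lin_flip_comp lin_flip_tens lin_flip_scale null_webs.zero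
      intro!: free_webs_lin_flip free_webs_add free_webs_lin_comp free_webs_lin_tens free_webs_scale free_webs_0)+

lemma flp_sum: "flp (\<Sum>i\<in>S. f i) = (\<Sum>i\<in>S. flp (f i))"
  by (induction S rule: infinite_finite_induct) (simp_all add: flp_add)

lemma flp_cls: "x \<in> free_webs n \<Longrightarrow> flp (cls n x) = cls n (lin_flip n x)"
  by transfer (auto simp: web_rel_def free_webs_0 free_webs_lin_flip null_webs.zero)

context webs
begin

lemma flp_wb [simp]: "flp (wb D) = wb (flip D)"
  by (simp add: wb_def flp_cls free_webs_vec lin_flip_vec)

lemma flp_pad: "flp (pad xs f ys) = pad xs (flp f) ys"
  by (simp add: pad_def flp_tens)


section \<open>Rotation\<close>

text \<open>The linear counterpart of \<open>rot\<close>, as \<open>rotr\<close> is of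
  \<open>rot'\<close>. It is needed because crossings are combinations of webs.\<close>

definition rotl :: "strand list \<Rightarrow> strand list \<Rightarrow> webmod \<Rightarrow> webmod" where
  "rotl xs ys f = pad (dual xs) (wb (caps ys)) [] * pad (dual xs) f (dual ys) * pad [] (wb (cups (dual xs))) (dual ys)"

definition rotr :: "strand list \<Rightarrow> strand list \<Rightarrow> webmod \<Rightarrow> webmod" where
  "rotr xs ys f = pad [] (wb (caps (dual ys))) (dual xs) * pad (dual ys) f (dual xs) * pad (dual ys) (wb (cups xs)) []"

lemma cups_homs [simp]: "wb (cups xs) \<in> homs [] (xs @ dual xs)"
  and caps_homs [simp]: "wb (caps xs) \<in> homs (xs @ dual xs) []"
  by (auto intro: homs_wb)

lemma tens_caps_Id_Nil [simp]: "wb (caps xs) \<otimes> Id [] = wb (caps xs)"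
    "wb (cups xs) \<otimes> Id [] = wb (cups xs)"
    "Id [] \<otimes> wb (caps xs) \<otimes> Id ys = wb (caps xs) \<otimes> Id ys"
    "Id [] \<otimes> wb (cups xs) \<otimes> Id ys = wb (cups xs) \<otimes> Id ys"
  by (rule tens_Id_Nil[OF caps_homs] tens_Id_Nil[OF cups_homs]
      Id_Nil_tens[OF homs_tens[OF caps_homs Id_homs]] Id_Nil_tens[OF homs_tens[OF cups_homs Id_homs]])+

lemma rotl_eq_rotr: "f \<in> homs xs ys \<Longrightarrow> rotl xs ys f = rotr xs ys f"
proof (induction f rule: homs_induct)
  case (add g c D)
  have "wb (rot D) = wb (rot' D)"
    using add by (intro wb_isotopic isotopic.rotation web_rot web_rot') (auto simp: web_def)
  with add show ?case
    by (simp add: rotl_def rotr_def pad_add distrib_left distrib_right)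
       (simp add: pad_def rot_def rot'_def wb_Comp wb_Tens mult.assoc)
qed (simp add: rotl_def rotr_def)


section \<open>Evaluation of diagrams\<close>

text \<open>Framing marks are ignored here; they contribute the separate factor \<open>mark_scalar\<close>.\<close>

primrec ev :: "diagram \<Rightarrow> webmod" where
  "ev (Ident xs) = Id xs"
| "ev (Cup x) = cup x"
| "ev (Cap x) = cap x"
| "ev (Merge k l) = wb (Merge k l)"
| "ev (Split k l) = wb (Split k l)"
| "ev (Cross s k l) = cls n (ladder_crossing n s k l)"
| "ev (Mark s x) = Id [x]"
| "ev (Comp D E) = ev D * ev E"
| "ev (Tens D E) = ev D \<otimes> ev E"

lemma ev_uncrossed: "uncrossed D \<Longrightarrow> unmarked D \<Longrightarrow> ev D = wb D"
  by (induction D) (auto simp: wb_Comp wb_Tens)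

end

lemma split0_boundary: "admissible n (split0 a b) \<Longrightarrow> src (split0 a b) = up (a + b) \<and> tgt (split0 a b) = up a @ up b"
  by (auto simp: split0_def up_def)

lemma merge0_boundary: "admissible n (merge0 a b) \<Longrightarrow> tgt (merge0 a b) = up (a + b) \<and> src (merge0 a b) = up a @ up b"
  by (auto simp: merge0_def up_def)

lemma ladE_boundary: "admissible n (ladE s k l) \<Longrightarrow> src (ladE s k l) = up k @ up l \<and> tgt (ladE s k l) = up (k - s) @ up (l + s)"
  and ladF_boundary: "admissible n (ladF s k l) \<Longrightarrow> src (ladF s k l) = up k @ up l \<and> tgt (ladF s k l) = up (k + s) @ up (l - s)"
  using merge0_boundary[of n s l] split0_boundary[of n "k - s" s] merge0_boundary[of n k s] split0_boundary[of n s "l - s"]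
  by (auto simp: ladE_def ladF_def algebra_simps)

lemma Zq_sign: "(- 1) powi m \<in> Zq"
  by (auto simp: power_int_def minus_one_power_iff Zq_1 Zq_minus)

lemma ladder_crossing_lin_webs:
  assumes "k \<noteq> 0" "l \<noteq> 0"
  shows "ladder_crossing n s k l \<in> lin_webs Zq n [Up k, Up l] [Up l, Up k]"
proof -
  have up: "up k = [Up k]" "up l = [Up l]" using assms by (auto simp: up_def)
  have "vec n (Comp (ladE a (k - c + b) (l + c - b)) (Comp (ladF b (k - c) (l + c)) (ladE c k l)))
    \<in> lin_webs Zq n [Up k, Up l] [Up l, Up k]" if "a - b + c = k - l" for a b c
  proof -
    \<comment> \<open>The summation condition says precisely that the labels are exchanged at the
      top.\<close>
    have "k - c + b - a = l" "l + c - b + a = k" using that by auto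
    then show ?thesis
      using ladE_boundary[of n a "k - c + b" "l + c - b"] ladE_boundary[of n c k l]
      by (intro lin_webs_vec) (auto simp: web_def up)
  qed
  moreover have "vec n (Comp (ladF a (k + c - b) (l - c + b)) (Comp (ladE b (k + c) (l - c)) (ladF c k l)))
    \<in> lin_webs Zq n [Up k, Up l] [Up l, Up k]" if "a - b + c = l - k" for a b c
  proof -
    have "k + c - b + a = l" "l - c + b - a = k" using that by auto
    then show ?thesis
      using ladF_boundary[of n a "k + c - b" "l - c + b"] ladF_boundary[of n c k l]
      by (intro lin_webs_vec) (auto simp: web_def up)
  qed
  ultimately show ?thesis
    unfolding ladder_crossing_def
    by (auto intro!: lin_webs_sum lin_webs_scale Zq_mult Zq_sign Zq_q_powi)
qed

context webs
begin

lemma ev_homs: "admissible n D \<Longrightarrow> ev D \<in> homs (src D) (tgt D)"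
proof (induction D)
  case (Cross s k l)
  then have "ladder_crossing n s k l \<in> lin_webs Zq n [Up k, Up l] [Up l, Up k]"
    by (intro ladder_crossing_lin_webs) (auto simp: strands_def)
  then show ?case by (simp add: homs_def)
qed (auto intro: homs_comp homs_tens homs_wb)

lemma ev_rot: "admissible n D \<Longrightarrow> ev (rot D) = rotl (src D) (tgt D) (ev D)"
  by (simp add: rot_def rotl_def pad_def ev_uncrossed mult.assoc)

lemma ev_rot': "admissible n D \<Longrightarrow> ev (rot' D) = rotr (src D) (tgt D) (ev D)"
  by (simp add: rot'_def rotr_def pad_def ev_uncrossed mult.assoc)

text \<open>Every generating isotopy holds for arbitrary elements of \<open>homs\<close> in place of
  webs. A crossing is one of these, so nothing has to be known about its expansion.\<close>

lemma ev_isotopic: "isotopic n D E \<Longrightarrow> ev D = ev E"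
proof (induction rule: isotopic.induct)
  case (comp_Id_left D) then show ?case using Id_comp[OF ev_homs] by simp
next
  case (comp_Id_right D) then show ?case using comp_Id[OF ev_homs] by simp
next
  case (tens_Id_left D) then show ?case using Id_Nil_tens[OF ev_homs] by simp
next
  case (tens_Id_right D) then show ?case using tens_Id_Nil[OF ev_homs] by simp
next
  case (interchange D D' E E')
  then show ?case using tens_interchange[of "ev D" "src D" "tgt D" "ev D'" "src D'" "ev E" "src E" "tgt E" "ev E'" "src E'"]
      ev_homs[of D] ev_homs[of D'] ev_homs[of E] ev_homs[of E'] by simp
next
  case (zigzag_left x)
  then have "wb (Comp (Tens (Cap x) (Ident [x])) (Tens (Ident [x]) (Cup (opp x)))) = Id [x]"
    by (intro wb_isotopic isotopic.zigzag_left) (auto simp: web_def)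
  then show ?case by (simp add: wb_Comp wb_Tens)
next
  case (zigzag_right x)
  then have "wb (Comp (Tens (Ident [x]) (Cap (opp x))) (Tens (Cup x) (Ident [x]))) = Id [x]"
    by (intro wb_isotopic isotopic.zigzag_right) (auto simp: web_def)
  then show ?case by (simp add: wb_Comp wb_Tens)
next
  case (rotation D)
  then show ?case using rotl_eq_rotr[OF ev_homs] by (simp add: ev_rot ev_rot')
next
  case (mark_Cup x s) then show ?case by simp
next
  case (mark_Cap x s) then show ?case by simp
qed (auto simp: mult.assoc tens_assoc)

end

primrec mark_scalar :: "nat \<Rightarrow> diagram \<Rightarrow> scalar" where
  "mark_scalar n (Ident xs) = 1"
| "mark_scalar n (Cup x) = 1"
| "mark_scalar n (Cap x) = 1"
| "mark_scalar n (Merge k l) = 1"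
| "mark_scalar n (Split k l) = 1"
| "mark_scalar n (Cross s k l) = 1"
| "mark_scalar n (Mark s x) = (if s then framing n (label x) else inverse (framing n (label x)))"
| "mark_scalar n (Comp D E) = mark_scalar n D * mark_scalar n E"
| "mark_scalar n (Tens D E) = mark_scalar n D * mark_scalar n E"

lemma mark_scalar_unmarked: "unmarked D \<Longrightarrow> mark_scalar n D = 1"
  by (induction D) auto

lemma mark_scalar_cups [simp]: "mark_scalar n (cups xs) = 1" and mark_scalar_caps [simp]: "mark_scalar n (caps xs) = 1"
  by (simp_all add: mark_scalar_unmarked)

lemma mark_scalar_isotopic: "isotopic n D E \<Longrightarrow> mark_scalar n D = mark_scalar n E"
  by (induction rule: isotopic.induct) (auto simp: rot_def rot'_def)

context webs
begin

text \<open>The marks form a single scalar in front, and what remains has coefficients in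
  \<open>Zq\<close>. This is why one computation over \<open>Zq\<close> settles both coefficient
  rings.\<close>

lemma resolve_eq:
  "admissible n D \<Longrightarrow> \<exists>x\<in>free_webs n. resolve n (ladder_crossing n) D = scale (mark_scalar n D) x \<and> cls n x = ev D"
proof (induction D)
  case (Comp D E)
  then obtain x y where *: "x \<in> free_webs n" "y \<in> free_webs n" "cls n x = ev D" "cls n y = ev E"
    "resolve n (ladder_crossing n) D = scale (mark_scalar n D) x" "resolve n (ladder_crossing n) E = scale (mark_scalar n E) y"
    by auto
  show ?case
    by (rule bexI[of _ "lin_comp n x y"])
      (simp_all add: * lin_comp_scale_left lin_comp_scale_right cls_lin_comp free_webs_lin_comp mult.commute)
next
  case (Tens D E)
  then obtain x y where *: "x \<in> free_webs n" "y \<in> free_webs n" "cls n x = ev D" "cls n y = ev E"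
    "resolve n (ladder_crossing n) D = scale (mark_scalar n D) x" "resolve n (ladder_crossing n) E = scale (mark_scalar n E) y"
    by auto
  show ?case
    by (rule bexI[of _ "lin_tens n x y"])
      (simp_all add: * lin_tens_scale_left lin_tens_scale_right cls_lin_tens free_webs_lin_tens mult.commute)
next
  case (Cross s k l)
  then have "ladder_crossing n s k l \<in> free_webs n"
    using ladder_crossing_lin_webs[of k l n s] lin_webs_subset by (auto simp: strands_def)
  then show ?case by auto
qed (auto simp: wb_def intro!: bexI[of _ "vec n _"] free_webs_vec)

end


section \<open>Divided power relations for ladders with two uprights\<close>

text \<open>The two ranges need not correspond: it is enough that unmatched terms vanish, as
  binomials and ladders with entries out of range do.\<close>

lemma sum_reflect:
  fixes G :: "int \<Rightarrow> 'a :: comm_monoid_add"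
  assumes "\<And>j. j \<in> A \<Longrightarrow> c - j \<notin> B \<Longrightarrow> G j = 0" "\<And>u. u \<in> B \<Longrightarrow> c - u \<notin> A \<Longrightarrow> G (c - u) = 0"
    and "finite A" "finite B"
  shows "(\<Sum>j\<in>A. G j) = (\<Sum>u\<in>B. G (c - u))"
proof (rule sum.reindex_bij_witness_not_neutral[where i = "\<lambda>u. c - u" and j = "\<lambda>j. c - j"
      and S' = "{j \<in> A. c - j \<notin> B}" and T' = "{u \<in> B. c - u \<notin> A}"])
qed (use assms in auto)

lemma sum_translate:
  fixes G :: "int \<Rightarrow> 'a :: comm_monoid_add"
  assumes "\<And>j. j \<in> A \<Longrightarrow> j + c \<notin> B \<Longrightarrow> G j = 0" "\<And>u. u \<in> B \<Longrightarrow> u - c \<notin> A \<Longrightarrow> G (u - c) = 0"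
    and "finite A" "finite B"
  shows "(\<Sum>j\<in>A. G j) = (\<Sum>u\<in>B. G (u - c))"
proof (rule sum.reindex_bij_witness_not_neutral[where i = "\<lambda>u. u - c" and j = "\<lambda>j. j + c"
      and S' = "{j \<in> A. j + c \<notin> B}" and T' = "{u \<in> B. u - c \<notin> A}"])
qed (use assms in auto)

lemma mv_minus: "mv s (a - b) = mv s a * mv (- s) b"
  by (simp add: mv_def par_diff right_diff_distrib qp_mult mult.left_commute[of "qp _" "par _"] mult.assoc)

lemma qbinom_uminus: "qbinom (- m) t = (- 1) ^ t * qbinom (m + int t - 1) t"
proof (induction t)
  case (Suc t)
  have "qint (- x) = - qint x" for x by (simp add: qint_def minus_divide_left)
  from this[of "m + int t"] have "qint (- m - int t) = - qint (m + int t)" by simp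
  moreover have "qbinom (m + int t) (Suc t) = qint (m + int t) / qint (int (Suc t)) * qbinom (m + int t - 1) t"
    using qbinom_Suc'[of "m + int t - 1" t] by simp
  moreover have "m + int (Suc t) - 1 = m + int t" by simp
  ultimately show ?case using Suc by (simp only: qbinom_Suc[of "- m"]) simp
qed simp

text \<open>Trades the upper entry a - k, which can have either sign, for one containing k - a in
  \<open>coefficient_exchange\<close>.\<close>

lemma qb_uminus: "qb (- m) t = par t * qb (m + t - 1) t"
proof (cases "t < 0")
  case False
  then obtain u where u: "t = int u" using zero_le_imp_eq_int[of t] by auto
  have "qbz (- m) u = (- 1) ^ u * qbz (m + int u - 1) u"
    by transfer (rule qbinom_uminus)
  moreover have "(- 1 :: zq) ^ u = par (int u)" by (simp add: par_def)
  ultimately show ?thesis by (simp add: qb_def u)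
qed simp

text \<open>(W4), (W5) and their mirror images for ladders on two uprights. The axioms are symmetric
  under exchange of left and right, so the locale is interpreted twice; the mirrored copy yields the
  negative crossing and the case k > l of invertibility.\<close>

locale ladder_pair =
  fixes n :: nat and e f :: "int \<Rightarrow> int \<Rightarrow> int \<Rightarrow> webmod" and i :: "int \<Rightarrow> int \<Rightarrow> webmod"
  assumes ee: "e r (k - s) (l + s) * e s k l = qb (r + s) r \<cdot> e (r + s) k l"
    and ff: "f r (k + s) (l - s) * f s k l = qb (r + s) r \<cdot> f (r + s) k l"
    and fe: "f r (k - s) (l + s) * e s k l =
      (\<Sum>t\<in>{0..min r s}. qb (k - l + r - s) t \<cdot> (e (s - t) (k + r - t) (l - r + t) * f (r - t) k l))"
    and ef: "e r (k + s) (l - s) * f s k l =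
      (\<Sum>t\<in>{0..min r s}. qb (l - k + r - s) t \<cdot> (f (s - t) (k - r + t) (l + r - t) * e (r - t) k l))"
    and e_0: "e 0 k l = i k l" and f_0: "f 0 k l = i k l"
    and e_i: "e s k l * i k l = e s k l" and f_i: "f s k l * i k l = f s k l"
    and e_zero: "s < 0 \<or> k < s \<or> l < 0 \<or> int n < k \<or> int n < l + s \<Longrightarrow> e s k l = 0"
    and f_zero: "s < 0 \<or> l < s \<or> k < 0 \<or> int n < l \<or> int n < k + s \<Longrightarrow> f s k l = 0"
begin

text \<open>The binomials in this square switch have upper entry k - l + (l - j) - (k - j) = 0, so
  only t = 0 survives.\<close>

lemma balance: "f (l - j) j (k + l - j) * e (k - j) k l = e (k - j) (k + l - j) j * f (l - j) k l"
proof (cases "j \<le> k \<and> j \<le> l")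
  case True
  have "f (l - j) j (k + l - j) * e (k - j) k l = f (l - j) (k - (k - j)) (l + (k - j)) * e (k - j) k l"
    by (simp add: algebra_simps)
  also have "\<dots> = (\<Sum>t\<in>{0..min (l - j) (k - j)}. qb 0 t \<cdot> (e (k - j - t) (k + (l - j) - t) (l - (l - j) + t) * f (l - j - t) k l))"
  proof -
    have "k - l + (l - j) - (k - j) = 0" by simp
    then show ?thesis by (simp only: fe)
  qed
  also have "\<dots> = (\<Sum>t\<in>{0}. qb 0 t \<cdot> (e (k - j - t) (k + (l - j) - t) (l - (l - j) + t) * f (l - j - t) k l))"
    using True by (intro sum.mono_neutral_right) (auto simp: qb_0_left)
  finally show ?thesis by (simp add: algebra_simps)
qed (auto simp: e_zero f_zero)

text \<open>The labels are (k, l) at the bottom, (j, k + l - j) in the middle and (l, k) at the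
  top.\<close>

definition P :: "int \<Rightarrow> int \<Rightarrow> int \<Rightarrow> webmod" where
  "P j k l = f (l - j) j (k + l - j) * e (k - j) k l"

lemma P_zero: "j < 0 \<or> k < j \<or> l < j \<or> int n < k \<or> int n < l \<or> int n < k + l - j \<Longrightarrow> P j k l = 0"
  by (auto simp: P_def e_zero f_zero)

text \<open>The crossing with v = q^s: s = -1 is the positive and s = 1 the negative one. The bound
  n is harmless, as \<open>P\<close> vanishes for j above k or l.\<close>

definition X :: "int \<Rightarrow> int \<Rightarrow> int \<Rightarrow> webmod" where
  "X s k l = (\<Sum>j\<in>{0..int n}. mv s j \<cdot> P j k l)"

lemma X_restrict: "m = k \<or> m = l \<Longrightarrow> X s k l = (\<Sum>j\<in>{0..m}. mv s j \<cdot> P j k l)"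
proof -
  assume m: "m = k \<or> m = l"
  have "X s k l = (\<Sum>j\<in>{0..int n} \<inter> {0..m}. mv s j \<cdot> P j k l)"
    unfolding X_def using m by (intro sum.mono_neutral_right) (auto simp: P_zero)
  also have "\<dots> = (\<Sum>j\<in>{0..m}. mv s j \<cdot> P j k l)"
    using m by (intro sum.mono_neutral_left) (auto simp: P_zero)
  finally show ?thesis .
qed

text \<open>Written as E F F E, a product of two \<open>P\<close> is reduced by merging the F rungs,
  switching E past F and merging the E rungs. The coefficients are then summed in two stages, by
  \<open>qb_sum_shifted\<close> and by \<open>qb_sum_alternating\<close>. The assumption k \<le> l
  keeps the entry l - a nonnegative.\<close>

lemma X_inverse:
  assumes s: "s = 1 \<or> s = - 1" and kl: "0 \<le> k" "k \<le> l"
  shows "X (- s) l k * X s k l = i k l"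
proof -
  \<comment> \<open>The family in which products of two \<open>P\<close> are expanded; B 0 is the
    identity and all other coefficients must cancel.\<close>
  define B where "B u = f u (k - u) (l + u) * e u k l" for u
  have B_zero: "B u = 0" if "u < 0 \<or> k < u" for u using that by (auto simp: B_def e_zero)
  have PP: "P j l k * P a k l = (\<Sum>t\<in>{0..l - a}.
      (qb (k + l - a - j) (k - j) * qb (l - a) t * qb (k + l - a - j - t) (l - j - t)) \<cdot> B (k + l - a - j - t))"
    if "0 \<le> a" "a \<le> k" "0 \<le> j" "j \<le> k" for a j
  proof -
    have ff': "f (k - j) l k * f (l - a) a (k + l - a) = qb (k + l - a - j) (k - j) \<cdot> f (k + l - a - j) a (k + l - a)"
      using ff[of "k - j" a "l - a" "k + l - a"] by (simp add: algebra_simps)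
    have ef': "e (l - j) (k + l - j) j * f (k + l - a - j) a (k + l - a) =
      (\<Sum>t\<in>{0..min (l - j) (k + l - a - j)}. qb (l - a) t \<cdot>
        (f (k + l - a - j - t) (a - (l - j) + t) (k + l - a + (l - j) - t) * e (l - j - t) a (k + l - a)))"
      using ef[of "l - j" a "k + l - a - j" "k + l - a"] by (simp add: algebra_simps)
    have ee': "e (l - j - t) a (k + l - a) * e (k - a) k l = qb (k + l - a - j - t) (l - j - t) \<cdot> e (k + l - a - j - t) k l" for t
      using ee[of "l - j - t" k "k - a" l] by (simp add: algebra_simps)
    have "P j l k * P a k l = e (l - j) (k + l - j) j * (f (k - j) l k * f (l - a) a (k + l - a)) * e (k - a) k l"
      unfolding P_def using balance[of k j l] by (simp add: mult.assoc add.commute)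
    also have "\<dots> = (\<Sum>t\<in>{0..min (l - j) (k + l - a - j)}. (qb (k + l - a - j) (k - j) * qb (l - a) t * qb (k + l - a - j - t) (l - j - t)) \<cdot>
         (f (k + l - a - j - t) (a - (l - j) + t) (k + l - a + (l - j) - t) * e (k + l - a - j - t) k l))"
      by (simp add: ff' ef' smult_sum sum_distrib_right mult.assoc ee')
    also have "\<dots> = (\<Sum>t\<in>{0..min (l - j) (k + l - a - j)}. (qb (k + l - a - j) (k - j) * qb (l - a) t * qb (k + l - a - j - t) (l - j - t)) \<cdot>
         B (k + l - a - j - t))"
      by (intro sum.cong HOL.refl) (simp add: B_def algebra_simps)
    also have "\<dots> = (\<Sum>t\<in>{0..min (l - j) (k + l - a - j)} \<inter> {0..l - a}. (qb (k + l - a - j) (k - j) * qb (l - a) t * qb (k + l - a - j - t) (l - j - t)) \<cdot>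
         B (k + l - a - j - t))"
      using that kl by (intro sum.mono_neutral_right) (auto simp: qb_zero)
    also have "\<dots> = (\<Sum>t\<in>{0..l - a}. (qb (k + l - a - j) (k - j) * qb (l - a) t * qb (k + l - a - j - t) (l - j - t)) \<cdot>
         B (k + l - a - j - t))"
      using that kl by (intro sum.mono_neutral_left) (auto simp: B_zero not_le)
    finally show ?thesis .
  qed
  have inner: "(\<Sum>j\<in>{0..k}. mv (- s) j \<cdot> (P j l k * P a k l)) =
     (\<Sum>u\<in>{0..k}. (mv (- s) (l - a + k - u) * par (l - a) * qp (s * ((l - a) * (u + 1))) * qb u (u - (k - a))) \<cdot> B u)"
    if a: "0 \<le> a" "a \<le> k" for a
  proof -
    define p where "p = l - a"
    have p: "0 \<le> p" using a kl by (simp add: p_def)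
    define g where "g j t = mv (- s) j * (qb (p + k - j) (k - j) * qb p t * qb (p + k - j - t) (l - j - t))" for j t
    have "(\<Sum>j\<in>{0..k}. mv (- s) j \<cdot> (P j l k * P a k l)) = (\<Sum>j\<in>{0..k}. \<Sum>t\<in>{0..p}. g j t \<cdot> B (p + k - t - j))"
    proof (rule sum.cong[OF HOL.refl])
      fix j assume j: "j \<in> {0..k}"
      have eqs: "k + l - a - j = p + k - j" "l - a = p" "p + k - t - j = p + k - j - t" for t by (auto simp: p_def)
      show "mv (- s) j \<cdot> (P j l k * P a k l) = (\<Sum>t\<in>{0..p}. g j t \<cdot> B (p + k - t - j))"
        using PP[OF a, of j] j by (simp only: eqs smult_sum smult_smult g_def atLeastAtMost_iff)
    qed
    also have "\<dots> = (\<Sum>t\<in>{0..p}. \<Sum>j\<in>{0..k}. g j t \<cdot> B (p + k - t - j))"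
      by (rule sum.swap)
    also have "\<dots> = (\<Sum>t\<in>{0..p}. \<Sum>u\<in>{0..k}. g (p + k - t - u) t \<cdot> B u)"
    proof (rule sum.cong[OF HOL.refl])
      fix t assume t: "t \<in> {0..p}"
      have "(\<Sum>j\<in>{0..k}. g j t \<cdot> B (p + k - t - j)) = (\<Sum>u\<in>{0..k}. g (p + k - t - u) t \<cdot> B (p + k - t - (p + k - t - u)))"
      proof (rule sum_reflect)
        fix j assume "j \<in> {0..k}" "p + k - t - j \<notin> {0..k}"
        then show "g j t \<cdot> B (p + k - t - j) = 0" by (auto simp: B_zero not_le)
      next
        fix u assume "u \<in> {0..k}" "p + k - t - u \<notin> {0..k}"
        then show "g (p + k - t - u) t \<cdot> B (p + k - t - (p + k - t - u)) = 0" using t by (auto simp: g_def)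
      qed auto
      then show "(\<Sum>j\<in>{0..k}. g j t \<cdot> B (p + k - t - j)) = (\<Sum>u\<in>{0..k}. g (p + k - t - u) t \<cdot> B u)" by simp
    qed
    also have "\<dots> = (\<Sum>u\<in>{0..k}. (\<Sum>t\<in>{0..p}. g (p + k - t - u) t) \<cdot> B u)"
      by (subst sum.swap) (simp add: smult_sum_left)
    also have "\<dots> = (\<Sum>u\<in>{0..k}. (mv (- s) (p + k - u) * par p * qp (s * (p * (u + 1))) * qb u (u - (k - a))) \<cdot> B u)"
    proof (intro sum.cong HOL.refl arg_cong[where f = "\<lambda>c. c \<cdot> _"])
      fix u assume u: "u \<in> {0..k}"
      \<comment> \<open>With u fixed, symmetry of one binomial exposes the Vandermonde sum in
        t.\<close>
      have "(\<Sum>t\<in>{0..p}. g (p + k - t - u) t) = (\<Sum>t\<in>{0..p}. mv (- s) (p + k - u) * qb u (u - (k - a)) * (mv s t * qb (u + t) p * qb p t))"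
      proof (intro sum.cong HOL.refl)
        fix t assume t: "t \<in> {0..p}"
        have e1: "mv (- s) (p + k - t - u) = mv (- s) (p + k - u) * mv s t"
          using mv_minus[of "- s" "p + k - u" t] by (simp add: algebra_simps)
        have e2: "qb (u + t) (u + t - p) = qb (u + t) p" using u t by (intro qb_sym) auto
        have e3: "p + k - (p + k - t - u) = u + t" "k - (p + k - t - u) = u + t - p" "u + t - t = u"
          "l - (p + k - t - u) - t = u - (k - a)" by (auto simp: p_def)
        show "g (p + k - t - u) t = mv (- s) (p + k - u) * qb u (u - (k - a)) * (mv s t * qb (u + t) p * qb p t)"
          unfolding g_def by (simp only: e1 e2 e3 mult_ac)
      qed
      also have "\<dots> = mv (- s) (p + k - u) * qb u (u - (k - a)) * (par p * qp (s * (p * (u + 1))))"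
        using a kl by (simp only: qb_sum_shifted[OF s p] flip: sum_distrib_left)
      finally show "(\<Sum>t\<in>{0..p}. g (p + k - t - u) t) = mv (- s) (p + k - u) * par p * qp (s * (p * (u + 1))) * qb u (u - (k - a))"
        by (simp add: mult_ac)
    qed
    finally show ?thesis by (simp add: p_def)
  qed
  have coeff: "(\<Sum>a\<in>{0..k}. mv s a * (mv (- s) (l - a + k - u) * par (l - a) * qp (s * ((l - a) * (u + 1))) * qb u (u - (k - a)))) =
      (if u = 0 then 1 else 0)" if u: "u \<in> {0..k}" for u
  proof -
    \<comment> \<open>With a = k - m the remaining sum is the alternating one with upper entry u,
      which is nonzero only for u = 0.\<close>
    have "(\<Sum>a\<in>{0..k}. mv s a * (mv (- s) (l - a + k - u) * par (l - a) * qp (s * ((l - a) * (u + 1))) * qb u (u - (k - a)))) =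
      (\<Sum>m\<in>{0..u}. mv s (k - m) * (mv (- s) (l - (k - m) + k - u) * par (l - (k - m)) * qp (s * ((l - (k - m)) * (u + 1))) * qb u (u - (k - (k - m)))))"
      using u by (intro sum_reflect) (auto simp: not_le)
    also have "\<dots> = (\<Sum>m\<in>{0..u}. par u * qp (s * (u + (l - k) * u)) * (par m * qp (s * (m * (u - 1))) * qb u m))"
    proof (intro sum.cong HOL.refl)
      fix m assume m: "m \<in> {0..u}"
      have "qb u (u - m) = qb u m" using u by (intro qb_sym) auto
      moreover have "par (k - m) * par (l - (k - m) + k - u) * par (l - (k - m)) = par u * par m"
        unfolding par_mult by (rule par_cong) (simp add: algebra_simps)
      moreover have "qp (s * (k - m)) * qp ((- s) * (l - (k - m) + k - u)) * qp (s * ((l - (k - m)) * (u + 1))) =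
        qp (s * (u + (l - k) * u)) * qp (s * (m * (u - 1)))"
        unfolding qp_mult by (rule arg_cong[where f = qp]) (simp add: algebra_simps)
      ultimately have "par (k - m) * par (l - (k - m) + k - u) * par (l - (k - m)) *
         (qp (s * (k - m)) * qp ((- s) * (l - (k - m) + k - u)) * qp (s * ((l - (k - m)) * (u + 1)))) * qb u (u - m) =
         par u * par m * (qp (s * (u + (l - k) * u)) * qp (s * (m * (u - 1)))) * qb u m" by simp
      then show "mv s (k - m) * (mv (- s) (l - (k - m) + k - u) * par (l - (k - m)) * qp (s * ((l - (k - m)) * (u + 1))) * qb u (u - (k - (k - m))))
         = par u * qp (s * (u + (l - k) * u)) * (par m * qp (s * (m * (u - 1))) * qb u m)"
        by (simp add: mv_def mult_ac)
    qed
    also have "\<dots> = (if u = 0 then 1 else 0)"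
      using u by (simp only: qb_sum_alternating[OF s] atLeastAtMost_iff flip: sum_distrib_left) auto
    finally show ?thesis .
  qed
  have "X (- s) l k * X s k l = (\<Sum>a\<in>{0..k}. mv s a \<cdot> (\<Sum>j\<in>{0..k}. mv (- s) j \<cdot> (P j l k * P a k l)))"
    by (simp add: X_restrict[of k l k] X_restrict[of k k l] sum_product smult_sum mult.commute)
       (rule sum.swap)
  also have "\<dots> = (\<Sum>a\<in>{0..k}. \<Sum>u\<in>{0..k}. (mv s a * (mv (- s) (l - a + k - u) * par (l - a) * qp (s * ((l - a) * (u + 1))) * qb u (u - (k - a)))) \<cdot> B u)"
    by (intro sum.cong HOL.refl) (simp add: inner smult_sum)
  also have "\<dots> = (\<Sum>u\<in>{0..k}. (if u = 0 then 1 else 0) \<cdot> B u)"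
    by (subst sum.swap) (simp add: coeff flip: smult_sum_left)
  also have "\<dots> = B 0" using kl by (subst sum.mono_neutral_right[of _ "{0}"]) auto
  also have "\<dots> = i k l" using f_i[of 0 k l] by (simp add: B_def e_0 f_0)
  finally show ?thesis .
qed

text \<open>Switching E^(a) past F^(b) and merging the two E rungs expands each term in the
  \<open>P\<close>. For fixed c and j the sum over the switching index t is alternating with upper
  entry c, so only c = 0 contributes.\<close>

lemma triple_sum:
  assumes s: "s = 1 \<or> s = - 1" and kl: "0 \<le> k" "k \<le> int n" "0 \<le> l" "l \<le> int n"
  shows "(\<Sum>(a, b, c) \<in> {(a, b, c). a \<in> {0..int n} \<and> b \<in> {0..int n} \<and> c \<in> {0..int n} \<and> a - b + c = k - l}.
      (par (b - l) * qp (s * (a * c - b + l))) \<cdot> (e a (k - c + b) (l + c - b) * (f b (k - c) (l + c) * e c k l))) = X s k l"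
proof -
  \<comment> \<open>The index a is eliminated as k - l + b - c; when this leaves the allowed range
    the ladder vanishes.\<close>
  let ?h = "\<lambda>b c. (par (b - l) * qp (s * ((k - l + b - c) * c - b + l))) \<cdot>
     (e (k - l + b - c) (k - c + b) (l + c - b) * (f b (k - c) (l + c) * e c k l))"
  define g where "g c b t = par (b - l) * qp (s * ((k - l + b - c) * c - b + l)) * (qb c t * qb (k - l + b - t) (k - l + b - c - t))" for c b t
  have h: "?h b c = (\<Sum>t\<in>{0..c}. g c b t \<cdot> P (l + t - b) k l)" if "0 \<le> c" for b c
  proof -
    let ?a = "k - l + b - c"
    have ee': "e (?a - t) (k - c) (l + c) * e c k l = qb (k - l + b - t) (?a - t) \<cdot> e (k - l + b - t) k l" for t
      using ee[of "?a - t" k c l] by (simp add: algebra_simps)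
    have "e ?a (k - c + b) (l + c - b) * f b (k - c) (l + c) =
      (\<Sum>t\<in>{0..min ?a b}. qb c t \<cdot> (f (b - t) (k - c - ?a + t) (l + c + ?a - t) * e (?a - t) (k - c) (l + c)))"
      using ef[of ?a "k - c" b "l + c"] by (simp add: algebra_simps)
    then have "e ?a (k - c + b) (l + c - b) * (f b (k - c) (l + c) * e c k l) =
      (\<Sum>t\<in>{0..min ?a b}. (qb c t * qb (k - l + b - t) (?a - t)) \<cdot> (f (b - t) (k - c - ?a + t) (l + c + ?a - t) * e (k - l + b - t) k l))"
      by (simp flip: mult.assoc) (simp add: sum_distrib_right mult.assoc ee')
    also have "\<dots> = (\<Sum>t\<in>{0..min ?a b}. (qb c t * qb (k - l + b - t) (?a - t)) \<cdot> P (l + t - b) k l)"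
      by (intro sum.cong HOL.refl) (simp add: P_def algebra_simps)
    also have "\<dots> = (\<Sum>t\<in>{0..min ?a b} \<inter> {0..c}. (qb c t * qb (k - l + b - t) (?a - t)) \<cdot> P (l + t - b) k l)"
      using that by (intro sum.mono_neutral_right) (auto simp: qb_zero)
    also have "\<dots> = (\<Sum>t\<in>{0..c}. (qb c t * qb (k - l + b - t) (?a - t)) \<cdot> P (l + t - b) k l)"
      using that by (intro sum.mono_neutral_left) (auto simp: P_zero not_le)
    finally show ?thesis by (simp add: smult_sum g_def)
  qed
  have g': "g c (l + t - j) t = (par j * qp (s * j)) * (qp (s * ((k - j - c) * c)) * qb (k - j) (k - j - c) * (par t * qp (s * (t * (c - 1))) * qb c t))" for c j t
  proof -
    have "par (t - j) = par j * par t" unfolding par_mult by (rule par_cong) simp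
    moreover have "qp (s * ((k - l + (l + t - j) - c) * c - (l + t - j) + l)) = qp (s * j) * qp (s * ((k - j - c) * c)) * qp (s * (t * (c - 1)))"
      unfolding qp_mult by (rule arg_cong[where f = qp]) (simp add: algebra_simps)
    moreover have "k - l + (l + t - j) - t = k - j" "k - l + (l + t - j) - c - t = k - j - c" "l + t - j - l = t - j" by auto
    ultimately show ?thesis unfolding g_def by (simp only: mult_ac)
  qed
  have "(\<Sum>(a, b, c) \<in> {(a, b, c). a \<in> {0..int n} \<and> b \<in> {0..int n} \<and> c \<in> {0..int n} \<and> a - b + c = k - l}.
      (par (b - l) * qp (s * (a * c - b + l))) \<cdot> (e a (k - c + b) (l + c - b) * (f b (k - c) (l + c) * e c k l)))
    = (\<Sum>(c, b) \<in> {0..int n} \<times> {0..int n}. ?h b c)"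
  proof (rule sum.reindex_bij_witness_not_neutral[where i = "\<lambda>(c, b). (k - l + b - c, b, c)" and j = "\<lambda>(a, b, c). (c, b)"
      and S' = "{}" and T' = "{(c, b) \<in> {0..int n} \<times> {0..int n}. k - l + b - c \<notin> {0..int n}}"])
    fix x assume "x \<in> {(c, b) \<in> {0..int n} \<times> {0..int n}. k - l + b - c \<notin> {0..int n}}"
    then obtain c b where x: "x = (c, b)" "k - l + b - c \<notin> {0..int n}" "c \<ge> 0" "b \<ge> 0" by auto
    then have "e (k - l + b - c) (k - c + b) (l + c - b) = 0" by (intro e_zero) auto
    then show "(case x of (c, b) \<Rightarrow> ?h b c) = 0" by (simp add: x)
  next
    show "finite {(c, b) \<in> {0..int n} \<times> {0..int n}. k - l + b - c \<notin> {0..int n}}"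
      by (rule finite_subset[of _ "{0..int n} \<times> {0..int n}"]) auto
  next
    fix x assume "x \<in> {(a, b, c). a \<in> {0..int n} \<and> b \<in> {0..int n} \<and> c \<in> {0..int n} \<and> a - b + c = k - l}"
    then obtain a b c where x: "x = (a, b, c)" "a - b + c = k - l" by auto
    then have "k - l + b - c = a" by simp
    then show "(case case x of (a, b, c) \<Rightarrow> (c, b) of (c, b) \<Rightarrow> ?h b c) =
      (case x of (a, b, c) \<Rightarrow> (par (b - l) * qp (s * (a * c - b + l))) \<cdot> (e a (k - c + b) (l + c - b) * (f b (k - c) (l + c) * e c k l)))"
      by (simp only: x prod.case)
  qed (auto simp: algebra_simps)
  also have "\<dots> = (\<Sum>c\<in>{0..int n}. \<Sum>b\<in>{0..int n}. \<Sum>t\<in>{0..c}. g c b t \<cdot> P (l + t - b) k l)"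
    by (simp add: h flip: sum.cartesian_product)
  also have "\<dots> = (\<Sum>c\<in>{0..int n}. \<Sum>t\<in>{0..c}. \<Sum>b\<in>{0..int n}. g c b t \<cdot> P (l + t - b) k l)"
    by (intro sum.cong HOL.refl sum.swap)
  \<comment> \<open>Replacing b by j = l + t - b makes the ladder independent of t.\<close>
  also have "\<dots> = (\<Sum>c\<in>{0..int n}. \<Sum>t\<in>{0..c}. \<Sum>j\<in>{0..int n}. g c (l + t - j) t \<cdot> P j k l)"
  proof (rule sum.cong[OF HOL.refl], rule sum.cong[OF HOL.refl])
    fix c t assume ct: "c \<in> {0..int n}" "t \<in> {0..c}"
    have "(\<Sum>b\<in>{0..int n}. g c b t \<cdot> P (l + t - b) k l) = (\<Sum>j\<in>{0..int n}. g c (l + t - j) t \<cdot> P (l + t - (l + t - j)) k l)"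
    proof (rule sum_reflect)
      fix b assume "b \<in> {0..int n}" "l + t - b \<notin> {0..int n}"
      then have "P (l + t - b) k l = 0" using kl by (intro P_zero) auto
      then show "g c b t \<cdot> P (l + t - b) k l = 0" by simp
    next
      fix j assume j: "j \<in> {0..int n}" "l + t - j \<notin> {0..int n}"
      then consider "l < j" | "k - j - c < 0" | "int n < k + l - j" using ct by auto linarith
      then show "g c (l + t - j) t \<cdot> P (l + t - (l + t - j)) k l = 0"
        by cases (auto simp: P_zero g')
    qed auto
    then show "(\<Sum>b\<in>{0..int n}. g c b t \<cdot> P (l + t - b) k l) = (\<Sum>j\<in>{0..int n}. g c (l + t - j) t \<cdot> P j k l)" by simp
  qed
  also have "\<dots> = (\<Sum>c\<in>{0..int n}. \<Sum>j\<in>{0..int n}. (\<Sum>t\<in>{0..c}. g c (l + t - j) t) \<cdot> P j k l)"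
    by (rule sum.cong[OF HOL.refl], subst sum.swap) (simp add: smult_sum_left)
  also have "\<dots> = (\<Sum>j\<in>{0..int n}. (\<Sum>c\<in>{0..int n}. \<Sum>t\<in>{0..c}. g c (l + t - j) t) \<cdot> P j k l)"
    by (subst sum.swap) (simp add: smult_sum_left)
  also have "\<dots> = X s k l"
    unfolding X_def
  proof (intro sum.cong HOL.refl)
    fix j assume j: "j \<in> {0..int n}"
    show "(\<Sum>c\<in>{0..int n}. \<Sum>t\<in>{0..c}. g c (l + t - j) t) \<cdot> P j k l = mv s j \<cdot> P j k l"
    proof (cases "j \<le> k")
      case True
      have "(\<Sum>c\<in>{0..int n}. \<Sum>t\<in>{0..c}. g c (l + t - j) t) =
        (\<Sum>c\<in>{0..int n}. par j * qp (s * j) * (qp (s * ((k - j - c) * c)) * qb (k - j) (k - j - c) * (if c = 0 then 1 else 0)))"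
        by (intro sum.cong HOL.refl) (simp only: g' qb_sum_alternating[OF s] atLeastAtMost_iff flip: sum_distrib_left)
      also have "\<dots> = (\<Sum>c\<in>{0}. par j * qp (s * j) * (qp (s * ((k - j - c) * c)) * qb (k - j) (k - j - c) * (if c = 0 then 1 else 0)))"
        by (intro sum.mono_neutral_right) auto
      finally show ?thesis using True by (simp add: mv_def qb_self)
    qed (simp add: P_zero)
  qed
  finally show ?thesis .
qed

text \<open>Switching F past E expands each term with coefficients of upper entry j. In every
  resulting ladder the sum over t is then a j-th difference of binomials with lower entry j -
  1.\<close>

lemma alternating_sum_vanishes:
  assumes "1 \<le> j"
  shows "(\<Sum>a\<in>{0..w}. (par a * qb (k - a + j - 1) (j - 1)) \<cdot> (f (k - a + j) a (w - a + k) * e (w - a) w k)) = 0"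
proof -
  define D where "D u = e (w - u) (w + k + j - u) (u - j) * f (k + j - u) w k" for u
  have D_zero: "D u = 0" if "u \<notin> {j..w}" for u using that by (auto simp: D_def e_zero)
  have *: "f (k - a + j) a (w - a + k) * e (w - a) w k = (\<Sum>t\<in>{0..j}. qb j t \<cdot> D (a + t))" for a
  proof -
    have "f (k - a + j) a (w - a + k) * e (w - a) w k = (\<Sum>t\<in>{0..min (k - a + j) (w - a)}. qb j t \<cdot> D (a + t))"
      using fe[of "k - a + j" w "w - a" k] by (simp add: D_def algebra_simps)
    also have "\<dots> = (\<Sum>t\<in>{0..min (k - a + j) (w - a)} \<inter> {0..j}. qb j t \<cdot> D (a + t))"
      using assms by (intro sum.mono_neutral_right) (auto simp: qb_zero)
    also have "\<dots> = (\<Sum>t\<in>{0..j}. qb j t \<cdot> D (a + t))"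
      by (intro sum.mono_neutral_left) (auto simp: D_def e_zero f_zero not_le)
    finally show ?thesis .
  qed
  have "(\<Sum>a\<in>{0..w}. (par a * qb (k - a + j - 1) (j - 1)) \<cdot> (f (k - a + j) a (w - a + k) * e (w - a) w k)) =
    (\<Sum>t\<in>{0..j}. \<Sum>a\<in>{0..w}. (par a * qb (k - a + j - 1) (j - 1) * qb j t) \<cdot> D (a + t))"
    by (subst sum.swap) (simp add: * smult_sum mult.assoc)
  also have "\<dots> = (\<Sum>t\<in>{0..j}. \<Sum>u\<in>{j..w}. (par (u - t) * qb (k - (u - t) + j - 1) (j - 1) * qb j t) \<cdot> D (u - t + t))"
    by (intro sum.cong HOL.refl sum_translate) (auto simp: D_zero)
  also have "\<dots> = (\<Sum>u\<in>{j..w}. (\<Sum>t\<in>{0..j}. par u * (par t * qb (k - u + j - 1 + t) (j - 1) * qb j t)) \<cdot> D u)"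
    by (subst sum.swap) (simp add: smult_sum_left par_diff mult_ac algebra_simps)
  also have "\<dots> = 0"
    by (simp only: qb_sum_vanishing[OF assms] mult_zero_right smult_0_left sum.neutral_const flip: sum_distrib_left)
  finally show ?thesis .
qed

text \<open>The exchange of the two coefficients is what makes the crossing compatible with merging.\<close>

lemma coefficient_exchange:
  assumes s: "s = 1 \<or> s = - 1" and "0 \<le> j"
  shows "(\<Sum>a\<in>{0..w}. (mv s a * qb (a - k) j) \<cdot> (f (k - a + j) a (w - a + k) * e (w - a) w k)) =
    (\<Sum>a\<in>{0..w}. (mv s a * mv s j * qb (k - a + j) j) \<cdot> (f (k - a + j) a (w - a + k) * e (w - a) w k))"
proof (cases "j = 0")
  case False
  then have j: "1 \<le> j" using assms by simp
  \<comment> \<open>The two coefficients differ by a term of the vanishing alternating sum, with a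
    factor free of a because q^(sa) and q^(s(k - a + j)) have a product free of a.\<close>
  have "mv s a * qb (a - k) j = mv s a * mv s j * qb (k - a + j) j + (- par j * qp (s * (k + j))) * (par a * qb (k - a + j - 1) (j - 1))" for a
  proof -
    have "qb (a - k) j = par j * qb (k - a + j - 1) j"
      using qb_uminus[of "k - a" j] by simp
    also have "qb (k - a + j - 1) j = qp (s * j) * qb (k - a + j) j - qp (s * (k - a + j)) * qb (k - a + j - 1) (j - 1)"
      using qb_diff[OF s, of "k - a + j - 1" j] by (simp add: algebra_simps)
    finally have "mv s a * qb (a - k) j = mv s a * mv s j * qb (k - a + j) j -
      par j * par a * (qp (s * a) * qp (s * (k - a + j))) * qb (k - a + j - 1) (j - 1)"
      by (simp add: mv_def right_diff_distrib mult_ac)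
    also have "qp (s * a) * qp (s * (k - a + j)) = qp (s * (k + j))" by (simp add: qp_mult algebra_simps)
    finally show ?thesis by (simp add: mult_ac)
  qed
  then have "(\<Sum>a\<in>{0..w}. (mv s a * qb (a - k) j) \<cdot> (f (k - a + j) a (w - a + k) * e (w - a) w k)) =
    (\<Sum>a\<in>{0..w}. (mv s a * mv s j * qb (k - a + j) j) \<cdot> (f (k - a + j) a (w - a + k) * e (w - a) w k))
    + (- par j * qp (s * (k + j))) \<cdot> (\<Sum>a\<in>{0..w}. (par a * qb (k - a + j - 1) (j - 1)) \<cdot> (f (k - a + j) a (w - a + k) * e (w - a) w k))"
    by (simp add: smult_diff_left sum_subtractf smult_minus sum_negf smult_sum)
  then show ?thesis by (simp add: alternating_sum_vanishes[OF j])
qed simp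

text \<open>Here \<open>e l (k + l) 0\<close> is a split, so this is the twist of a vertex in
  abstract form. The ladders merge into the split, and the coefficients form the Vandermonde sum for
  the sign -s.\<close>

lemma X_e:
  assumes s: "s = 1 \<or> s = - 1" and kl: "0 \<le> k" "0 \<le> l"
  shows "X s k l * e l (k + l) 0 = qp (- s * (k * l)) \<cdot> e k (k + l) 0"
proof -
  have "P j k l * e l (k + l) 0 = (qb (k + l - j) (k - j) * qb l (l - j)) \<cdot> e k (k + l) 0" if j: "j \<in> {0..l}" for j
  proof -
    have "P j k l * e l (k + l) 0 = f (l - j) j (k + l - j) * (e (k - j) k l * e l (k + l) 0)"
      by (simp add: P_def mult.assoc)
    also have "e (k - j) k l * e l (k + l) 0 = qb (k + l - j) (k - j) \<cdot> e (k + l - j) (k + l) 0"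
      using ee[of "k - j" "k + l" l 0] by (simp add: algebra_simps)
    also have "f (l - j) j (k + l - j) * (qb (k + l - j) (k - j) \<cdot> e (k + l - j) (k + l) 0) =
      qb (k + l - j) (k - j) \<cdot> (f (l - j) (k + l - (k + l - j)) (0 + (k + l - j)) * e (k + l - j) (k + l) 0)" by simp
    also have "f (l - j) (k + l - (k + l - j)) (0 + (k + l - j)) * e (k + l - j) (k + l) 0 =
      (\<Sum>t\<in>{0..min (l - j) (k + l - j)}. qb l t \<cdot> (e (k + l - j - t) (k + l + (l - j) - t) (0 - (l - j) + t) * f (l - j - t) (k + l) 0))"
      by (subst fe) (simp add: algebra_simps)
    \<comment> \<open>The right upright carries 0 at the bottom, so no F rung can start there and t
      = l - j is forced.\<close>
    also have "\<dots> = (\<Sum>t\<in>{l - j}. qb l t \<cdot> (e (k + l - j - t) (k + l + (l - j) - t) (0 - (l - j) + t) * f (l - j - t) (k + l) 0))"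
      using j kl by (intro sum.mono_neutral_right) (auto simp: f_zero)
    also have "\<dots> = qb l (l - j) \<cdot> e k (k + l) 0"
      using e_i[of k "k + l" 0] by (simp add: f_0 algebra_simps)
    finally show ?thesis by simp
  qed
  then have "X s k l * e l (k + l) 0 = (\<Sum>j\<in>{0..l}. mv s j * (qb (k + l - j) (k - j) * qb l (l - j))) \<cdot> e k (k + l) 0"
    by (simp add: X_restrict[of l k l] sum_distrib_right smult_sum_left)
  also have "(\<Sum>j\<in>{0..l}. mv s j * (qb (k + l - j) (k - j) * qb l (l - j))) =
    (\<Sum>t\<in>{0..l}. mv s (l - t) * (qb (k + l - (l - t)) (k - (l - t)) * qb l (l - (l - t))))"
    by (rule sum_reflect) auto
  also have "\<dots> = (\<Sum>t\<in>{0..l}. mv s l * (mv (- s) t * qb (k + t) l * qb l t))"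
  proof (intro sum.cong HOL.refl)
    fix t assume "t \<in> {0..l}"
    then have "qb (k + t) (k + t - l) = qb (k + t) l" using kl by (intro qb_sym) auto
    moreover have "k + l - (l - t) = k + t" "k - (l - t) = k + t - l" "l - (l - t) = t" by auto
    ultimately show "mv s (l - t) * (qb (k + l - (l - t)) (k - (l - t)) * qb l (l - (l - t))) = mv s l * (mv (- s) t * qb (k + t) l * qb l t)"
      by (simp only: mv_minus mult_ac)
  qed
  also have "\<dots> = mv s l * (par l * qp ((- s) * (l * (k + 1))))"
    using s kl by (simp only: flip: sum_distrib_left) (subst qb_sum_shifted, auto)
  also have "\<dots> = par l * par l * (qp (s * l) * qp ((- s) * (l * (k + 1))))"
    by (simp only: mv_def mult_ac)
  also have "\<dots> = qp (- s * (k * l))"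
    unfolding par_square qp_mult by (simp add: algebra_simps)
  finally show ?thesis .
qed

end


section \<open>Ladders in the web module\<close>

lemma admissible_up [simp]: "admissible n (Ident (up a)) \<longleftrightarrow> 0 \<le> a \<and> a \<le> int n"
  by (auto simp: up_def strands_def)

lemma set_up [simp]: "set (up a) \<subseteq> strands n \<longleftrightarrow> 0 \<le> a \<and> a \<le> int n"
  using admissible_up[of n a] by simp

lemma admissible_merge0 [simp]: "admissible n (merge0 a b) \<longleftrightarrow> 0 \<le> a \<and> 0 \<le> b \<and> a + b \<le> int n"
  and admissible_split0 [simp]: "admissible n (split0 a b) \<longleftrightarrow> 0 \<le> a \<and> 0 \<le> b \<and> a + b \<le> int n"
  by (auto simp: merge0_def split0_def)

lemma uncrossed_merge0 [simp]: "uncrossed (merge0 a b)" "unmarked (merge0 a b)"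
  and uncrossed_split0 [simp]: "uncrossed (split0 a b)" "unmarked (split0 a b)"
  by (auto simp: merge0_def split0_def)

lemma rev_up [simp]: "rev (up a) = up a"
  by (simp add: up_def)

lemma up_0 [simp]: "up 0 = []"
  by (simp add: up_def)

lemma mirror_merge0 [simp]: "mirror (merge0 a b) = merge0 b a"
  and mirror_split0 [simp]: "mirror (split0 a b) = split0 b a"
  by (auto simp: merge0_def split0_def add.commute)

lemma flip_merge0 [simp]: "flip (merge0 a b) = split0 a b"
  and flip_split0 [simp]: "flip (split0 a b) = merge0 a b"
  by (auto simp: merge0_def split0_def)

lemma mirror_ladE [simp]: "mirror (ladE s k l) = ladF s l k"
  and flip_ladE: "flip (ladE s k l) = ladF s (k - s) (l + s)"
  and flip_ladF: "flip (ladF s k l) = ladE s (k + s) (l - s)"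
  by (auto simp: ladE_def ladF_def)

lemma mirror_ladF [simp]: "mirror (ladF s k l) = ladE s l k"
  by (auto simp: ladE_def ladF_def)

section \<open>Mirror images of the relations\<close>

definition lin_mirror :: "nat \<Rightarrow> lin \<Rightarrow> lin" where
  "lin_mirror n = linear_ext (\<lambda>W. vec n (mirror W))"

lemma lin_mirror_vec: "lin_mirror n (vec n W) = vec n (mirror W)"
  by (auto simp: lin_mirror_def linear_ext_vec) (simp add: vec_def)

lemma lin_mirror_scale: "lin_mirror n (scale c x) = scale c (lin_mirror n x)"
  and lin_mirror_diff: "lin_mirror n (x - y) = lin_mirror n x - lin_mirror n y"
  by (simp_all add: lin_mirror_def linear_ext_scale linear_ext_diff)

lemma lin_mirror_sum: "lin_mirror n (\<Sum>i\<in>S. f i) = (\<Sum>i\<in>S. lin_mirror n (f i))"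
  by (induction S rule: infinite_finite_induct) (simp_all add: lin_mirror_def linear_ext_add)

lemma lin_mirror_relations: "x \<in> relations n \<Longrightarrow> lin_mirror n x \<in> relations n"
  unfolding lin_mirror_def by (rule relations.mirror)

lemma sum_nat_int: "(\<Sum>t\<in>{0..int m}. f t) = (\<Sum>t\<le>m. f (int t))"
  by (rule sum.reindex_bij_witness[of _ int nat]) auto

context webs
begin

lemma relation_eq: "x - y \<in> relations n \<Longrightarrow> x \<in> free_webs n \<Longrightarrow> y \<in> free_webs n \<Longrightarrow> cls n x = cls n y"
  by (simp add: cls_eq_iff null_webs.relation)

lemma cls_vec: "cls n (vec n D) = wb D"
  by (simp add: wb_def)

lemma cls_qbinom: "cls n (scale (qbinom p t) (vec n D)) = qb p (int t) \<cdot> wb D"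
proof -
  have "qbinom p t = Rep_zq (qbz p t)" by (simp add: qbz.rep_eq)
  then show ?thesis by (simp add: cls_scale_Rep free_webs_vec wb_def qb_def)
qed

section \<open>Vertices, ladders and their relations in the web module\<close>

definition mg :: "int \<Rightarrow> int \<Rightarrow> webmod" where "mg k l = wb (merge0 k l)"
definition sp :: "int \<Rightarrow> int \<Rightarrow> webmod" where "sp k l = wb (split0 k l)"
definition EE :: "int \<Rightarrow> int \<Rightarrow> int \<Rightarrow> webmod" where "EE s k l = wb (ladE s k l)"
definition FF :: "int \<Rightarrow> int \<Rightarrow> int \<Rightarrow> webmod" where "FF s k l = wb (ladF s k l)"

lemma mg_homs: "k + l = m \<Longrightarrow> mg k l \<in> homs (up k @ up l) (up m)"
  and sp_homs: "k + l = m \<Longrightarrow> sp k l \<in> homs (up m) (up k @ up l)"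
  using merge0_boundary[of n k l] split0_boundary[of n k l]
  by (auto simp: mg_def sp_def web_def intro!: homs_wb)

lemma EE_homs: "EE s k l \<in> homs (up k @ up l) (up (k - s) @ up (l + s))"
  and FF_homs: "FF s k l \<in> homs (up k @ up l) (up (k + s) @ up (l - s))"
  using ladE_boundary[of n s k l] ladF_boundary[of n s k l]
  by (auto simp: EE_def FF_def web_def intro!: homs_wb)

lemma Id_up_zero: "a < 0 \<or> int n < a \<Longrightarrow> Id (up a) = 0"
  by (rule wb_not_web) (auto simp: web_def simp del: admissible.simps)

lemma mg_zero: "a < 0 \<or> b < 0 \<or> int n < a + b \<Longrightarrow> mg a b = 0"
  unfolding mg_def by (auto intro!: wb_not_web simp: web_def)

lemma mg_0_right [simp]: "mg k 0 = Id (up k)" and mg_0_left [simp]: "mg 0 k = Id (up k)"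
  and sp_0_right [simp]: "sp k 0 = Id (up k)" and sp_0_left [simp]: "sp 0 k = Id (up k)"
  by (simp_all add: mg_def sp_def merge0_def split0_def)

lemma EE_eq: "EE s k l = pad (up (k - s)) (mg s l) [] * pad [] (sp (k - s) s) (up l)"
  and FF_eq: "FF s k l = pad [] (mg k s) (up (l - s)) * pad (up k) (sp s (l - s)) []"
proof -
  have *: "f \<otimes> Id [] = f" "Id [] \<otimes> (f \<otimes> Id ys) = f \<otimes> Id ys" if "f \<in> homs as bs" for f as bs ys
    using that by (auto simp: Id_Nil_tens[OF homs_tens[OF that Id_homs]])
  show "EE s k l = pad (up (k - s)) (mg s l) [] * pad [] (sp (k - s) s) (up l)"
    by (simp add: EE_def ladE_def wb_Comp wb_Tens pad_def *[OF mg_homs[OF HOL.refl]] *[OF sp_homs[OF HOL.refl]] flip: mg_def sp_def)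
  show "FF s k l = pad [] (mg k s) (up (l - s)) * pad (up k) (sp s (l - s)) []"
    by (simp add: FF_def ladF_def wb_Comp wb_Tens pad_def *[OF mg_homs[OF HOL.refl]] *[OF sp_homs[OF HOL.refl]] flip: mg_def sp_def)
qed

lemma EE_zero: "s < 0 \<or> k < s \<or> l < 0 \<or> int n < k \<or> int n < l + s \<Longrightarrow> EE s k l = 0"
  and FF_zero: "s < 0 \<or> l < s \<or> k < 0 \<or> int n < l \<or> int n < k + s \<Longrightarrow> FF s k l = 0"
  unfolding EE_def FF_def by (rule wb_not_web; auto simp: web_def ladE_def ladF_def)+

lemma EE_zero': "k < 0 \<Longrightarrow> EE s k l = 0" and FF_zero': "l < 0 \<Longrightarrow> FF s k l = 0"
  by (cases "s < 0"; simp add: EE_zero FF_zero)+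

text \<open>The relation is imposed for natural labels. For other integers both sides are 0, so
  later computations may ignore the range of the labels.\<close>

lemma digon: "mg k l * sp k l = qb (k + l) l \<cdot> Id (up (k + l))"
proof (cases "0 \<le> k \<and> 0 \<le> l")
  case True
  then obtain a b where ab: "k = int a" "l = int b" by (meson zero_le_imp_eq_int)
  show ?thesis
    using relation_eq[OF relations.digon[of n a b]] Zq_qbinom
    by (simp add: free_webs_vec free_webs_scale cls_vec cls_qbinom wb_Comp mg_def sp_def ab)
next
  case False
  then consider "k < 0" "0 \<le> k + l" | "l < 0" | "k + l < 0" by linarith
  then show ?thesis by cases (auto simp: mg_zero qb_zero Id_up_zero, cases "k < 0", auto simp: mg_zero)
qed

lemma bubble:
  assumes "0 \<le> k" "1 \<le> l"
  shows "pad (up k) (cap (Up l)) [] * (pad [] (sp k l) [Dn l] * (pad [] (mg k l) [Dn l] * pad (up k) (cup (Up l)) [])) =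
    qb (int n - k) l \<cdot> Id (up k)"
proof -
  obtain a b where ab: "k = int a" "l = int b" using assms by (meson order.trans zero_le_imp_eq_int zero_le_one)
  have *: "Id [] \<otimes> (f \<otimes> Id ys) = f \<otimes> Id ys" if "f \<in> homs as bs" for f as bs ys
    using that by (auto simp: Id_Nil_tens[OF homs_tens[OF that Id_homs]])
  have "tens h (Id []) = h" if "h = cap (Up l) \<or> h = cup (Up l)" for h
    using that tens_Id_Nil[OF cap_homs(2)] tens_Id_Nil[OF cup_homs(2)] by auto
  then show ?thesis
    using relation_eq[OF relations.bubble[of n a b]] Zq_qbinom assms
    by (simp add: free_webs_vec free_webs_scale cls_vec cls_qbinom wb_Comp wb_Tens mg_def sp_def ab pad_def
        cap0_def cup0_def dn_def *[OF mg_homs[OF HOL.refl], unfolded mg_def] *[OF sp_homs[OF HOL.refl], unfolded sp_def])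
qed

lemma mg_assoc: "mg (k + l) m * pad [] (mg k l) (up m) = mg k (l + m) * pad (up k) (mg l m) []"
proof -
  have "mg (k + l) m * (mg k l \<otimes> Id (up m)) = mg k (l + m) * (Id (up k) \<otimes> mg l m)"
  proof (cases "0 \<le> k \<and> 0 \<le> l \<and> 0 \<le> m")
    case True
    then obtain a b c where abc: "k = int a" "l = int b" "m = int c" by (meson zero_le_imp_eq_int)
    show ?thesis
      using relation_eq[OF relations.merge_assoc[of n a b c]]
      by (simp add: free_webs_vec cls_vec wb_Comp wb_Tens mg_def abc)
  qed (auto simp: mg_zero)
  then show ?thesis
    using Id_Nil_tens[OF homs_tens[OF mg_homs[OF HOL.refl, of k l] Id_homs[of "up m"]]]
      tens_Id_Nil[OF homs_tens[OF Id_homs[of "up k"] mg_homs[OF HOL.refl, of l m]]]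
    by (simp add: pad_def tens_assoc)
qed

lemma square_sum_free: "(\<Sum>t\<in>S. scale (qbinom (p t) (u t)) (vec n (D t))) \<in> free_webs n"
  by (intro free_webs_sum free_webs_scale free_webs_vec Zq_qbinom)

lemma cls_square_sum: "cls n (\<Sum>t\<in>S. scale (qbinom (p t) (u t)) (vec n (D t))) = (\<Sum>t\<in>S. qb (p t) (int (u t)) \<cdot> wb (D t))"
  by (subst cls_sum) (auto simp: cls_qbinom intro: free_webs_scale free_webs_vec Zq_qbinom)

lemma EE_EE: "EE r (k - s) (l + s) * EE s k l = qb (r + s) r \<cdot> EE (r + s) k l"
  and FF_FF: "FF r (k + s) (l - s) * FF s k l = qb (r + s) r \<cdot> FF (r + s) k l"
proof -
  have zero: "qb (r + s) r = 0 \<or> r + s < 0" if "r < 0 \<or> s < 0" for r s :: int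
    using that by (cases "r < 0") (auto simp: qb_zero not_less)
  show "EE r (k - s) (l + s) * EE s k l = qb (r + s) r \<cdot> EE (r + s) k l"
  proof (cases "0 \<le> k \<and> 0 \<le> l \<and> 0 \<le> r \<and> 0 \<le> s")
    case True
    then obtain a b c d where "k = int a" "l = int b" "r = int c" "s = int d" by (meson zero_le_imp_eq_int)
    then show ?thesis
      using relation_eq[OF relations.rungs[of n c a d b]] Zq_qbinom
      by (simp add: free_webs_vec free_webs_scale cls_vec cls_qbinom wb_Comp EE_def)
  next
    case False
    then consider "k < 0" "0 \<le> r + s" | "l < 0" | "r < 0" | "s < 0" by linarith
    then show ?thesis using zero[of r s] by cases (auto simp: EE_zero)
  qed
  show "FF r (k + s) (l - s) * FF s k l = qb (r + s) r \<cdot> FF (r + s) k l"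
  proof (cases "0 \<le> k \<and> 0 \<le> l \<and> 0 \<le> r \<and> 0 \<le> s")
    case True
    then obtain a b c d where "k = int a" "l = int b" "r = int c" "s = int d" by (meson zero_le_imp_eq_int)
    then show ?thesis
      using relation_eq[OF lin_mirror_relations[OF relations.rungs[of n c b d a], unfolded lin_mirror_diff lin_mirror_scale lin_mirror_vec]] Zq_qbinom
      by (simp add: free_webs_vec free_webs_scale cls_vec cls_qbinom wb_Comp FF_def)
  next
    case False
    then consider "k < 0" | "l < 0" "0 \<le> r + s" | "r < 0" | "s < 0" by linarith
    then show ?thesis using zero[of r s] by cases (auto simp: FF_zero)
  qed
qed

lemma FF_EE: "FF r (k - s) (l + s) * EE s k l =
    (\<Sum>t\<in>{0..min r s}. qb (k - l + r - s) t \<cdot> (EE (s - t) (k + r - t) (l - r + t) * FF (r - t) k l))"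
proof (cases "0 \<le> k \<and> 0 \<le> l \<and> 0 \<le> r \<and> 0 \<le> s")
  case True
  then obtain a b c d where *: "k = int a" "l = int b" "r = int c" "s = int d" by (meson zero_le_imp_eq_int)
  have "min r s = int (min c d)" by (simp add: *)
  then show ?thesis
    using relation_eq[OF relations.square_switch[of n c a d b]]
    by (simp only: sum_nat_int) (simp add: free_webs_vec square_sum_free cls_vec cls_square_sum wb_Comp EE_def FF_def * algebra_simps)
qed (auto simp: EE_zero FF_zero EE_zero' FF_zero')

lemma EE_FF: "EE r (k + s) (l - s) * FF s k l =
    (\<Sum>t\<in>{0..min r s}. qb (l - k + r - s) t \<cdot> (FF (s - t) (k - r + t) (l + r - t) * EE (r - t) k l))"
proof (cases "0 \<le> k \<and> 0 \<le> l \<and> 0 \<le> r \<and> 0 \<le> s")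
  case True
  then obtain a b c d where *: "k = int a" "l = int b" "r = int c" "s = int d" by (meson zero_le_imp_eq_int)
  have "min r s = int (min c d)" by (simp add: *)
  then show ?thesis
    using relation_eq[OF lin_mirror_relations[OF relations.square_switch[of n c b d a], unfolded lin_mirror_diff lin_mirror_sum lin_mirror_scale lin_mirror_vec]]
    by (simp only: sum_nat_int) (simp add: free_webs_vec square_sum_free cls_vec cls_square_sum wb_Comp EE_def FF_def * algebra_simps)
qed (auto simp: EE_zero FF_zero EE_zero' FF_zero')

lemma EE_0: "EE 0 k l = Id (up k @ up l)" and FF_0: "FF 0 k l = Id (up k @ up l)"
  by (simp_all add: EE_eq FF_eq)

section \<open>The crossing of two upward strands\<close>

sublocale EF: ladder_pair n EE FF "\<lambda>k l. Id (up k @ up l)"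
proof
  show "EE s k l * Id (up k @ up l) = EE s k l" "FF s k l * Id (up k @ up l) = FF s k l" for s k l
    by (rule comp_Id[OF EE_homs] comp_Id[OF FF_homs])+
qed (fact EE_EE FF_FF FF_EE EE_FF EE_0 FF_0 EE_zero FF_zero)+

sublocale FE: ladder_pair n "\<lambda>s k l. FF s l k" "\<lambda>s k l. EE s l k" "\<lambda>k l. Id (up l @ up k)"
proof
  show "FF s l k * Id (up l @ up k) = FF s l k" "EE s l k * Id (up l @ up k) = EE s l k" for s k l
    by (rule comp_Id[OF EE_homs] comp_Id[OF FF_homs])+
qed (fact EE_EE FF_FF FF_EE EE_FF EE_0 FF_0 EE_zero FF_zero)+

abbreviation XC :: "int \<Rightarrow> int \<Rightarrow> int \<Rightarrow> webmod" where "XC \<equiv> EF.X"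

text \<open>Mirroring turns F E into E F and \<open>balance\<close> turns it back. Hence the E F E
  sum and the F E F sum collapse to the same family.\<close>

lemma FE_P: "FE.P j k l = EF.P j l k"
  using EF.balance[of k j l] by (simp add: FE.P_def EF.P_def add.commute)

lemma FE_X: "FE.X s k l = XC s l k"
  by (simp add: FE.X_def EF.X_def FE_P)

lemma XC_inverse:
  assumes "s = 1 \<or> s = - 1" "0 \<le> k" "0 \<le> l"
  shows "XC (- s) l k * XC s k l = Id (up k @ up l)"
  using EF.X_inverse[of s k l] FE.X_inverse[of s l k] assms by (cases "k \<le> l") (auto simp: FE_X)

lemma P_homs: "EF.P j k l \<in> homs (up k @ up l) (up l @ up k)"
  unfolding EF.P_def using EE_homs[of "k - j" k l] FF_homs[of "l - j" j "k + l - j"]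
  by (auto intro!: homs_comp[of _ "up j @ up (k + l - j)"] simp: algebra_simps)

lemma XC_homs: "XC s k l \<in> homs (up k @ up l) (up l @ up k)"
  unfolding EF.X_def by (intro homs_sum homs_smult P_homs)

text \<open>The positive crossing is the triple sum with s = -1. The negative one is that of the
  mirrored pair with s = 1, where (-1)^(b + k) is read as (-1)^(b - k).\<close>

lemma ladder_crossing_eq:
  assumes "1 \<le> k" "k \<le> int n" "1 \<le> l" "l \<le> int n"
  shows "cls n (ladder_crossing n s k l) = XC (if s then - 1 else 1) k l"
proof -
  have coeff: "Abs_zq ((- 1) powi m * q powi x) = par m * qp x" for m x
  proof -
    have "Rep_zq (par m) = (- 1) powi m"
      by (auto simp: par_def one_zq.rep_eq uminus_zq.rep_eq power_int_def minus_one_power_iff even_nat_iff)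
    then show ?thesis by (metis Rep_zq_inverse qp.rep_eq times_zq.rep_eq)
  qed
  have tm: "cls n (scale ((- 1) powi m * q powi x) (vec n D)) = (par m * qp x) \<cdot> wb D" for m x D
    by (subst cls_scale) (simp_all add: Zq_mult Zq_sign Zq_q_powi free_webs_vec coeff cls_vec)
  have free: "scale ((- 1) powi m * q powi x) (vec n D) \<in> free_webs n" for m x D
    by (intro free_webs_scale free_webs_vec Zq_mult Zq_sign Zq_q_powi)
  show ?thesis
  proof (cases s)
    case True
    have "cls n (ladder_crossing n s k l) =
      (\<Sum>(a, b, c) \<in> {(a, b, c). a \<in> {0..int n} \<and> b \<in> {0..int n} \<and> c \<in> {0..int n} \<and> a - b + c = k - l}.
      (par (b - l) * qp ((- 1) * (a * c - b + l))) \<cdot> (EE a (k - c + b) (l + c - b) * (FF b (k - c) (l + c) * EE c k l)))"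
      unfolding ladder_crossing_def using True
      by (simp, subst cls_sum, force simp: free)
        (auto intro!: sum.cong simp: tm wb_Comp EE_def FF_def algebra_simps)
    also have "\<dots> = XC (- 1) k l"
      using assms by (intro EF.triple_sum) auto
    finally show ?thesis using True by simp
  next
    case False
    have "cls n (ladder_crossing n s k l) =
      (\<Sum>(a, b, c) \<in> {(a, b, c). a \<in> {0..int n} \<and> b \<in> {0..int n} \<and> c \<in> {0..int n} \<and> a - b + c = l - k}.
      (par (b - k) * qp (1 * (a * c - b + k))) \<cdot> (FF a (k + c - b) (l - c + b) * (EE b (k + c) (l - c) * FF c k l)))"
      unfolding ladder_crossing_def using False
      by (simp, subst cls_sum, force simp: free)
        (auto intro!: sum.cong simp: tm wb_Comp EE_def FF_def algebra_simps par_def)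
    also have "\<dots> = FE.X 1 l k"
      using assms by (subst FE.triple_sum[symmetric]) auto
    finally show ?thesis using False by (simp add: FE_X)
  qed
qed


lemma flp_mg [simp]: "flp (mg k l) = sp k l" and flp_sp [simp]: "flp (sp k l) = mg k l"
  by (simp_all add: mg_def sp_def)

lemma flp_EE: "flp (EE s k l) = FF s (k - s) (l + s)" and flp_FF: "flp (FF s k l) = EE s (k + s) (l - s)"
  by (simp_all add: EE_def FF_def flip_ladE flip_ladF)

text \<open>Reflection exchanges the roles of the two rungs of \<open>P\<close>. In contrast to
  \<open>flip\<close> on diagrams, which changes the sign of a crossing, \<open>flp\<close> is
  linear over Laurent polynomials and keeps v.\<close>

lemma flp_XC [simp]: "flp (XC s k l) = XC s l k"
  by (simp add: EF.X_def EF.P_def flp_sum flp_mult flp_EE flp_FF algebra_simps)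

text \<open>A rung meeting an upright labelled 0 is a vertex; this lets ladder relations speak about
  merges and splits.\<close>

lemma EE_full: "EE l k 0 = sp (k - l) l"
  using pad_Nil[OF sp_homs, of "k - l" l k] Id_comp[OF sp_homs, of "k - l" l k] by (simp add: EE_eq)

lemma FF_full: "FF l k l = mg k l"
  using pad_Nil[OF mg_homs, of k l "k + l"] comp_Id[OF mg_homs, of k l "k + l"] by (simp add: FF_eq)

lemma XC_sp:
  assumes "s = 1 \<or> s = - 1" "0 \<le> k" "0 \<le> l"
  shows "XC s k l * sp k l = qp (- s * (k * l)) \<cdot> sp l k"
  using EF.X_e[OF assms] by (simp add: EE_full)

lemma mg_XC:
  assumes "s = 1 \<or> s = - 1" "0 \<le> k" "0 \<le> l"
  shows "mg l k * XC s k l = qp (- s * (k * l)) \<cdot> mg k l"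
  using arg_cong[OF XC_sp[OF assms(1,3,2)], of flp] by (simp add: flp_mult mult.commute)


section \<open>Crossings and merges\<close>

lemma pad_mg_assoc:
  "pad xs (mg (k + l) m) ys * pad xs (mg k l) (up m @ ys) = pad xs (mg k (l + m)) ys * pad (xs @ up k) (mg l m) ys"
proof -
  have "pad xs (mg (k + l) m * pad [] (mg k l) (up m)) ys = pad xs (mg k (l + m) * pad (up k) (mg l m) []) ys"
    by (simp add: mg_assoc)
  then show ?thesis
    by (subst (asm) pad_comp[OF mg_homs[OF HOL.refl] pad_homs[OF mg_homs[OF HOL.refl]]], simp, simp)
       (subst (asm) pad_comp[OF mg_homs[OF HOL.refl] pad_homs[OF mg_homs[OF HOL.refl]]], simp_all)
qed

lemma pad_mg_assoc':
  assumes "k + l = a" "l + m = b"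
  shows "pad xs (mg k b) ys * pad (xs @ up k) (mg l m) ys = pad xs (mg a m) ys * pad xs (mg k l) (up m @ ys)"
  using pad_mg_assoc[of xs k l m ys] assms by simp

lemma pad_EE: "pad xs (EE s k l) ys = pad (xs @ up (k - s)) (mg s l) ys * pad xs (sp (k - s) s) (up l @ ys)"
  unfolding EE_eq
  by (subst pad_comp[OF pad_homs[OF mg_homs[OF HOL.refl]] pad_homs[OF sp_homs[OF HOL.refl]]]) simp_all

lemma pad_FF: "pad xs (FF s k l) ys = pad xs (mg k s) (up (l - s) @ ys) * pad (xs @ up k) (sp s (l - s)) ys"
  unfolding FF_eq
  by (subst pad_comp[OF pad_homs[OF mg_homs[OF HOL.refl]] pad_homs[OF sp_homs[OF HOL.refl]]]) simp_all

lemma pad_P: "pad xs (EF.P j k l) ys = pad xs (FF (l - j) j (k + l - j)) ys * pad xs (EE (k - j) k l) ys"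
  unfolding EF.P_def
proof (rule pad_comp[OF FF_homs])
  show "EE (k - j) k l \<in> homs (up k @ up l) (up j @ up (k + l - j))"
    using EE_homs[of "k - j" k l] by (simp add: algebra_simps)
qed

text \<open>Everything in \<open>(M\<^sub>k\<^sub>,\<^sub>l \<otimes> 1) (1 \<otimes> P\<^sub>j)\<close> that lies above the ladder on the first two strands.\<close>

definition merge_top :: "int \<Rightarrow> int \<Rightarrow> int \<Rightarrow> int \<Rightarrow> webmod" where
  "merge_top j w k l = pad [] (mg (k + j) (l - j)) (up w) *
     (pad (up (k + j)) (sp (l - j) w) [] * pad (up (k + j)) (mg (w - j) l) [])"

text \<open>The part above depends only on the total a + b = k + j. Both sides of
  \<open>XC_merge\<close> are brought to this shape by reassociating merges.\<close>

lemma merge_top_lower: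
  assumes "a + b = k + j" "c = w - j + l"
  shows "pad [] (mg a (b + (l - j))) (up w) * (pad (up a) (pad [] (mg b (l - j)) (up w)) [] *
      (pad (up a @ up b) (sp (l - j) w) [] * pad (up a @ up b) (mg (w - j) l) [])) =
    merge_top j w k l * pad [] (mg a b) (up (w - j) @ up l)"
proof -
  have 1: "pad [] (mg a (b + (l - j))) (up w) * pad (up a) (mg b (l - j)) (up w) =
     pad [] (mg (k + j) (l - j)) (up w) * pad [] (mg a b) (up (l - j) @ up w)"
    using pad_mg_assoc'[of a b "k + j" "l - j" "b + (l - j)" "[]" "up w"] assms by simp
  have 2: "pad [] (mg a b) (up (l - j) @ up w) * pad (up a @ up b) (sp (l - j) w) [] =
     pad (up (k + j)) (sp (l - j) w) [] * pad [] (mg a b) (up (w - j + l))"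
    using pad_swap[OF mg_homs[of a b "k + j"] sp_homs[of "l - j" w "w - j + l"], of "[]" "[]" "[]"] assms by simp
  have 3: "pad [] (mg a b) (up (w - j + l)) * pad (up a @ up b) (mg (w - j) l) [] =
     pad (up (k + j)) (mg (w - j) l) [] * pad [] (mg a b) (up (w - j) @ up l)"
    using pad_swap[OF mg_homs[of a b "k + j"] mg_homs[of "w - j" l "w - j + l"], of "[]" "[]" "[]"] assms by simp
  show ?thesis
    unfolding merge_top_def by (simp add: mult.assoc mult_extend[OF 1] mult_extend[OF 2] 3)
qed

text \<open>The part j split off from w ends up merged with k, which is a rung of F on the first two
  strands.\<close>

lemma merge_P:
  "pad [] (mg k l) (up w) * pad (up k) (EF.P j w l) [] = merge_top j w k l * pad [] (FF j k w) (up l)"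
proof -
  have P: "pad (up k) (EF.P j w l) [] =
    pad (up k) (mg j (l - j)) (up w) * (pad (up k @ up j) (sp (l - j) w) [] *
     (pad (up k @ up j) (mg (w - j) l) [] * pad (up k) (sp j (w - j)) (up l)))"
    by (simp add: pad_P pad_EE pad_FF mult.assoc)
  have "pad [] (mg k l) (up w) * (pad (up k) (mg j (l - j)) (up w) * (pad (up k @ up j) (sp (l - j) w) [] *
      pad (up k @ up j) (mg (w - j) l) [])) = merge_top j w k l * pad [] (mg k j) (up (w - j) @ up l)"
    using merge_top_lower[of k j k j "w - j + l" w l] by simp
  then have "pad [] (mg k l) (up w) * pad (up k) (EF.P j w l) [] =
     merge_top j w k l * (pad [] (mg k j) (up (w - j) @ up l) * pad (up k) (sp j (w - j)) (up l))"
    unfolding P by (simp flip: mult.assoc)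
  then show ?thesis by (simp add: pad_FF)
qed

text \<open>A merge followed by a split is a product E F through an upright labelled 0, so the
  square switch applies.\<close>

lemma split_merge_switch:
  "sp (k + l - i) w * mg (w - i + k) l =
     (\<Sum>j\<in>{0..w}. qb (i - k) j \<cdot> (FF (l - j) (k - i + j) (l + w - j) * EE (w - j) (w - i + k) l))"
proof -
  let ?y = "w - i + k"
  have "EE w (?y + l) (l - l) * FF l ?y l =
    (\<Sum>j\<in>{0..min w l}. qb (l - ?y + w - l) j \<cdot> (FF (l - j) (?y - w + j) (l + w - j) * EE (w - j) ?y l))"
    by (rule EE_FF)
  also have "\<dots> = (\<Sum>j\<in>{0..w}. qb (l - ?y + w - l) j \<cdot> (FF (l - j) (?y - w + j) (l + w - j) * EE (w - j) ?y l))"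
    by (rule sum.mono_neutral_left) (auto simp: FF_zero)
  finally show ?thesis by (simp add: EE_full FF_full algebra_simps)
qed

text \<open>Inside \<open>P\<close> the merge meets a split; after the switch each term contains the
  same \<open>merge_top\<close> as in \<open>merge_P\<close>. What remains to be compared lives on
  the strands w and k.\<close>

lemma P_merge:
  "EF.P i w (k + l) * pad (up w) (mg k l) [] =
    (\<Sum>j\<in>{0..w}. qb (i - k) j \<cdot> (merge_top j w k l * pad [] (FF (k - i + j) i (w - i + k) * EE (w - i) w k) (up l)))"
proof -
  let ?y = "w - i + k"
  have P: "EF.P i w (k + l) = pad [] (mg i (k + l - i)) (up w) * (pad (up i) (sp (k + l - i) w) [] *
     (pad (up i) (mg (w - i) (k + l)) [] * pad [] (sp i (w - i)) (up (k + l))))"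
    using pad_Nil[OF P_homs, of i w "k + l"] pad_P[of "[]" i w "k + l" "[]"]
    by (simp add: pad_EE pad_FF mult.assoc)
  have 1: "pad [] (sp i (w - i)) (up (k + l)) * pad (up w) (mg k l) [] =
     pad (up i @ up (w - i)) (mg k l) [] * pad [] (sp i (w - i)) (up k @ up l)"
    using pad_swap[OF sp_homs[of i "w - i" w] mg_homs[of k l "k + l"], of "[]" "[]" "[]"] by simp
  have 2: "pad (up i) (mg (w - i) (k + l)) [] * pad (up i @ up (w - i)) (mg k l) [] =
     pad (up i) (mg ?y l) [] * pad (up i) (mg (w - i) k) (up l)"
    using pad_mg_assoc'[of "w - i" k ?y l "k + l" "up i" "[]"] by simp
  have 3: "pad (up i) (sp (k + l - i) w) [] * pad (up i) (mg ?y l) [] =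
    (\<Sum>j\<in>{0..w}. qb (i - k) j \<cdot> (pad (up i) (FF (l - j) (k - i + j) (l + w - j)) [] * pad (up i) (EE (w - j) ?y l) []))"
  proof -
    have "pad (up i) (sp (k + l - i) w) [] * pad (up i) (mg ?y l) [] = pad (up i) (sp (k + l - i) w * mg ?y l) []"
      by (rule pad_comp[symmetric, OF sp_homs mg_homs]) simp_all
    also have "\<dots> = (\<Sum>j\<in>{0..w}. qb (i - k) j \<cdot> pad (up i) (FF (l - j) (k - i + j) (l + w - j) * EE (w - j) ?y l) [])"
      by (simp add: split_merge_switch pad_sum)
    also have "\<dots> = (\<Sum>j\<in>{0..w}. qb (i - k) j \<cdot> (pad (up i) (FF (l - j) (k - i + j) (l + w - j)) [] * pad (up i) (EE (w - j) ?y l) []))"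
    proof (rule sum.cong[OF HOL.refl])
      fix j
      have "EE (w - j) ?y l \<in> homs (up ?y @ up l) (up (k - i + j) @ up (l + w - j))"
        using EE_homs[of "w - j" ?y l] by (simp add: algebra_simps)
      then show "qb (i - k) j \<cdot> pad (up i) (FF (l - j) (k - i + j) (l + w - j) * EE (w - j) ?y l) [] =
        qb (i - k) j \<cdot> (pad (up i) (FF (l - j) (k - i + j) (l + w - j)) [] * pad (up i) (EE (w - j) ?y l) [])"
        by (simp add: pad_comp[OF FF_homs])
    qed
    finally show ?thesis .
  qed
  have 4: "pad [] (mg i (k + l - i)) (up w) * (pad (up i) (FF (l - j) (k - i + j) (l + w - j)) [] *
      (pad (up i) (EE (w - j) ?y l) [] * (pad (up i) (mg (w - i) k) (up l) * pad [] (sp i (w - i)) (up k @ up l)))) =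
      merge_top j w k l * pad [] (FF (k - i + j) i ?y * EE (w - i) w k) (up l)" for j
  proof -
    let ?b = "k - i + j"
    have F: "pad (up i) (FF (l - j) ?b (l + w - j)) [] = pad (up i) (mg ?b (l - j)) (up w) * pad (up i @ up ?b) (sp (l - j) w) []"
      by (simp add: pad_FF)
    have E: "pad (up i) (EE (w - j) ?y l) [] = pad (up i @ up ?b) (mg (w - j) l) [] * pad (up i) (sp ?b (w - j)) (up l)"
    proof -
      have "?y - (w - j) = ?b" by simp
      then show ?thesis by (simp only: pad_EE) simp
    qed
    have b: "k + l - i = ?b + (l - j)" by simp
    have "EE (w - i) w k \<in> homs (up w @ up k) (up i @ up ?y)"
      using EE_homs[of "w - i" w k] by (simp add: algebra_simps)
    then have A: "pad [] (FF ?b i ?y * EE (w - i) w k) (up l) =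
      pad [] (mg i ?b) (up (w - j) @ up l) * (pad (up i) (sp ?b (w - j)) (up l) *
       (pad (up i) (mg (w - i) k) (up l) * pad [] (sp i (w - i)) (up k @ up l)))"
      by (simp add: pad_comp[OF FF_homs] pad_FF pad_EE mult.assoc)
    have "pad [] (mg i (k + l - i)) (up w) * (pad (up i) (mg ?b (l - j)) (up w) *
        (pad (up i @ up ?b) (sp (l - j) w) [] * pad (up i @ up ?b) (mg (w - j) l) [])) =
      merge_top j w k l * pad [] (mg i ?b) (up (w - j) @ up l)"
      unfolding b using merge_top_lower[of i ?b k j "w - j + l" w l] by simp
    then show ?thesis
      unfolding F E A by (simp flip: mult.assoc)
  qed
  have "EF.P i w (k + l) * pad (up w) (mg k l) [] =
     pad [] (mg i (k + l - i)) (up w) * ((pad (up i) (sp (k + l - i) w) [] * pad (up i) (mg ?y l) []) *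
      (pad (up i) (mg (w - i) k) (up l) * pad [] (sp i (w - i)) (up k @ up l)))"
    unfolding P by (simp add: mult.assoc 1 mult_extend[OF 2])
  also have "\<dots> = (\<Sum>j\<in>{0..w}. qb (i - k) j \<cdot> (merge_top j w k l * pad [] (FF (k - i + j) i ?y * EE (w - i) w k) (up l)))"
    unfolding 3 by (simp add: sum_distrib_left sum_distrib_right mult.assoc 4)
  finally show ?thesis .
qed

text \<open>In front of \<open>merge_top\<close> one side has the coefficients of
  \<open>P_merge\<close> and the other those from merging F^(j) with the F rung of \<open>P\<close>.
  They differ term by term; their sums agree by \<open>coefficient_exchange\<close>.\<close>

lemma XC_merge:
  assumes s: "s = 1 \<or> s = - 1" and "0 \<le> w"
  shows "XC s w (k + l) * pad (up w) (mg k l) [] =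
    pad [] (mg k l) (up w) * (pad (up k) (XC s w l) [] * pad [] (XC s w k) (up l))"
proof -
  let ?A = "\<lambda>i j. FF (k - i + j) i (w - i + k) * EE (w - i) w k"
  have "XC s w (k + l) * pad (up w) (mg k l) [] =
    (\<Sum>i\<in>{0..w}. \<Sum>j\<in>{0..w}. (mv s i * qb (i - k) j) \<cdot> (merge_top j w k l * pad [] (?A i j) (up l)))"
    by (simp add: EF.X_restrict[of w] sum_distrib_right P_merge smult_sum)
  also have "\<dots> = (\<Sum>j\<in>{0..w}. merge_top j w k l * pad [] (\<Sum>i\<in>{0..w}. (mv s i * qb (i - k) j) \<cdot> ?A i j) (up l))"
    by (subst sum.swap) (simp add: sum_distrib_left pad_sum)
  also have "\<dots> = (\<Sum>j\<in>{0..w}. merge_top j w k l * pad [] (\<Sum>i\<in>{0..w}. (mv s i * mv s j * qb (k - i + j) j) \<cdot> ?A i j) (up l))"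
    by (intro sum.cong HOL.refl) (simp add: EF.coefficient_exchange[OF s])
  also have "\<dots> = (\<Sum>j\<in>{0..w}. mv s j \<cdot> (merge_top j w k l * (pad [] (FF j k w) (up l) * pad [] (XC s w k) (up l))))"
  proof (rule sum.cong[OF HOL.refl])
    fix j
    have "FF j k w * EF.P i w k = qb (k - i + j) j \<cdot> ?A i j" for i
    proof -
      have "FF j k w * FF (k - i) i (w + k - i) = qb (k - i + j) j \<cdot> FF (k - i + j) i (w + k - i)"
        using FF_FF[of j i "k - i" "w + k - i"] by (simp add: algebra_simps)
      then show ?thesis by (simp add: EF.P_def algebra_simps flip: mult.assoc) 
    qed
    then have "FF j k w * XC s w k = (\<Sum>i\<in>{0..w}. (mv s i * qb (k - i + j) j) \<cdot> ?A i j)"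
      by (simp add: EF.X_restrict[of w] sum_distrib_left)
    moreover have "pad [] (FF j k w) (up l) * pad [] (XC s w k) (up l) = pad [] (FF j k w * XC s w k) (up l)"
      by (rule pad_comp[symmetric, OF FF_homs XC_homs])
    ultimately show "merge_top j w k l * pad [] (\<Sum>i\<in>{0..w}. (mv s i * mv s j * qb (k - i + j) j) \<cdot> ?A i j) (up l) =
      mv s j \<cdot> (merge_top j w k l * (pad [] (FF j k w) (up l) * pad [] (XC s w k) (up l)))"
      by (simp add: pad_sum sum_distrib_left smult_sum mult_ac)
  qed
  also have "\<dots> = (\<Sum>j\<in>{0..w}. mv s j \<cdot> (pad [] (mg k l) (up w) * (pad (up k) (EF.P j w l) [] * pad [] (XC s w k) (up l))))"
    by (simp add: merge_P flip: mult.assoc)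
  also have "\<dots> = pad [] (mg k l) (up w) * (pad (up k) (XC s w l) [] * pad [] (XC s w k) (up l))"
    by (simp add: EF.X_restrict[of w w l] pad_sum sum_distrib_left sum_distrib_right)
  finally show ?thesis .
qed


section \<open>Curls\<close>

text \<open>Closing the right strand of \<open>P\<close> j leaves a digon with legs j and k - j,
  with a bubble on the leg k - j. (W2) gives the binomial with upper entry n - (k - j) and (W1) that
  with upper entry k.\<close>

lemma XC_curl:
  assumes s: "s = 1 \<or> s = - 1" and k: "1 \<le> k"
  shows "pad (up k) (cap (Up k)) [] * (pad [] (XC s k k) [Dn k] * pad (up k) (cup (Up k)) []) =
    (par k * qp (s * (k * (int n - k + 1)))) \<cdot> Id (up k)"
proof -
  have P: "pad (up k) (cap (Up k)) [] * (pad [] (EF.P j k k) [Dn k] * pad (up k) (cup (Up k)) []) =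
    (qb (int n - k + j) k * qb k j) \<cdot> Id (up k)" if j: "j \<in> {0..k}" for j
  proof -
    have PP: "pad [] (EF.P j k k) [Dn k] = pad [] (mg j (k - j)) (up k @ [Dn k]) * (pad (up j) (sp (k - j) k) [Dn k] *
       (pad (up j) (mg (k - j) k) [Dn k] * pad [] (sp j (k - j)) (up k @ [Dn k])))"
      by (simp add: pad_P pad_EE pad_FF mult.assoc)
    have up: "up k = [Up k]" using k by (simp add: up_def)
    have 1: "pad (up k) (cap (Up k)) [] * pad [] (mg j (k - j)) (up k @ [Dn k]) =
        mg j (k - j) * pad (up j @ up (k - j)) (cap (Up k)) []"
      using pad_swap[OF mg_homs[of j "k - j" k] cap_homs(2)[of k], of "[]" "[]" "[]"]
        pad_Nil[OF mg_homs[of j "k - j" k]] by (simp add: up)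
    have 2: "pad [] (sp j (k - j)) (up k @ [Dn k]) * pad (up k) (cup (Up k)) [] =
        pad (up j @ up (k - j)) (cup (Up k)) [] * sp j (k - j)"
      using pad_swap[OF sp_homs[of j "k - j" k] cup_homs(2)[of k], of "[]" "[]" "[]"]
        pad_Nil[OF sp_homs[of j "k - j" k]] by (simp add: up)
    let ?B = "pad (up (k - j)) (cap (Up k)) [] * (pad [] (sp (k - j) k) [Dn k] * (pad [] (mg (k - j) k) [Dn k] * pad (up (k - j)) (cup (Up k)) []))"
    have h: "pad (up (k - j)) (cup (Up k)) [] \<in> homs (up (k - j)) (up (k - j) @ [Up k, Dn k])"
      "pad [] (mg (k - j) k) [Dn k] \<in> homs (up (k - j) @ [Up k, Dn k]) (up (k - j + k) @ [Dn k])"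
      "pad [] (sp (k - j) k) [Dn k] \<in> homs (up (k - j + k) @ [Dn k]) (up (k - j) @ [Up k, Dn k])"
      "pad (up (k - j)) (cap (Up k)) [] \<in> homs (up (k - j) @ [Up k, Dn k]) (up (k - j))"
      by (rule pad_homs[OF cup_homs(2)] pad_homs[OF cap_homs(2)] pad_homs[OF mg_homs[OF HOL.refl]]
          pad_homs[OF sp_homs[OF HOL.refl]]; simp add: up)+
    have 3: "pad (up j @ up (k - j)) (cap (Up k)) [] * (pad (up j) (sp (k - j) k) [Dn k] *
       (pad (up j) (mg (k - j) k) [Dn k] * pad (up j @ up (k - j)) (cup (Up k)) [])) =
       qb (int n - k + j) k \<cdot> Id (up j @ up (k - j))"
    proof -
      have "pad (up j) ?B [] = pad (up j @ up (k - j)) (cap (Up k)) [] * (pad (up j) (sp (k - j) k) [Dn k] *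
       (pad (up j) (mg (k - j) k) [Dn k] * pad (up j @ up (k - j)) (cup (Up k)) []))"
        by (subst pad_comp[OF h(4) homs_comp[OF h(3) homs_comp[OF h(2,1)]]], subst pad_comp[OF h(3) homs_comp[OF h(2,1)]],
            subst pad_comp[OF h(2,1)]) simp
      moreover have "?B = qb (int n - k + j) k \<cdot> Id (up (k - j))"
      proof -
        have "int n - (k - j) = int n - k + j" by simp
        then show ?thesis using bubble[of "k - j" k] j k by (simp only: atLeastAtMost_iff diff_ge_0_iff_ge)
      qed
      ultimately show ?thesis by simp
    qed
    have "pad (up k) (cap (Up k)) [] * (pad [] (EF.P j k k) [Dn k] * pad (up k) (cup (Up k)) []) =
      mg j (k - j) * (pad (up j @ up (k - j)) (cap (Up k)) [] * (pad (up j) (sp (k - j) k) [Dn k] *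
       (pad (up j) (mg (k - j) k) [Dn k] * pad (up j @ up (k - j)) (cup (Up k)) []))) * sp j (k - j)"
      unfolding PP by (simp add: mult.assoc mult_extend[OF 1] 2)
    also have "\<dots> = qb (int n - k + j) k \<cdot> (mg j (k - j) * sp j (k - j))"
      unfolding 3 by (simp add: comp_Id[OF mg_homs[of j "k - j" k]])
    also have "mg j (k - j) * sp j (k - j) = qb k j \<cdot> Id (up k)"
      using digon[of j "k - j"] qb_sym[of k j] k by simp
    finally show ?thesis by simp
  qed
  have "pad (up k) (cap (Up k)) [] * (pad [] (XC s k k) [Dn k] * pad (up k) (cup (Up k)) []) =
    (\<Sum>j\<in>{0..k}. mv s j * (qb (int n - k + j) k * qb k j)) \<cdot> Id (up k)"
    by (simp add: EF.X_restrict[of k] pad_sum sum_distrib_left sum_distrib_right P smult_sum_left)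
  also have "(\<Sum>j\<in>{0..k}. mv s j * (qb (int n - k + j) k * qb k j)) = par k * qp (s * (k * (int n - k + 1)))"
    using qb_sum_shifted[OF s, of k "int n - k"] k by (simp add: mult.assoc)
  finally show ?thesis .
qed


section \<open>Crossings of arbitrarily oriented strands\<close>

definition cr :: "bool \<Rightarrow> strand \<Rightarrow> strand \<Rightarrow> webmod" where
  "cr s x y = ev (X s x y)"

text \<open>The exponent with v = q^(sg s) for the crossing of sign s.\<close>

definition sg :: "bool \<Rightarrow> int" where
  "sg s = (if s then - 1 else 1)"

lemma sg_cases: "sg s = 1 \<or> sg s = - 1"
  by (simp add: sg_def)

lemma sg_Not [simp]: "sg (\<not> s) = - sg s"
  by (simp add: sg_def)

lemma Up_strands: "Up k \<in> strands n \<longleftrightarrow> 1 \<le> k \<and> k \<le> int n" and Dn_strands: "Dn k \<in> strands n \<longleftrightarrow> Up k \<in> strands n"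
  by (simp_all add: strands_def)

lemma up_strand: "Up k \<in> strands n \<Longrightarrow> up k = [Up k]"
  by (auto simp: up_def strands_def)

lemma X_boundary: "x \<in> strands n \<Longrightarrow> y \<in> strands n \<Longrightarrow>
    admissible n (X s x y) \<and> src (X s x y) = [x, y] \<and> tgt (X s x y) = [y, x]"
  by (cases x; cases y) (auto simp: strands_def rot_def)

lemma cr_homs: "x \<in> strands n \<Longrightarrow> y \<in> strands n \<Longrightarrow> cr s x y \<in> homs [x, y] [y, x]"
  using X_boundary[of x y s] ev_homs[of "X s x y"] by (simp add: cr_def)

lemma cr_Up_Up: "Up k \<in> strands n \<Longrightarrow> Up l \<in> strands n \<Longrightarrow> cr s (Up k) (Up l) = XC (sg s) k l"
  by (simp add: cr_def sg_def ladder_crossing_eq Up_strands)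

lemma tens_simps [simp]:
  "cap x \<otimes> Id [] = cap x" "cup x \<otimes> Id [] = cup x"
  "Id [] \<otimes> (cap x \<otimes> Id ys) = cap x \<otimes> Id ys" "Id [] \<otimes> (cup x \<otimes> Id ys) = cup x \<otimes> Id ys"
  by (rule tens_Id_Nil[OF cap_homs(1)] tens_Id_Nil[OF cup_homs(1)]
      Id_Nil_tens[OF homs_tens[OF cap_homs(1) Id_homs]] Id_Nil_tens[OF homs_tens[OF cup_homs(1) Id_homs]])+

lemma cr_Up_Dn: "cr s (Up k) (Dn l) =
    pad [Dn l, Up k] (cap (Up l)) [] * (pad [Dn l] (cr (\<not> s) (Up l) (Up k)) [Dn l] * pad [] (cup (Dn l)) [Up k, Dn l])"
  and cr_Dn_Up: "cr s (Dn k) (Up l) =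
    pad [] (cap (Dn k)) [Up l, Dn k] * (pad [Dn k] (cr (\<not> s) (Up l) (Up k)) [Dn k] * pad [Dn k, Up l] (cup (Up k)) [])"
  by (simp_all add: cr_def pad_def)

lemma cr_Up_inverse:
  assumes "Up k \<in> strands n" "Up l \<in> strands n"
  shows "cr (\<not> s) (Up l) (Up k) * cr s (Up k) (Up l) = Id [Up k, Up l]"
  using XC_inverse[OF sg_cases, of k l s] assms
  by (simp add: cr_Up_Up) (simp add: Up_strands up_strand)

text \<open>The strand x passes all of \<open>ys\<close> from left to right, over them iff s. In
  \<open>YY\<close> it passes back from right to left; the negated sign keeps it on the same level,
  so that \<open>YY\<close> is the candidate inverse.\<close>

primrec XX :: "bool \<Rightarrow> strand \<Rightarrow> strand list \<Rightarrow> webmod" where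
  "XX s x [] = Id [x]"
| "XX s x (y # ys) = pad [y] (XX s x ys) [] * pad [] (cr s x y) ys"

primrec YY :: "bool \<Rightarrow> strand \<Rightarrow> strand list \<Rightarrow> webmod" where
  "YY s x [] = Id [x]"
| "YY s x (y # ys) = pad [] (cr (\<not> s) y x) ys * pad [y] (YY s x ys) []"

lemma XX_homs: "x \<in> strands n \<Longrightarrow> set ys \<subseteq> strands n \<Longrightarrow> XX s x ys \<in> homs (x # ys) (ys @ [x])"
  by (induction ys) (auto intro!: homs_comp[OF pad_homs pad_homs[OF cr_homs]])

lemma YY_homs: "x \<in> strands n \<Longrightarrow> set ys \<subseteq> strands n \<Longrightarrow> YY s x ys \<in> homs (ys @ [x]) (x # ys)"
  by (induction ys) (auto intro!: homs_comp[OF pad_homs[OF cr_homs] pad_homs])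

lemma XX_single: "x \<in> strands n \<Longrightarrow> y \<in> strands n \<Longrightarrow> XX s x [y] = cr s x y"
  and YY_single: "x \<in> strands n \<Longrightarrow> y \<in> strands n \<Longrightarrow> YY s x [y] = cr (\<not> s) y x"
  using pad_Nil[OF cr_homs] Id_comp[OF cr_homs] comp_Id[OF cr_homs] by auto

lemma XX_two:
  assumes "x \<in> strands n" "y \<in> strands n" "z \<in> strands n"
  shows "XX s x [y, z] = pad [y] (cr s x z) [] * pad [] (cr s x y) [z]"
    and "YY s x [y, z] = pad [] (cr (\<not> s) y x) [z] * pad [y] (cr (\<not> s) z x) []"
  using XX_single[OF assms(1,3)] YY_single[OF assms(1,3)] by auto

lemma XX_append:
  assumes "x \<in> strands n" "set ys \<subseteq> strands n" "set zs \<subseteq> strands n"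
  shows "XX s x (ys @ zs) = pad ys (XX s x zs) [] * pad [] (XX s x ys) zs"
  using assms(2)
proof (induction ys)
  case Nil
  then show ?case using pad_Nil[OF XX_homs[OF assms(1,3)]] comp_Id[OF XX_homs[OF assms(1,3)]] by simp
next
  case (Cons y ys)
  have "pad [y] (XX s x (ys @ zs)) [] = pad (y # ys) (XX s x zs) [] * pad [y] (XX s x ys) zs"
    using Cons assms by (simp add: pad_comp[OF pad_homs[OF XX_homs] pad_homs[OF XX_homs]])
  moreover have "pad [] (pad [y] (XX s x ys) [] * pad [] (cr s x y) ys) zs = pad [y] (XX s x ys) zs * pad [] (cr s x y) (ys @ zs)"
    using Cons assms by (subst pad_comp[OF pad_homs[OF XX_homs] pad_homs[OF cr_homs]]) auto
  ultimately show ?case by (simp add: mult.assoc)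
qed

lemma YY_append:
  assumes "x \<in> strands n" "set ys \<subseteq> strands n" "set zs \<subseteq> strands n"
  shows "YY s x (ys @ zs) = pad [] (YY s x ys) zs * pad ys (YY s x zs) []"
  using assms(2)
proof (induction ys)
  case Nil
  then show ?case using pad_Nil[OF YY_homs[OF assms(1,3)]] Id_comp[OF YY_homs[OF assms(1,3)]] by simp
next
  case (Cons y ys)
  have "pad [y] (YY s x (ys @ zs)) [] = pad [y] (YY s x ys) zs * pad (y # ys) (YY s x zs) []"
    using Cons assms by (simp add: pad_comp[OF pad_homs[OF YY_homs] pad_homs[OF YY_homs]])
  moreover have "pad [] (pad [] (cr (\<not> s) y x) ys * pad [y] (YY s x ys) []) zs = pad [] (cr (\<not> s) y x) (ys @ zs) * pad [y] (YY s x ys) zs"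
    using Cons assms by (subst pad_comp[OF pad_homs[OF cr_homs] pad_homs[OF YY_homs]]) auto
  ultimately show ?case by (simp add: mult.assoc)
qed

declare XX.simps(2) [simp del] YY.simps(2) [simp del]

text \<open>A strand \<open>x\<close> can be moved across \<open>f\<close> from left to right (\<open>natl\<close>) or from right to left
  (\<open>natr\<close>).\<close>

definition natl :: "bool \<Rightarrow> strand \<Rightarrow> strand list \<Rightarrow> strand list \<Rightarrow> webmod \<Rightarrow> bool" where
  "natl s x ys zs f \<longleftrightarrow> XX s x zs * pad [x] f [] = pad [] f [x] * XX s x ys"

definition natr :: "bool \<Rightarrow> strand \<Rightarrow> strand list \<Rightarrow> strand list \<Rightarrow> webmod \<Rightarrow> bool" where
  "natr s x ys zs f \<longleftrightarrow> YY s x zs * pad [] f [x] = pad [x] f [] * YY s x ys"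

lemma natl_comp:
  assumes "natl s x ys zs f" "natl s x xs ys g" "f \<in> homs ys zs" "g \<in> homs xs ys"
  shows "natl s x xs zs (f * g)"
  using assms(1,2) unfolding natl_def pad_comp[OF assms(3,4)]
  by (metis mult.assoc)

lemma natr_comp:
  assumes "natr s x ys zs f" "natr s x xs ys g" "f \<in> homs ys zs" "g \<in> homs xs ys"
  shows "natr s x xs zs (f * g)"
  using assms(1,2) unfolding natr_def pad_comp[OF assms(3,4)]
  by (metis mult.assoc)

lemma natl_pad:
  assumes f: "natl s x ys zs f" "f \<in> homs ys zs" and x: "x \<in> strands n"
    and sub: "set us \<subseteq> strands n" "set vs \<subseteq> strands n" "set ys \<subseteq> strands n" "set zs \<subseteq> strands n"
  shows "natl s x (us @ ys @ vs) (us @ zs @ vs) (pad us f vs)"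
proof -
  have XX: "XX s x (us @ ws @ vs) = pad (us @ ws) (XX s x vs) [] * (pad us (XX s x ws) vs * pad [] (XX s x us) (ws @ vs))"
    if ws: "set ws \<subseteq> strands n" for ws
  proof -
    have "XX s x (us @ ws @ vs) = pad us (XX s x (ws @ vs)) [] * pad [] (XX s x us) (ws @ vs)"
      using x sub ws by (simp add: XX_append)
    also have "pad us (XX s x (ws @ vs)) [] = pad (us @ ws) (XX s x vs) [] * pad us (XX s x ws) vs"
      using x sub ws by (simp add: XX_append pad_comp[OF pad_homs[OF XX_homs] pad_homs[OF XX_homs]])
    finally show ?thesis by (simp add: mult.assoc)
  qed
  have 1: "pad [] (XX s x us) (zs @ vs) * pad (x # us) f vs = pad (us @ [x]) f vs * pad [] (XX s x us) (ys @ vs)"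
    using pad_swap[OF XX_homs[OF x sub(1), of s] f(2), of "[]" "[]" vs] by simp
  have 2: "pad us (XX s x zs) vs * pad (us @ [x]) f vs = pad us f (x # vs) * pad us (XX s x ys) vs"
  proof -
    have "pad us (XX s x zs * pad [x] f []) vs = pad us (pad [] f [x] * XX s x ys) vs"
      using f(1) by (simp add: natl_def)
    then show ?thesis
      by (subst (asm) pad_comp[OF XX_homs[OF x sub(4)] pad_homs[OF f(2)]], simp, simp)
         (subst (asm) pad_comp[OF pad_homs[OF f(2)] XX_homs[OF x sub(3)]], simp_all)
  qed
  have 3: "pad (us @ zs) (XX s x vs) [] * pad us f (x # vs) = pad us f (vs @ [x]) * pad (us @ ys) (XX s x vs) []"
    using pad_swap[OF f(2) XX_homs[OF x sub(2), of s], of us "[]" "[]"] by simp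
  show ?thesis
    unfolding natl_def using sub
    by (simp add: XX mult.assoc 1 mult_extend[OF 2] mult_extend[OF 3])
qed

lemma natr_pad:
  assumes f: "natr s x ys zs f" "f \<in> homs ys zs" and x: "x \<in> strands n"
    and sub: "set us \<subseteq> strands n" "set vs \<subseteq> strands n" "set ys \<subseteq> strands n" "set zs \<subseteq> strands n"
  shows "natr s x (us @ ys @ vs) (us @ zs @ vs) (pad us f vs)"
proof -
  have YY: "YY s x (us @ ws @ vs) = pad [] (YY s x us) (ws @ vs) * (pad us (YY s x ws) vs * pad (us @ ws) (YY s x vs) [])"
    if ws: "set ws \<subseteq> strands n" for ws
  proof -
    have "YY s x (us @ ws @ vs) = pad [] (YY s x us) (ws @ vs) * pad us (YY s x (ws @ vs)) []"
      using x sub ws by (simp add: YY_append)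
    also have "pad us (YY s x (ws @ vs)) [] = pad us (YY s x ws) vs * pad (us @ ws) (YY s x vs) []"
      using x sub ws by (simp add: YY_append pad_comp[OF pad_homs[OF YY_homs] pad_homs[OF YY_homs]])
    finally show ?thesis .
  qed
  have 1: "pad (us @ zs) (YY s x vs) [] * pad us f (vs @ [x]) = pad us f (x # vs) * pad (us @ ys) (YY s x vs) []"
    using pad_swap[OF f(2) YY_homs[OF x sub(2), of s], of us "[]" "[]"] by simp
  have 2: "pad us (YY s x zs) vs * pad us f (x # vs) = pad (us @ [x]) f vs * pad us (YY s x ys) vs"
  proof -
    have "pad us (YY s x zs * pad [] f [x]) vs = pad us (pad [x] f [] * YY s x ys) vs"
      using f(1) by (simp add: natr_def)
    then show ?thesis
      by (subst (asm) pad_comp[OF YY_homs[OF x sub(4)] pad_homs[OF f(2)]], simp, simp)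
         (subst (asm) pad_comp[OF pad_homs[OF f(2)] YY_homs[OF x sub(3)]], simp_all)
  qed
  have 3: "pad [] (YY s x us) (zs @ vs) * pad (us @ [x]) f vs = pad (x # us) f vs * pad [] (YY s x us) (ys @ vs)"
    using pad_swap[OF YY_homs[OF x sub(1), of s] f(2), of "[]" "[]" vs] by simp
  show ?thesis
    unfolding natr_def using sub
    by (simp add: YY mult.assoc 1 mult_extend[OF 2] mult_extend[OF 3])
qed

section \<open>Moving an upward strand across vertices and arcs\<close>

lemma Merge_homs [simp]: "wb (Merge k l) \<in> homs [Up k, Up l] [Up (k + l)]"
  and Split_homs [simp]: "wb (Split k l) \<in> homs [Up (k + l)] [Up k, Up l]"
  by (auto intro: homs_wb)

lemma natl_Merge:
  assumes "Up w \<in> strands n" "1 \<le> k" "1 \<le> l" "k + l \<le> int n"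
  shows "natl s (Up w) [Up k, Up l] [Up (k + l)] (wb (Merge k l))"
proof -
  have st: "Up k \<in> strands n" "Up l \<in> strands n" "Up (k + l) \<in> strands n" using assms by (auto simp: Up_strands)
  have "XC (sg s) w (k + l) * pad (up w) (mg k l) [] =
    pad [] (mg k l) (up w) * (pad (up k) (XC (sg s) w l) [] * pad [] (XC (sg s) w k) (up l))"
    using assms by (intro XC_merge sg_cases) (simp add: Up_strands)
  moreover have "mg k l = wb (Merge k l)" using assms by (simp add: mg_def merge0_def)
  ultimately show ?thesis
    using assms st by (simp add: natl_def XX_single XX_two up_strand flip: cr_Up_Up)
qed

text \<open>The reflection of moving across a merge from the left, for the opposite crossing as used
  in \<open>YY\<close>.\<close>

lemma natr_Split:
  assumes "Up w \<in> strands n" "1 \<le> k" "1 \<le> l" "k + l \<le> int n"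
  shows "natr s (Up w) [Up (k + l)] [Up k, Up l] (wb (Split k l))"
proof -
  have st: "Up k \<in> strands n" "Up l \<in> strands n" "Up (k + l) \<in> strands n" using assms by (auto simp: Up_strands)
  have "XC (sg (\<not> s)) w (k + l) * pad (up w) (mg k l) [] =
    pad [] (mg k l) (up w) * (pad (up k) (XC (sg (\<not> s)) w l) [] * pad [] (XC (sg (\<not> s)) w k) (up l))"
    using assms by (intro XC_merge sg_cases) (simp add: Up_strands)
  from arg_cong[OF this, of flp]
  have "pad (up w) (sp k l) [] * XC (sg (\<not> s)) (k + l) w =
     pad [] (XC (sg (\<not> s)) k w) (up l) * (pad (up k) (XC (sg (\<not> s)) l w) [] * pad [] (sp k l) (up w))"
    by (simp add: flp_mult flp_pad mult.assoc del: sg_Not)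
  moreover have "sp k l = wb (Split k l)" using assms by (simp add: sp_def split0_def)
  ultimately show ?thesis
    using assms st by (simp add: natr_def YY_single XX_two up_strand mult.assoc del: sg_Not flip: cr_Up_Up)
qed

text \<open>The antiparallel crossing is by definition a rotation of the inverse of the parallel one; the cup undoes
  the rotation.\<close>

lemma natl_cup_Dn:
  assumes w: "Up w \<in> strands n" and l: "Up l \<in> strands n"
  shows "natl s (Up w) [] [Dn l, Up l] (cup (Dn l))"
proof -
  have l': "Dn l \<in> strands n" using l by (simp add: Dn_strands)
  let ?c = "cr (\<not> s) (Up l) (Up w)" and ?d = "cr s (Up w) (Up l)"
  note c = cr_homs[OF l w, of "\<not> s"] and d = cr_homs[OF w l, of s]
  have pc: "pad [] (cr s (Up w) (Dn l)) [Up l] = pad [Dn l, Up w] (cap (Up l)) [Up l] *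
      (pad [Dn l] ?c [Dn l, Up l] * pad [] (cup (Dn l)) [Up w, Dn l, Up l])"
    unfolding cr_Up_Dn
    by (subst pad_comp[OF pad_homs[OF cap_homs(2)] homs_comp[OF pad_homs[OF c] pad_homs[OF cup_homs(3)]]], simp_all)
       (subst pad_comp[OF pad_homs[OF c] pad_homs[OF cup_homs(3)]], simp_all)
  note 1 = pad_swap[OF cup_homs(3)[of l] cup_homs(3)[of l], of "[]" "[Up w]" "[]", simplified]
  note 2 = pad_swap[OF c cup_homs(3)[of l], of "[Dn l]" "[]" "[]", simplified]
  note 3 = zigzag_left[of "[Dn l, Up w]" "Up l" "[]", simplified]
  have 4: "pad [Dn l] ?d [] * pad [Dn l] ?c [] = Id [Dn l, Up l, Up w]"
    using cr_Up_inverse[OF l w, of "\<not> s"] by (simp flip: pad_comp[OF d c])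
  have 5: "Id [Dn l, Up w, Up l] * pad [Dn l] ?c [] = pad [Dn l] ?c []"
    by (rule Id_comp[OF pad_homs[OF c]]) simp_all
  have 6: "Id [Dn l, Up l, Up w] * pad [] (cup (Dn l)) [Up w] = pad [] (cup (Dn l)) [Up w]"
      "pad [] (cup (Dn l)) [Up w] * Id [Up w] = pad [] (cup (Dn l)) [Up w]"
    by (rule Id_comp[OF pad_homs[OF cup_homs(3)]] comp_Id[OF pad_homs[OF cup_homs(3)]]; simp)+
  have "pad [Dn l] ?d [] * (pad [] (cr s (Up w) (Dn l)) [Up l] * pad [Up w] (cup (Dn l)) []) = pad [] (cup (Dn l)) [Up w]"
    unfolding pc by (simp add: mult.assoc 1 mult_extend[OF 2] mult_extend1[OF 3] mult_extend1[OF 5] mult_extend1[OF 4] 6)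
  then show ?thesis
    unfolding natl_def using w l l' by (simp add: 6 XX_two mult.assoc)
qed


lemma pad_comp3:
  "f \<in> homs cs ds \<Longrightarrow> g \<in> homs bs cs \<Longrightarrow> h \<in> homs as bs \<Longrightarrow>
    pad xs (f * (g * h)) ys = pad xs f ys * (pad xs g ys * pad xs h ys)"
  by (subst pad_comp[OF _ homs_comp]) (auto simp: pad_comp)

lemma Id_pad: "f \<in> homs as bs \<Longrightarrow> us = xs @ bs @ ys \<Longrightarrow> Id us * pad xs f ys = pad xs f ys"
  and pad_Id_right: "f \<in> homs as bs \<Longrightarrow> us = xs @ as @ ys \<Longrightarrow> pad xs f ys * Id us = pad xs f ys"
  by (auto intro!: Id_comp[OF pad_homs[OF _ HOL.refl HOL.refl]] comp_Id[OF pad_homs[OF _ HOL.refl HOL.refl]])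

lemma Id_simps [simp]:
  "us = xs @ x # opp x # ys \<Longrightarrow> Id us * pad xs (cup x) ys = pad xs (cup x) ys"
  "us = xs @ ys \<Longrightarrow> pad xs (cup x) ys * Id us = pad xs (cup x) ys"
  "us = xs @ ys \<Longrightarrow> Id us * pad xs (cap x) ys = pad xs (cap x) ys"
  "us = xs @ x # opp x # ys \<Longrightarrow> pad xs (cap x) ys * Id us = pad xs (cap x) ys"
  "us = xs @ x # opp x # ys \<Longrightarrow> Id us * (pad xs (cup x) ys * r) = pad xs (cup x) ys * r"
  "us = xs @ ys \<Longrightarrow> pad xs (cup x) ys * (Id us * r) = pad xs (cup x) ys * r"
  "us = xs @ ys \<Longrightarrow> Id us * (pad xs (cap x) ys * r) = pad xs (cap x) ys * r"
  "us = xs @ x # opp x # ys \<Longrightarrow> pad xs (cap x) ys * (Id us * r) = pad xs (cap x) ys * r"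
  by (simp_all add: Id_pad[OF cup_homs(1)] pad_Id_right[OF cup_homs(1)] Id_pad[OF cap_homs(1)] pad_Id_right[OF cap_homs(1)]
      flip: mult.assoc)

lemma Id_cr [simp]:
  assumes "x \<in> strands n" "y \<in> strands n"
  shows "us = xs @ y # x # ys \<Longrightarrow> Id us * pad xs (cr s x y) ys = pad xs (cr s x y) ys"
    "us = xs @ x # y # ys \<Longrightarrow> pad xs (cr s x y) ys * Id us = pad xs (cr s x y) ys"
    "us = xs @ y # x # ys \<Longrightarrow> Id us * (pad xs (cr s x y) ys * r) = pad xs (cr s x y) ys * r"
    "us = xs @ x # y # ys \<Longrightarrow> pad xs (cr s x y) ys * (Id us * r) = pad xs (cr s x y) ys * r"
  by (simp_all add: Id_pad[OF cr_homs[OF assms]] pad_Id_right[OF cr_homs[OF assms]] flip: mult.assoc)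

lemma pad_cr_Up_Dn:
  assumes "Up k \<in> strands n" "Up l \<in> strands n"
  shows "pad xs (cr s (Up k) (Dn l)) ys = pad (xs @ [Dn l, Up k]) (cap (Up l)) ys *
    (pad (xs @ [Dn l]) (cr (\<not> s) (Up l) (Up k)) (Dn l # ys) * pad xs (cup (Dn l)) (Up k # Dn l # ys))"
  unfolding cr_Up_Dn
  by (subst pad_comp3[OF pad_homs[OF cap_homs(2)] pad_homs[OF cr_homs[OF assms(2,1)]] pad_homs[OF cup_homs(3)]]) simp_all

lemma pad_cr_Dn_Up:
  assumes "Up k \<in> strands n" "Up l \<in> strands n"
  shows "pad xs (cr s (Dn k) (Up l)) ys = pad xs (cap (Dn k)) (Up l # Dn k # ys) *
    (pad (xs @ [Dn k]) (cr (\<not> s) (Up l) (Up k)) (Dn k # ys) * pad (xs @ [Dn k, Up l]) (cup (Up k)) ys)"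
  unfolding cr_Dn_Up
  by (subst pad_comp3[OF pad_homs[OF cap_homs(3)] pad_homs[OF cr_homs[OF assms(2,1)]] pad_homs[OF cup_homs(2)]]) simp_all

lemma pad_cr_inverse:
  assumes "x \<in> strands n" "y \<in> strands n" "cr (\<not> s) y x * cr s x y = Id [x, y]"
  shows "pad xs (cr (\<not> s) y x) ys * pad xs (cr s x y) ys = Id (xs @ x # y # ys)"
  using arg_cong[OF assms(3), of "\<lambda>f. pad xs f ys"] by (simp add: pad_comp[OF cr_homs[OF assms(2,1)] cr_homs[OF assms(1,2)]])

text \<open>Of the eight combinations of arc, orientation and direction of passage, four follow from
  the definition of the bent crossing, a zigzag and the parallel inverse. This is one; the other
  four require invertible antiparallel crossings.\<close>

lemma natl_cap_Up:
  assumes w: "Up w \<in> strands n" and l: "Up l \<in> strands n"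
  shows "natl s (Up w) [Up l, Dn l] [] (cap (Up l))"
proof -
  note c = cr_homs[OF l w, of "\<not> s"]
  note 1 = pad_swap[OF cap_homs(2)[of l] cap_homs(2)[of l], of "[]" "[Up w]" "[]", simplified]
  note 2 = pad_swap[OF cap_homs(2)[of l] c, of "[]" "[]" "[Dn l]", simplified]
  note 3 = zigzag_left[of "[]" "Up l" "[Up w, Dn l]", simplified]
  note 4 = pad_cr_inverse[OF w l cr_Up_inverse[OF w l, of s], of "[]" "[Dn l]", simplified]
  show ?thesis
    unfolding natl_def using w l
    by (simp add: XX_two Dn_strands pad_cr_Up_Dn mult.assoc mult_extend[OF 1] mult_extend[OF 2] mult_extend1[OF 3] 4)
qed

lemma natr_cup_Up:
  assumes w: "Up w \<in> strands n" and l: "Up l \<in> strands n"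
  shows "natr s (Up w) [] [Up l, Dn l] (cup (Up l))"
proof -
  note c = cr_homs[OF w l, of s]
  note 1 = pad_swap[OF cup_homs(2)[of l] cup_homs(2)[of l], of "[]" "[Up w]" "[]", simplified, symmetric]
  note 2 = pad_swap[OF cup_homs(2)[of l] c, of "[]" "[]" "[Dn l]", simplified, symmetric]
  note 3 = zigzag_right[of "[]" "Up l" "[Up w, Dn l]", simplified]
  note 4 = pad_cr_inverse[OF w l cr_Up_inverse[OF w l, of s], of "[]" "[Dn l]", simplified]
  show ?thesis
    unfolding natr_def using w l
    by (simp add: XX_two Dn_strands pad_cr_Dn_Up mult.assoc 1 mult_extend[OF 2] mult_extend1[OF 3] mult_extend1[OF 4])
qed

lemma natr_cap_Dn:
  assumes w: "Up w \<in> strands n" and l: "Up l \<in> strands n"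
  shows "natr s (Up w) [Dn l, Up l] [] (cap (Dn l))"
proof -
  note c = cr_homs[OF w l, of s]
  note 1 = pad_swap[OF cap_homs(3)[of l] cap_homs(3)[of l], of "[]" "[Up w]" "[]", simplified, symmetric]
  note 2 = pad_swap[OF c cap_homs(3)[of l], of "[Dn l]" "[]" "[]", simplified, symmetric]
  note 3 = zigzag_right[of "[Dn l, Up w]" "Up l" "[]", simplified]
  note 4 = pad_cr_inverse[OF l w cr_Up_inverse[OF l w, of "\<not> s"], of "[Dn l]" "[]", simplified]
  show ?thesis
    unfolding natr_def using w l
    by (simp add: XX_two Dn_strands pad_cr_Dn_Up mult.assoc mult_extend[OF 1] mult_extend[OF 2] mult_extend1[OF 3] 4)
qed


section \<open>Invertibility of crossings of antiparallel strands\<close>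

lemma bubble_left:
  assumes "0 \<le> k" "1 \<le> l"
  shows "pad [] (cap (Dn l)) (up k) * (pad [Dn l] (sp l k) [] * (pad [Dn l] (mg l k) [] * pad [] (cup (Dn l)) (up k))) =
    qb (int n - k) l \<cdot> Id (up k)"
proof -
  obtain a b where ab: "k = int a" "l = int b" using assms by (meson order.trans zero_le_imp_eq_int zero_le_one)
  have *: "f \<otimes> Id [] = f" if "f \<in> homs as bs" for f as bs
    using that by simp
  show ?thesis
    using relation_eq[OF lin_mirror_relations[OF relations.bubble[of n a b], unfolded lin_mirror_diff lin_mirror_scale lin_mirror_vec]] Zq_qbinom assms
    by (simp add: free_webs_vec free_webs_scale cls_vec cls_qbinom wb_Comp wb_Tens mg_def sp_def ab pad_def
        cap0_def cup0_def dn_def *[OF mg_homs[OF HOL.refl], unfolded mg_def] *[OF sp_homs[OF HOL.refl], unfolded sp_def])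
qed

lemma saddle_right: "n \<ge> 1 \<Longrightarrow> Id [Dn (int n), Up (int n)] = cup (Dn (int n)) * cap (Dn (int n))"
  using relation_eq[OF lin_mirror_relations[OF relations.saddle[of n], unfolded lin_mirror_diff lin_mirror_scale lin_mirror_vec]]
  by (simp add: free_webs_vec cls_vec wb_Comp)

text \<open>A circle is a bubble on a strand labelled 0, here with value [n choose n] = 1.\<close>

lemma circle_n:
  assumes "n \<ge> 1"
  shows "cap (Up (int n)) * cup (Up (int n)) = Id []" "cap (Dn (int n)) * cup (Dn (int n)) = Id []"
proof -
  have st: "up (int n) = [Up (int n)]" using assms by (simp add: up_def)
  show "cap (Up (int n)) * cup (Up (int n)) = Id []"
    using bubble[of 0 "int n"] assms qb_self[of "int n"] by (simp add: st pad_Nil[OF cap_homs(2)] pad_Nil[OF cup_homs(2)])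
      (metis comp_Id[OF cap_homs(2)] mult.assoc)
  show "cap (Dn (int n)) * cup (Dn (int n)) = Id []"
    using bubble_left[of 0 "int n"] assms qb_self[of "int n"] by (simp add: st pad_Nil[OF cap_homs(3)] pad_Nil[OF cup_homs(3)])
      (metis comp_Id[OF cap_homs(3)] mult.assoc)
qed

text \<open>Closing the extra strand into a circle of value 1 recovers f.\<close>

lemma cancel_n:
  assumes n: "n \<ge> 1" and f: "f \<in> homs us us" and eq: "pad [] f [Up (int n)] = Id (us @ [Up (int n)])"
  shows "f = Id us"
proof -
  have 1: "pad us (cap (Up (int n)) * cup (Up (int n))) [] = pad us (cap (Up (int n))) [] * pad us (cup (Up (int n))) []"
    by (rule pad_comp[OF cap_homs(2) cup_homs(2)])
  have 2: "pad [] f [] * pad us (cap (Up (int n))) [] = pad us (cap (Up (int n))) [] * pad [] f [Up (int n), Dn (int n)]"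
    using pad_swap[OF f cap_homs(2)[of "int n"], of "[]" "[]" "[]"] by simp
  have "pad [] f [Up (int n), Dn (int n)] = pad [] (pad [] f [Up (int n)]) [Dn (int n)]" by simp
  then have 3: "pad [] f [Up (int n), Dn (int n)] = Id (us @ [Up (int n), Dn (int n)])" by (simp add: eq del: pad_pad)
  have "f = pad [] f [] * pad us (cap (Up (int n)) * cup (Up (int n))) []"
    using f by (simp add: circle_n[OF n] pad_Nil[OF f])
  also have "\<dots> = pad us (cap (Up (int n)) * cup (Up (int n))) []"
    unfolding 1 by (simp add: mult_extend[OF 2] 3)
  finally show ?thesis by (simp add: circle_n[OF n])
qed

lemma cups_single [simp]: "wb (cups [x]) = cup x" and caps_single [simp]: "wb (caps [x]) = cap x"
proof -
  show "wb (cups [x]) = cup x" by (simp add: wb_Comp wb_Tens) (rule Id_comp[OF cup_homs(1)])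
  show "wb (caps [x]) = cap x" by (simp add: wb_Comp wb_Tens) (rule comp_Id[OF cap_homs(1)])
qed

lemma cups_Cons: "wb (cups (x # xs)) = pad [x] (wb (cups xs)) [opp x] * cup x"
  and caps_Cons: "wb (caps (x # xs)) = cap x * pad [x] (wb (caps xs)) [opp x]"
  by (simp_all add: wb_Comp wb_Tens pad_def)

lemma pad_caps_two: "pad us (wb (caps [x, y])) vs = pad us (cap x) vs * pad (us @ [x]) (cap y) (opp x # vs)"
  and pad_cups_two: "pad us (wb (cups [x, y])) vs = pad (us @ [x]) (cup y) (opp x # vs) * pad us (cup x) vs"
  unfolding cups_Cons[of x "[y]"] caps_Cons[of x "[y]"] cups_single caps_single
  by (subst pad_comp[OF cap_homs(1) pad_homs[OF cap_homs(1)]] pad_comp[OF pad_homs[OF cup_homs(1)] cup_homs(1)]; simp)+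

text \<open>For \<open>l + m = n\<close>, a downward strand \<open>l\<close> next to an upward strand \<open>n\<close> is isomorphic to an upward strand
  \<open>m\<close>; this reduces antiparallel crossings to parallel ones.\<close>

definition into :: "int \<Rightarrow> webmod" where
  "into l = pad [Dn l] (mg l (int n - l)) [] * pad [] (cup (Dn l)) (up (int n - l))"

definition outof :: "int \<Rightarrow> webmod" where
  "outof l = pad [] (cap (Dn l)) (up (int n - l)) * pad [Dn l] (sp l (int n - l)) []"

lemma into_homs: "Up l \<in> strands n \<Longrightarrow> into l \<in> homs (up (int n - l)) [Dn l, Up (int n)]"
  and outof_homs: "Up l \<in> strands n \<Longrightarrow> outof l \<in> homs [Dn l, Up (int n)] (up (int n - l))"
  unfolding into_def outof_def
  by (rule homs_comp[OF pad_homs[OF mg_homs[of _ _ "int n"]] pad_homs[OF cup_homs(3)]]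
      homs_comp[OF pad_homs[OF cap_homs(3)] pad_homs[OF sp_homs[of _ _ "int n"]]];
      force simp: up_strand Up_strands up_def)+

text \<open>A bubble labelled l on a strand n - l has the value [l choose l] = 1.\<close>

lemma outof_into:
  assumes "Up l \<in> strands n"
  shows "outof l * into l = Id (up (int n - l))"
  using bubble_left[of "int n - l" l] assms qb_self[of l]
  by (simp add: outof_def into_def mult.assoc Up_strands)

text \<open>Carrying the split through a rotation, from one bent drawing to the other, turns the
  arcs into the bubble of (W2) with labels l and m, whose value is [n - l choose m] = 1 since l + m
  = n.\<close>

lemma rotated_bubble:
  assumes l: "1 \<le> l" and m: "1 \<le> m" and lm: "l + m = int n"
  defines "N \<equiv> int n"
  shows "pad [Dn l] (cap (Up N)) [] * (pad [Dn l] (mg l m) [Dn N] * (pad [] (cup (Dn l)) [Up m, Dn N] *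
    (pad [] (cap (Dn l)) [Up m, Dn N] * (pad [Dn l] (sp l m) [Dn N] * pad [Dn l] (cup (Up N)) [])))) = Id [Dn l]"
proof -
  have up: "up l = [Up l]" "up m = [Up m]" "up N = [Up N]" using assms by (auto simp: up_def)
  have sp: "sp l m \<in> homs [Up N] [Up l, Up m]" using sp_homs[of l m N] lm by (simp add: up(1,2) up(3)[unfolded N_def] N_def)
  have mg: "mg l m \<in> homs [Up l, Up m] [Up N]" using mg_homs[of l m N] lm by (simp add: up(1,2) up(3)[unfolded N_def] N_def)
  \<comment> \<open>The split after a half turn, drawn with its arcs bent to either side; the
    equality of the two drawings is the planar isotopy used here.\<close>
  define R where "R = rotr [Up N] [Up l, Up m] (sp l m)"
  have Rr: "R = pad [] (cap (Dn m)) [Dn N] * (pad [Dn m] (cap (Dn l)) [Up m, Dn N] * (pad [Dn m, Dn l] (sp l m) [Dn N] * pad [Dn m, Dn l] (cup (Up N)) []))"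
    by (simp add: R_def rotr_def pad_caps_two mult.assoc del: caps.simps cups.simps)
  have Rl: "R = pad [Dn N] (cap (Up l)) [] * (pad [Dn N, Up l] (cap (Up m)) [Dn l] * (pad [Dn N] (sp l m) [Dn m, Dn l] * pad [] (cup (Dn N)) [Dn m, Dn l]))"
    using rotl_eq_rotr[OF sp] by (simp add: R_def rotl_def pad_caps_two mult.assoc del: caps.simps cups.simps)
  have pRr: "pad [Up m] R [] = pad [Up m] (cap (Dn m)) [Dn N] * (pad [Up m, Dn m] (cap (Dn l)) [Up m, Dn N] *
      (pad [Up m, Dn m, Dn l] (sp l m) [Dn N] * pad [Up m, Dn m, Dn l] (cup (Up N)) []))"
    unfolding Rr
    by (subst pad_comp[OF pad_homs[OF cap_homs(3)] homs_comp[OF pad_homs[OF cap_homs(3)] homs_comp[OF pad_homs[OF sp] pad_homs[OF cup_homs(2)]]]], simp_all)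
       (subst pad_comp3[OF pad_homs[OF cap_homs(3)] pad_homs[OF sp] pad_homs[OF cup_homs(2)]], simp_all)
  have pRl: "pad [Up m] R [] = pad [Up m, Dn N] (cap (Up l)) [] * (pad [Up m, Dn N, Up l] (cap (Up m)) [Dn l] *
      (pad [Up m, Dn N] (sp l m) [Dn m, Dn l] * pad [Up m] (cup (Dn N)) [Dn m, Dn l]))"
    unfolding Rl
    by (subst pad_comp[OF pad_homs[OF cap_homs(2)] homs_comp[OF pad_homs[OF cap_homs(2)] homs_comp[OF pad_homs[OF sp] pad_homs[OF cup_homs(3)]]]], simp_all)
       (subst pad_comp3[OF pad_homs[OF cap_homs(2)] pad_homs[OF sp] pad_homs[OF cup_homs(3)]], simp_all)
  note 1 = pad_swap[OF cup_homs(2)[of m] cup_homs(2)[of N], of "[]" "[Dn l]" "[]", simplified, symmetric]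
  note 2 = pad_swap[OF cup_homs(2)[of m] sp, of "[]" "[Dn l]" "[Dn N]", simplified, symmetric]
  note 3 = pad_swap[OF cup_homs(2)[of m] cap_homs(3)[of l], of "[]" "[]" "[Up m, Dn N]", simplified, symmetric]
  note 4 = zigzag_right[of "[]" "Up m" "[Dn N]", simplified]
  have Q: "pad [] (cap (Dn l)) [Up m, Dn N] * (pad [Dn l] (sp l m) [Dn N] * pad [Dn l] (cup (Up N)) []) =
    pad [Up m] R [] * pad [] (cup (Up m)) [Dn l]"
    unfolding pRr by (simp add: mult.assoc 1 mult_extend[OF 2] mult_extend[OF 3] mult_extend1[OF 4])
  note a1 = pad_swap[OF cup_homs(3)[of l] cap_homs(2)[of l], of "[]" "[Up m, Dn N]" "[]", simplified]
  note a2 = pad_swap[OF mg cap_homs(2)[of l], of "[Dn l]" "[Dn N]" "[]", simplified]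
  note a3 = pad_swap[OF cap_homs(2)[of N] cap_homs(2)[of l], of "[Dn l]" "[]" "[]", simplified]
  note b1 = pad_swap[OF cup_homs(3)[of l] cap_homs(2)[of m], of "[]" "[Up m, Dn N, Up l]" "[Dn l]", simplified]
  note b2 = pad_swap[OF mg cap_homs(2)[of m], of "[Dn l]" "[Dn N, Up l]" "[Dn l]", simplified]
  note b3 = pad_swap[OF cap_homs(2)[of N] cap_homs(2)[of m], of "[Dn l]" "[Up l]" "[Dn l]", simplified]
  note c1 = pad_swap[OF cup_homs(3)[of l] sp, of "[]" "[Up m, Dn N]" "[Dn m, Dn l]", simplified]
  note c2 = pad_swap[OF mg sp, of "[Dn l]" "[Dn N]" "[Dn m, Dn l]", simplified]
  note c3 = pad_swap[OF cap_homs(2)[of N] sp, of "[Dn l]" "[]" "[Dn m, Dn l]", simplified]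
  note d1 = pad_swap[OF cup_homs(3)[of l] cup_homs(3)[of N], of "[]" "[Up m]" "[Dn m, Dn l]", simplified]
  note d2 = pad_swap[OF mg cup_homs(3)[of N], of "[Dn l]" "[]" "[Dn m, Dn l]", simplified]
  note d3 = zigzag_left[of "[Dn l]" "Up N" "[Dn m, Dn l]", simplified]
  note e = pad_swap[OF cup_homs(3)[of l] cup_homs(2)[of m], of "[]" "[]" "[Dn l]", simplified]
  have mgId: "Id [Dn l, Up N, Dn m, Dn l] * (pad [Dn l] (mg l m) [Dn m, Dn l] * r) = pad [Dn l] (mg l m) [Dn m, Dn l] * r" for r
    using Id_pad[OF mg, of "[Dn l, Up N, Dn m, Dn l]" "[Dn l]" "[Dn m, Dn l]"] by (simp flip: mult.assoc)
  have B: "pad [Dn l, Up l] (cap (Up m)) [Dn l] * (pad [Dn l] (sp l m) [Dn m, Dn l] * (pad [Dn l] (mg l m) [Dn m, Dn l] * pad [Dn l, Up l] (cup (Up m)) [Dn l])) =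
    Id [Dn l, Up l, Dn l]"
  proof -
    have "pad [Dn l] (pad [Up l] (cap (Up m)) [] * (pad [] (sp l m) [Dn m] * (pad [] (mg l m) [Dn m] * pad [Up l] (cup (Up m)) []))) [Dn l] =
      Id [Dn l, Up l, Dn l]"
      using bubble[of l m] l m lm qb_self[of m] by (simp add: up) (metis add_diff_cancel_left' Id_tens_Id append_Cons append_Nil pad_Id smult_1)
    then show ?thesis
      by (subst (asm) pad_comp[OF pad_homs[OF cap_homs(2)] homs_comp[OF pad_homs[OF sp] homs_comp[OF pad_homs[OF mg] pad_homs[OF cup_homs(2)]]]], simp_all)
         (subst (asm) pad_comp3[OF pad_homs[OF sp] pad_homs[OF mg] pad_homs[OF cup_homs(2)]], simp_all)
  qed
  note z = zigzag_right[of "[]" "Dn l" "[]", simplified]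
  have "pad [Dn l] (cap (Up N)) [] * (pad [Dn l] (mg l m) [Dn N] * (pad [] (cup (Dn l)) [Up m, Dn N] *
    (pad [Up m] R [] * pad [] (cup (Up m)) [Dn l]))) =
    pad [Dn l] (cap (Up l)) [] * (pad [Dn l, Up l] (cap (Up m)) [Dn l] * (pad [Dn l] (sp l m) [Dn m, Dn l] *
     (pad [Dn l] (mg l m) [Dn m, Dn l] * (pad [] (cup (Dn l)) [Up m, Dn m, Dn l] * pad [] (cup (Up m)) [Dn l]))))"
    unfolding pRl
    by (simp add: mult.assoc mult_extend[OF a1] mult_extend[OF a2] mult_extend[OF a3] mult_extend[OF b1] mult_extend[OF b2] mult_extend[OF b3]
        mult_extend[OF c1] mult_extend[OF c2] mult_extend[OF c3] mult_extend[OF d1] mult_extend[OF d2] mult_extend1[OF d3] mgId)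
  also have "\<dots> = pad [Dn l] (cap (Up l)) [] * ((pad [Dn l, Up l] (cap (Up m)) [Dn l] * (pad [Dn l] (sp l m) [Dn m, Dn l] *
     (pad [Dn l] (mg l m) [Dn m, Dn l] * pad [Dn l, Up l] (cup (Up m)) [Dn l]))) * pad [] (cup (Dn l)) [Dn l])"
    by (simp add: mult.assoc e)
  also have "\<dots> = Id [Dn l]" unfolding B by (simp add: z)
  finally show ?thesis unfolding Q .
qed

text \<open>For l = n this is the saddle itself. Otherwise the saddle is inserted beside
  \<open>rotated_bubble\<close>, which bends A and B back into the two maps.\<close>

lemma into_outof:
  assumes l: "Up l \<in> strands n"
  shows "into l * outof l = Id [Dn l, Up (int n)]"
proof (cases "l = int n")
  case True
  have n: "up (int n) = [Up (int n)]" "n \<ge> 1" using l True by (auto simp: up_strand Up_strands)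
  have "into l = cup (Dn (int n))" "outof l = cap (Dn (int n))"
    using Id_comp[OF cup_homs(3)] comp_Id[OF cap_homs(3)]
    by (simp_all add: into_def outof_def True n pad_Nil[OF cup_homs(3)] pad_Nil[OF cap_homs(3)])
  then show ?thesis by (simp add: True saddle_right[OF n(2)])
next
  case False
  define m where "m = int n - l"
  define N where "N = int n"
  have lm: "1 \<le> l" "1 \<le> m" "l + m = int n" "l + m = N" and n: "n \<ge> 1" using l False by (auto simp: Up_strands m_def N_def)
  have up: "up l = [Up l]" "up m = [Up m]" "up N = [Up N]" using lm n by (auto simp: up_def N_def)
  have sp: "sp l m \<in> homs [Up N] [Up l, Up m]" using sp_homs[of l m N] lm by (simp add: up)
  have mg: "mg l m \<in> homs [Up l, Up m] [Up N]" using mg_homs[of l m N] lm by (simp add: up)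
  have V: "into l = pad [Dn l] (mg l m) [] * pad [] (cup (Dn l)) [Up m]"
    and W: "outof l = pad [] (cap (Dn l)) [Up m] * pad [Dn l] (sp l m) []"
    by (simp_all add: into_def outof_def m_def[symmetric] up)
  have h: "into l \<in> homs [Up m] [Dn l, Up N]" "outof l \<in> homs [Dn l, Up N] [Up m]"
    using into_homs[OF l, folded m_def N_def] outof_homs[OF l, folded m_def N_def] by (simp_all add: up)
  have pV: "pad [] (into l) us = pad [Dn l] (mg l m) us * pad [] (cup (Dn l)) (Up m # us)" for us
    unfolding V by (subst pad_comp[OF pad_homs[OF mg] pad_homs[OF cup_homs(3)]]) simp_all
  have pW: "pad [] (outof l) us = pad [] (cap (Dn l)) (Up m # us) * pad [Dn l] (sp l m) us" for us
    unfolding W by (subst pad_comp[OF pad_homs[OF cap_homs(3)] pad_homs[OF sp]]) simp_all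
  define A where "A = pad [Dn l] (cap (Up N)) [] * pad [] (into l) [Dn N]"
  define B where "B = pad [] (outof l) [Dn N] * pad [Dn l] (cup (Up N)) []"
  have AB: "A * B = Id [Dn l]"
    using rotated_bubble[OF lm(1,2,3)] by (simp add: A_def B_def pV pW mult.assoc N_def)
  have A: "A \<in> homs [Up m, Dn N] [Dn l]" and B: "B \<in> homs [Dn l] [Up m, Dn N]"
    unfolding A_def B_def by (rule homs_comp[OF pad_homs[OF cap_homs(2)] pad_homs[OF h(1)]] homs_comp[OF pad_homs[OF h(2)] pad_homs[OF cup_homs(2)]]; simp)+
  have pA: "pad [] A [Up N] = pad [Dn l] (cap (Up N)) [Up N] * pad [] (into l) [Dn N, Up N]"
    and pB: "pad [] B [Up N] = pad [] (outof l) [Dn N, Up N] * pad [Dn l] (cup (Up N)) [Up N]"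
    unfolding A_def B_def
    by (subst pad_comp[OF pad_homs[OF cap_homs(2)] pad_homs[OF h(1)]] pad_comp[OF pad_homs[OF h(2)] pad_homs[OF cup_homs(2)]]; simp)+
  note 1 = pad_swap[OF h(1) cup_homs(3)[of N], of "[]" "[]" "[]", simplified]
  note 2 = zigzag_left[of "[Dn l]" "Up N" "[]", simplified]
  note 3 = pad_swap[OF h(2) cap_homs(3)[of N], of "[]" "[]" "[]", simplified, symmetric]
  note 4 = zigzag_right[of "[Dn l]" "Up N" "[]", simplified]
  \<comment> \<open>The identity on the two strands labelled n is isolated so that the saddle can
    replace it by a cap below a cup.\<close>
  have "Id [Dn l, Up N] = pad [] A [Up N] * (pad [Up m] (Id [Dn N, Up N]) [] * pad [] B [Up N])"
  proof -
    have "Id [Dn l, Up N] = pad [] (A * B) [Up N]" by (simp add: AB)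
    also have "\<dots> = pad [] A [Up N] * pad [] B [Up N]" by (rule pad_comp[OF A B])
    also have "pad [] B [Up N] = pad [Up m] (Id [Dn N, Up N]) [] * pad [] B [Up N]"
      using Id_pad[OF B, of "[Up m, Dn N, Up N]" "[]" "[Up N]"] by simp
    finally show ?thesis .
  qed
  also have "pad [Up m] (Id [Dn N, Up N]) [] = pad [Up m] (cup (Dn N)) [] * pad [Up m] (cap (Dn N)) []"
    using saddle_right[OF n] by (simp only: N_def) (rule pad_comp[OF cup_homs(3) cap_homs(3)])
  also have "pad [] A [Up N] * (pad [Up m] (cup (Dn N)) [] * pad [Up m] (cap (Dn N)) [] * pad [] B [Up N]) = into l * outof l"
    unfolding pA pB
    by (simp add: mult.assoc mult_extend[OF 1] mult_extend[OF 3] mult_extend1[OF 2] 4 pad_Nil[OF h(1)] pad_Nil[OF h(2)] comp_Id[OF h(2)])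
       (simp add: Id_comp[OF h(1)] flip: mult.assoc)
  finally show ?thesis by (simp add: N_def)
qed


definition inverses :: "bool \<Rightarrow> strand \<Rightarrow> strand \<Rightarrow> bool" where
  "inverses s x y \<longleftrightarrow> cr (\<not> s) y x * cr s x y = Id [x, y] \<and> cr s x y * cr (\<not> s) y x = Id [y, x]"

lemma YY_XX:
  assumes x: "x \<in> strands n" and ys: "set ys \<subseteq> strands n" and inv: "\<And>y. y \<in> set ys \<Longrightarrow> inverses s x y"
  shows "YY s x ys * XX s x ys = Id (x # ys)" and "XX s x ys * YY s x ys = Id (ys @ [x])"
proof -
  have "YY s x ys * XX s x ys = Id (x # ys) \<and> XX s x ys * YY s x ys = Id (ys @ [x])"
    using ys inv
  proof (induction ys)
    case (Cons y ys)
    then have y: "y \<in> strands n" "set ys \<subseteq> strands n" by auto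
    have IH: "YY s x ys * XX s x ys = Id (x # ys)" "XX s x ys * YY s x ys = Id (ys @ [x])" using Cons by auto
    have inv: "cr (\<not> s) y x * cr s x y = Id [x, y]" "cr s x y * cr (\<not> s) y x = Id [y, x]"
      using Cons.prems(2)[of y] by (auto simp: inverses_def)
    have 1: "pad [y] (YY s x ys) [] * pad [y] (XX s x ys) [] = Id (y # x # ys)"
      using IH(1) by (simp flip: pad_comp[OF YY_homs[OF x y(2)] XX_homs[OF x y(2)]])
    have 2: "pad [y] (XX s x ys) [] * pad [y] (YY s x ys) [] = Id (y # ys @ [x])"
      using IH(2) by (simp flip: pad_comp[OF XX_homs[OF x y(2)] YY_homs[OF x y(2)]])
    have 3: "pad [] (cr (\<not> s) y x) ys * pad [] (cr s x y) ys = Id (x # y # ys)"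
      using inv(1) by (simp flip: pad_comp[OF cr_homs[OF y(1) x] cr_homs[OF x y(1)]])
    have 4: "pad [] (cr s x y) ys * pad [] (cr (\<not> s) y x) ys = Id (y # x # ys)"
      using inv(2) by (simp flip: pad_comp[OF cr_homs[OF x y(1)] cr_homs[OF y(1) x]])
    have 5: "Id (y # x # ys) * pad [y] (YY s x ys) [] = pad [y] (YY s x ys) []"
      by (rule Id_pad[OF YY_homs[OF x y(2)]]) simp
    show ?case
      using x y by (simp add: XX.simps YY.simps mult.assoc mult_extend1[OF 1] mult_extend1[OF 4] 3 2 5)
  qed simp
  then show "YY s x ys * XX s x ys = Id (x # ys)" "XX s x ys * YY s x ys = Id (ys @ [x])" by auto
qed

text \<open>Conjugation by the invertible passages turns one direction into the other.\<close>

lemma natl_iff_natr: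
  assumes x: "x \<in> strands n" and f: "f \<in> homs ys zs"
    and sub: "set ys \<subseteq> strands n" "set zs \<subseteq> strands n"
    and inv: "\<And>y. y \<in> set ys \<union> set zs \<Longrightarrow> inverses s x y"
  shows "natl s x ys zs f \<longleftrightarrow> natr s x ys zs f"
proof -
  note y = YY_XX[OF x sub(1), of s] and z = YY_XX[OF x sub(2), of s]
  have y: "YY s x ys * XX s x ys = Id (x # ys)" "XX s x ys * YY s x ys = Id (ys @ [x])"
    and z: "YY s x zs * XX s x zs = Id (x # zs)" "XX s x zs * YY s x zs = Id (zs @ [x])"
    using y z inv by auto
  have i: "pad [x] f [] * Id (x # ys) = pad [x] f []" "Id (x # zs) * pad [x] f [] = pad [x] f []"
     "pad [] f [x] * Id (ys @ [x]) = pad [] f [x]" "Id (zs @ [x]) * pad [] f [x] = pad [] f [x]"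
    by (rule Id_pad[OF f] pad_Id_right[OF f]; simp)+
  show ?thesis
  proof
    assume nat: "natl s x ys zs f"
    have "YY s x zs * pad [] f [x] = YY s x zs * (pad [] f [x] * XX s x ys) * YY s x ys"
      by (simp add: mult.assoc y i)
    also have "\<dots> = (YY s x zs * XX s x zs) * pad [x] f [] * YY s x ys"
      using nat by (simp add: natl_def mult.assoc)
    finally show "natr s x ys zs f" by (simp add: z i natr_def)
  next
    assume nat: "natr s x ys zs f"
    have "XX s x zs * pad [x] f [] = XX s x zs * (pad [x] f [] * YY s x ys) * XX s x ys"
      by (simp add: mult.assoc y i)
    also have "\<dots> = (XX s x zs * YY s x zs) * pad [] f [x] * XX s x ys"
      using nat by (simp add: natr_def mult.assoc)
    finally show "natl s x ys zs f" by (simp add: z i natl_def)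
  qed
qed

lemma natl_Id: "x \<in> strands n \<Longrightarrow> set us \<subseteq> strands n \<Longrightarrow> natl s x us us (Id us)"
  and natr_Id: "x \<in> strands n \<Longrightarrow> set us \<subseteq> strands n \<Longrightarrow> natr s x us us (Id us)"
  using Id_comp[OF XX_homs] comp_Id[OF XX_homs] Id_comp[OF YY_homs] comp_Id[OF YY_homs]
  by (simp_all add: natl_def natr_def)

text \<open>The isomorphism between the pair of a downward l and an upward n and the single strand n
  - l consists of pieces whose compatibility with k is already known. It conjugates passing the pair
  into passing n - l, which is invertible; the crossing with n is then split off and the strand n
  cancelled.\<close>

lemma inverses_Up_Dn:
  assumes k: "Up k \<in> strands n" and l: "Up l \<in> strands n"
  shows "inverses s (Up k) (Dn l)"
proof -
  define m where "m = int n - l"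
  define N where "N = int n"
  have n: "n \<ge> 1" and N: "Up N \<in> strands n" "up N = [Up N]" and l': "Dn l \<in> strands n" "up l = [Up l]" and lm: "l + m = N"
    using k l by (auto simp: Up_strands Dn_strands up_def N_def m_def)
  have m: "set (up m) \<subseteq> strands n" using l by (auto simp: m_def Up_strands up_def)
  have mg: "mg l m \<in> homs ([Up l] @ up m) [Up N]" and sp: "sp l m \<in> homs [Up N] ([Up l] @ up m)"
    using mg_homs[OF lm] sp_homs[OF lm] by (simp_all add: N l')
  have nat: "natl s (Up k) ([Up l] @ up m) [Up N] (mg l m)" "natr s (Up k) [Up N] ([Up l] @ up m) (sp l m)"
  proof -
    have "natl s (Up k) ([Up l] @ up m) [Up N] (mg l m) \<and> natr s (Up k) [Up N] ([Up l] @ up m) (sp l m)"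
    proof (cases "m = 0")
      case True
      then show ?thesis using natl_Id[OF k, of "[Up l]"] natr_Id[OF k, of "[Up l]"] l lm N l' by simp
    next
      case False
      then have "1 \<le> m" using l by (simp add: m_def Up_strands)
      then show ?thesis using natl_Merge[OF k, of l m s] natr_Split[OF k, of l m s] l lm
        by (simp add: mg_def merge0_def sp_def split0_def Up_strands up_def N_def)
    qed
    then show "natl s (Up k) ([Up l] @ up m) [Up N] (mg l m)" "natr s (Up k) [Up N] ([Up l] @ up m) (sp l m)"
      by auto
  qed
  define V where "V = into l"
  define W where "W = outof l"
  have V: "V = pad [Dn l] (mg l m) [] * pad [] (cup (Dn l)) (up m)" and W: "W = pad [] (cap (Dn l)) (up m) * pad [Dn l] (sp l m) []"
    by (simp_all add: V_def W_def into_def outof_def m_def)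
  have hV: "V \<in> homs (up m) [Dn l, Up N]" and hW: "W \<in> homs [Dn l, Up N] (up m)"
    using into_homs[OF l] outof_homs[OF l] by (simp_all add: V_def W_def m_def N_def)
  have VW: "V * W = Id [Dn l, Up N]" "W * V = Id (up m)"
    using into_outof[OF l] outof_into[OF l] by (simp_all add: V_def W_def m_def N_def)
  have nV: "natl s (Up k) (up m) [Dn l, Up N] V"
    unfolding V
  proof (rule natl_comp[where ys = "[Dn l, Up l] @ up m"])
    show "natl s (Up k) ([Dn l, Up l] @ up m) [Dn l, Up N] (pad [Dn l] (mg l m) [])"
      using natl_pad[OF nat(1) mg k, of "[Dn l]" "[]"] l l' m N by simp
    show "natl s (Up k) (up m) ([Dn l, Up l] @ up m) (pad [] (cup (Dn l)) (up m))"
      using natl_pad[OF natl_cup_Dn[OF k l, of s] cup_homs(3) k, of "[]" "up m"] l l' m by simp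
  qed (auto intro: pad_homs[OF mg] pad_homs[OF cup_homs(3)])
  have nW: "natr s (Up k) [Dn l, Up N] (up m) W"
    unfolding W
  proof (rule natr_comp[where ys = "[Dn l, Up l] @ up m"])
    show "natr s (Up k) [Dn l, Up N] ([Dn l, Up l] @ up m) (pad [Dn l] (sp l m) [])"
      using natr_pad[OF nat(2) sp k, of "[Dn l]" "[]"] l l' m N by simp
    show "natr s (Up k) ([Dn l, Up l] @ up m) (up m) (pad [] (cap (Dn l)) (up m))"
      using natr_pad[OF natr_cap_Dn[OF k l, of s] cap_homs(3) k, of "[]" "up m"] l l' m by simp
  qed (auto intro: pad_homs[OF sp] pad_homs[OF cap_homs(3)])
  have inv_m: "YY s (Up k) (up m) * XX s (Up k) (up m) = Id (Up k # up m)" "XX s (Up k) (up m) * YY s (Up k) (up m) = Id (up m @ [Up k])"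
  proof -
    have "inverses s (Up k) y" if "y \<in> set (up m)" for y
      using that m cr_Up_inverse[OF k, of m s] cr_Up_inverse[OF _ k, of m "\<not> s"] by (auto simp: inverses_def up_def split: if_splits)
    then show "YY s (Up k) (up m) * XX s (Up k) (up m) = Id (Up k # up m)" "XX s (Up k) (up m) * YY s (Up k) (up m) = Id (up m @ [Up k])"
      using YY_XX[OF k m] by auto
  qed
  let ?X = "XX s (Up k) [Dn l, Up N]" and ?Y = "YY s (Up k) [Dn l, Up N]"
  have hX: "?X \<in> homs [Up k, Dn l, Up N] [Dn l, Up N, Up k]" and hY: "?Y \<in> homs [Dn l, Up N, Up k] [Up k, Dn l, Up N]"
    using XX_homs[OF k, of "[Dn l, Up N]" s] YY_homs[OF k, of "[Dn l, Up N]" s] l' N by auto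
  have p: "pad [Up k] V [] * pad [Up k] W [] = Id [Up k, Dn l, Up N]" "pad [] V [Up k] * pad [] W [Up k] = Id [Dn l, Up N, Up k]"
     "pad [Up k] W [] * pad [Up k] V [] = Id (Up k # up m)" "pad [] W [Up k] * pad [] V [Up k] = Id (up m @ [Up k])"
    using VW by (simp_all flip: pad_comp[OF hV hW] pad_comp[OF hW hV])
  \<comment> \<open>Only compatibility of V from the left and of W from the right is at hand. These
    suffice, since one enters into \<open>?X\<close> and the other into \<open>?Y\<close>.\<close>
  have X: "?X = pad [] V [Up k] * (XX s (Up k) (up m) * pad [Up k] W [])"
  proof -
    have "?X = ?X * (pad [Up k] V [] * pad [Up k] W [])" unfolding p(1) using hX by simp
    also have "\<dots> = pad [] V [Up k] * (XX s (Up k) (up m) * pad [Up k] W [])"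
      using nV unfolding natl_def by (simp flip: mult.assoc)
    finally show ?thesis .
  qed
  have Y: "?Y = pad [Up k] V [] * (YY s (Up k) (up m) * pad [] W [Up k])"
  proof -
    have "?Y = (pad [Up k] V [] * pad [Up k] W []) * ?Y" unfolding p(1) using hY by simp
    also have "\<dots> = pad [Up k] V [] * (YY s (Up k) (up m) * pad [] W [Up k])"
      using nW unfolding natr_def by (simp add: mult.assoc)
    finally show ?thesis .
  qed
  have i: "Id (Up k # up m) * pad [Up k] W [] = pad [Up k] W []" "Id (up m @ [Up k]) * pad [] W [Up k] = pad [] W [Up k]"
    "XX s (Up k) (up m) * Id (Up k # up m) = XX s (Up k) (up m)" "YY s (Up k) (up m) * Id (up m @ [Up k]) = YY s (Up k) (up m)"
    using comp_Id[OF XX_homs[OF k m]] comp_Id[OF YY_homs[OF k m]] by (auto intro!: Id_pad[OF hW])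
  have YX: "?Y * ?X = Id [Up k, Dn l, Up N]"
    unfolding X Y by (simp add: mult.assoc mult_extend1[OF p(4)] mult_extend1[OF i(4)] mult_extend1[OF inv_m(1)] i p)
  have XY: "?X * ?Y = Id [Dn l, Up N, Up k]"
    unfolding X Y by (simp add: mult.assoc mult_extend1[OF p(3)] mult_extend1[OF i(3)] mult_extend1[OF inv_m(2)] i p)
  let ?a = "cr s (Up k) (Dn l)" and ?b = "cr (\<not> s) (Dn l) (Up k)"
  note a = cr_homs[OF k l'(1), of s] and b = cr_homs[OF l'(1) k, of "\<not> s"]
  note r = pad_cr_inverse[OF k N(1) cr_Up_inverse[OF k N(1), of s], of "[Dn l]" "[]", simplified]
  \<comment> \<open>The two crossings of k with the strand n are parallel and cancel each other in
    the middle.\<close>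
  have "pad [] (?b * ?a) [Up N] = Id [Up k, Dn l, Up N]"
    using YX k l' N(1) by (simp add: XX_two mult.assoc mult_extend1[OF r] flip: pad_comp[OF b a])
  then have 1: "?b * ?a = Id [Up k, Dn l]"
    using cancel_n[OF n homs_comp[OF b a]] by (simp add: N_def)
  have "pad [Dn l] (cr s (Up k) (Up N)) [] * (pad [] (?a * ?b) [Up N] * pad [Dn l] (cr (\<not> s) (Up N) (Up k)) []) = Id [Dn l, Up N, Up k]"
    using XY k l' N(1) by (simp add: XX_two mult.assoc pad_comp[OF a b])
  then have "pad [Dn l] (cr (\<not> s) (Up N) (Up k)) [] * (pad [Dn l] (cr s (Up k) (Up N)) [] * (pad [] (?a * ?b) [Up N] * pad [Dn l] (cr (\<not> s) (Up N) (Up k)) [])) * pad [Dn l] (cr s (Up k) (Up N)) []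
    = pad [Dn l] (cr (\<not> s) (Up N) (Up k)) [] * Id [Dn l, Up N, Up k] * pad [Dn l] (cr s (Up k) (Up N)) []"
    by simp
  then have "pad [] (?a * ?b) [Up N] = Id [Dn l, Up k, Up N]"
    using k N(1) pad_Id_right[OF homs_comp[OF a b], of "[Dn l, Up k, Up N]" "[]" "[Up N]"] Id_pad[OF homs_comp[OF a b], of "[Dn l, Up k, Up N]" "[]" "[Up N]"]
    by (simp add: mult.assoc mult_extend1[OF r] r)
  then have 2: "?a * ?b = Id [Dn l, Up k]"
    using cancel_n[OF n homs_comp[OF a b]] by (simp add: N_def)
  show ?thesis using 1 2 by (simp add: inverses_def)
qed

lemma inverses_Up: "Up k \<in> strands n \<Longrightarrow> y \<in> strands n \<Longrightarrow> inverses s (Up k) y"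
  using inverses_Up_Dn cr_Up_inverse[of k _ s] cr_Up_inverse[of _ k "\<not> s"]
  by (cases y) (auto simp: inverses_def Dn_strands)


section \<open>Moving a strand across a web\<close>

text \<open>Splits, upward cups and downward caps were obtained only in the direction
  \<open>natr\<close>; the inverse crossings convert them.\<close>

lemma natl_Up_web: "Up w \<in> strands n \<Longrightarrow> web n D \<Longrightarrow> natl s (Up w) (src D) (tgt D) (wb D)"
proof (induction D)
  case (Ident us)
  then show ?case by (auto intro!: natl_Id simp: web_def)
next
  case (Cup x)
  then have x: "x \<in> strands n" by (simp add: web_def)
  show ?case
  proof (cases x)
    case (Up l)
    have "natl s (Up w) [] [Up l, Dn l] (cup (Up l)) \<longleftrightarrow> natr s (Up w) [] [Up l, Dn l] (cup (Up l))"
      by (rule natl_iff_natr[OF Cup(1) cup_homs(2)]) (use x Up Cup(1) in \<open>auto simp: Dn_strands intro!: inverses_Up\<close>)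
    then show ?thesis
      using natr_cup_Up[of w l s] x Cup(1) Up by simp
  next
    case (Dn l)
    then show ?thesis using natl_cup_Dn[of w l s] x Cup(1) by (simp add: Dn_strands)
  qed
next
  case (Cap x)
  then have x: "x \<in> strands n" by (simp add: web_def)
  show ?case
  proof (cases x)
    case (Up l)
    then show ?thesis using natl_cap_Up[of w l s] x Cap(1) by (simp add: Dn_strands)
  next
    case (Dn l)
    have "natl s (Up w) [Dn l, Up l] [] (cap (Dn l)) \<longleftrightarrow> natr s (Up w) [Dn l, Up l] [] (cap (Dn l))"
      by (rule natl_iff_natr[OF Cap(1) cap_homs(3)]) (use x Dn Cap(1) in \<open>auto simp: Dn_strands intro!: inverses_Up\<close>)
    then show ?thesis
      using natr_cap_Dn[of w l s] x Cap(1) Dn by (simp add: Dn_strands)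
  qed
next
  case (Merge k l)
  then show ?case using natl_Merge[of w k l s] by (simp add: web_def)
next
  case (Split k l)
  then have kl: "1 \<le> k" "1 \<le> l" "k + l \<le> int n" by (auto simp: web_def)
  then have "natl s (Up w) [Up (k + l)] [Up k, Up l] (wb (Split k l)) \<longleftrightarrow> natr s (Up w) [Up (k + l)] [Up k, Up l] (wb (Split k l))"
    by (intro natl_iff_natr Split(1) Split_homs) (auto simp: Up_strands intro!: inverses_Up Split(1))
  then show ?case
    using natr_Split[OF Split(1) kl, of s] by simp
next
  case (Comp D E)
  then have "web n D" "web n E" "src D = tgt E" by (auto simp: web_Comp)
  then show ?case
    unfolding wb_Comp using Comp homs_wb[of D "src D" "tgt D"] homs_wb[of E "src E" "tgt E"] by (auto intro!: natl_comp)
next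
  case (Tens D E)
  then have DE: "web n D" "web n E" by (auto simp: web_Tens)
  have sub: "set (src D) \<subseteq> strands n" "set (tgt D) \<subseteq> strands n" "set (src E) \<subseteq> strands n" "set (tgt E) \<subseteq> strands n"
    using DE admissible_boundary by (auto simp: web_def)
  have h: "wb D \<in> homs (src D) (tgt D)" "wb E \<in> homs (src E) (tgt E)" by (auto intro: homs_wb)
  have "natl s (Up w) (src D @ tgt E) (tgt D @ tgt E) (pad [] (wb D) (tgt E))"
    using natl_pad[OF Tens.IH(1)[OF Tens(3) DE(1)] h(1) Tens(3), of "[]" "tgt E"] sub by simp
  moreover have "natl s (Up w) (src D @ src E) (src D @ tgt E) (pad (src D) (wb E) [])"
    using natl_pad[OF Tens.IH(2)[OF Tens(3) DE(2)] h(2) Tens(3), of "src D" "[]"] sub by simp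
  ultimately show ?case
    unfolding wb_Tens tens_eq_pad(1)[OF h] by (auto intro!: natl_comp pad_homs[OF h(1)] pad_homs[OF h(2)])
qed (auto simp: web_def)

lemma natl_Up:
  assumes "Up w \<in> strands n" and f: "f \<in> homs ys zs"
  shows "natl s (Up w) ys zs f"
  using f
proof (induction f rule: homs_induct)
  case (add g c D)
  then show ?case using natl_Up_web[OF assms(1), of D s] by (simp add: natl_def pad_add distrib_left distrib_right)
qed (simp add: natl_def)

lemma natr_Up:
  assumes w: "Up w \<in> strands n" and f: "f \<in> homs ys zs"
  shows "natr s (Up w) ys zs f"
  using f
proof (induction f rule: homs_induct)
  case (add g c D)
  have sub: "set (src D) \<subseteq> strands n" "set (tgt D) \<subseteq> strands n"
    using add admissible_boundary by (auto simp: web_def)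
  have "natr s (Up w) (src D) (tgt D) (wb D)"
    using natl_Up_web[OF w, of D s] add natl_iff_natr[OF w homs_wb[of D "src D" "tgt D"], of s] sub inverses_Up[OF w] by auto
  with add show ?case by (simp add: natr_def pad_add distrib_left distrib_right)
qed (simp add: natr_def)

text \<open>Crossings with a downward strand \<open>w\<close> are rotations of crossings with an upward one.\<close>

definition turned :: "bool \<Rightarrow> int \<Rightarrow> strand list \<Rightarrow> webmod" where
  "turned s w ys = pad [] (cap (Dn w)) (ys @ [Dn w]) *
     (pad [Dn w] (YY s (Up w) ys) [Dn w] * pad (Dn w # ys) (cup (Up w)) [])"

lemma turned_Nil: "turned s w [] = Id [Dn w]"
  using zigzag_left[of "[]" "Dn w" "[]"] by (simp add: turned_def)

lemma turned_single:
  assumes w: "Up w \<in> strands n" and y: "y \<in> strands n"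
  shows "turned s w [y] = cr s (Dn w) y"
proof (cases y)
  case (Up l)
  then show ?thesis using w y by (simp add: turned_def YY_single cr_Dn_Up)
next
  case (Dn l)
  have l: "Up l \<in> strands n" using y Dn by (simp add: Dn_strands)
  have "cr s (Dn w) (Dn l) = rotr [Up w, Up l] [Up l, Up w] (cr s (Up w) (Up l))"
    using ev_rot[of "Cross s w l"] w l rotl_eq_rotr[OF cr_homs[OF w l, of s]] by (simp add: cr_def)
  also have "\<dots> = turned s w [y]"
    using w l y Dn
    by (simp add: rotr_def turned_def YY_single pad_caps_two pad_cups_two pad_cr_Dn_Up mult.assoc del: caps.simps cups.simps)
  finally show ?thesis by (simp add: Dn)
qed

text \<open>Between the passages across y and across \<open>ys\<close> the strand w makes a zigzag,
  which is straightened.\<close>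

lemma turned_Cons:
  assumes w: "Up w \<in> strands n" and y: "y \<in> strands n" and ys: "set ys \<subseteq> strands n"
  shows "turned s w (y # ys) = pad [y] (turned s w ys) [] * pad [] (turned s w [y]) ys"
proof -
  note Y = YY_homs[OF w ys, of s] and c = cr_homs[OF y w, of "\<not> s"]
  have A: "pad [y] (turned s w ys) [] = pad [y] (cap (Dn w)) (ys @ [Dn w]) *
     (pad [y, Dn w] (YY s (Up w) ys) [Dn w] * pad (y # Dn w # ys) (cup (Up w)) [])"
    unfolding turned_def by (subst pad_comp3[OF pad_homs[OF cap_homs(3)] pad_homs[OF Y] pad_homs[OF cup_homs(2)]]) simp_all
  have B: "pad [] (turned s w [y]) ys = pad [] (cap (Dn w)) (y # Dn w # ys) *
     (pad [Dn w] (cr (\<not> s) y (Up w)) (Dn w # ys) * pad [Dn w, y] (cup (Up w)) ys)"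
    unfolding turned_def YY_single[OF w y]
    by (subst pad_comp3[OF pad_homs[OF cap_homs(3)] pad_homs[OF c] pad_homs[OF cup_homs(2)]]) simp_all
  have C: "pad [Dn w] (YY s (Up w) (y # ys)) [Dn w] = pad [Dn w] (cr (\<not> s) y (Up w)) (ys @ [Dn w]) * pad [Dn w, y] (YY s (Up w) ys) [Dn w]"
    unfolding YY.simps by (subst pad_comp[OF pad_homs[OF c] pad_homs[OF Y]]) simp_all
  note a1 = pad_swap[OF cap_homs(3)[of w] cup_homs(2)[of w], of "[]" "y # Dn w # ys" "[]", simplified, symmetric]
  note a2 = pad_swap[OF cap_homs(3)[of w] Y, of "[]" "[y, Dn w]" "[Dn w]", simplified, symmetric]
  note a3 = pad_swap[OF cap_homs(3)[of w] cap_homs(3)[of w], of "[]" "[y]" "ys @ [Dn w]", simplified, symmetric]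
  note b1 = pad_swap[OF c cup_homs(2)[of w], of "[Dn w]" "Dn w # ys" "[]", simplified, symmetric]
  note b2 = pad_swap[OF c Y, of "[Dn w]" "[Dn w]" "[Dn w]", simplified, symmetric]
  note b3 = pad_swap[OF c cap_homs(3)[of w], of "[Dn w]" "[]" "ys @ [Dn w]", simplified, symmetric]
  note c1 = pad_swap[OF cup_homs(2)[of w] cup_homs(2)[of w], of "[Dn w, y]" "ys" "[]", simplified, symmetric]
  note c2 = pad_swap[OF cup_homs(2)[of w] Y, of "[Dn w, y]" "[]" "[Dn w]", simplified, symmetric]
  note z = zigzag_right[of "[Dn w, y]" "Up w" "ys @ [Dn w]", simplified]
  have i: "Id (Dn w # y # Up w # ys @ [Dn w]) * (pad [Dn w, y] (YY s (Up w) ys) [Dn w] * r) = pad [Dn w, y] (YY s (Up w) ys) [Dn w] * r" for r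
    using Id_pad[OF Y, of "Dn w # y # Up w # ys @ [Dn w]" "[Dn w, y]" "[Dn w]"] by (simp flip: mult.assoc)
  show ?thesis
    unfolding A B unfolding turned_def[of s w "y # ys"] C
    using c2 z
    by (simp add: mult.assoc mult_extend[OF a1] mult_extend[OF a2] mult_extend[OF a3] mult_extend[OF b1] mult_extend[OF b2] mult_extend[OF b3]
        c1 mult_extend[OF c2] mult_extend1[OF z] i)
qed

lemma turned_XX:
  assumes w: "Up w \<in> strands n" and ys: "set ys \<subseteq> strands n"
  shows "turned s w ys = XX s (Dn w) ys"
  using ys
proof (induction ys)
  case (Cons y ys)
  then show ?case using turned_Cons[OF w, of y ys s] turned_single[OF w, of y s] by (simp add: XX.simps)
qed (simp add: turned_Nil)

text \<open>Bending w at both ends turns a passage of \<open>Up w\<close> from the right into one of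
  \<open>Dn w\<close> from the left.\<close>

lemma natl_Dn:
  assumes w: "Up w \<in> strands n" and f: "f \<in> homs ys zs" and sub: "set ys \<subseteq> strands n" "set zs \<subseteq> strands n"
  shows "natl s (Dn w) ys zs f"
proof -
  have nat: "YY s (Up w) zs * pad [] f [Up w] = pad [Up w] f [] * YY s (Up w) ys"
    using natr_Up[OF w f, of s] by (simp add: natr_def)
  have 2: "pad [Dn w] (YY s (Up w) zs) [Dn w] * pad [Dn w] f [Up w, Dn w] = pad [Dn w, Up w] f [Dn w] * pad [Dn w] (YY s (Up w) ys) [Dn w]"
    using arg_cong[OF nat, of "\<lambda>f. pad [Dn w] f [Dn w]"]
    by (subst (asm) pad_comp[OF YY_homs[OF w sub(2)] pad_homs[OF f]], simp, simp)
       (subst (asm) pad_comp[OF pad_homs[OF f] YY_homs[OF w sub(1)]], simp_all)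
  note 1 = pad_swap[OF f cup_homs(2)[of w], of "[Dn w]" "[]" "[]", simplified, symmetric]
  note 3 = pad_swap[OF cap_homs(3)[of w] f, of "[]" "[]" "[Dn w]", simplified]
  show ?thesis
    unfolding natl_def turned_XX[OF w sub(1), symmetric] turned_XX[OF w sub(2), symmetric] turned_def
    by (simp add: mult.assoc 1 mult_extend[OF 2] mult_extend[OF 3])
qed

lemma natl_strand:
  assumes "x \<in> strands n" "f \<in> homs ys zs" "set ys \<subseteq> strands n" "set zs \<subseteq> strands n"
  shows "natl s x ys zs f"
  using assms by (cases x) (auto intro: natl_Up natl_Dn simp: Dn_strands)


lemma cups_append: "wb (cups (xs @ [z])) = pad xs (cup z) (dual xs) * wb (cups xs)"
proof (induction xs)
  case Nil
  then show ?case using pad_Nil[OF cup_homs(1)[of z]] comp_Id[OF cup_homs(1)[of z]] cups_single[of z]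
    by (simp del: cups_single)
next
  case (Cons x xs)
  have "pad [x] (wb (cups (xs @ [z]))) [opp x] = pad (x # xs) (cup z) (dual (x # xs)) * pad [x] (wb (cups xs)) [opp x]"
    unfolding Cons by (subst pad_comp[OF pad_homs[OF cup_homs(1)] cups_homs]) simp_all
  then show ?case by (simp add: cups_Cons mult.assoc del: cups.simps)
qed

lemma zigzag_list: "pad us (wb (caps ys)) (ys @ vs) * pad (us @ ys) (wb (cups (dual ys))) vs = Id (us @ ys @ vs)"
proof (induction ys arbitrary: us)
  case (Cons y ys)
  have 1: "pad us (wb (caps (y # ys))) (y # ys @ vs) = pad us (cap y) (y # ys @ vs) * pad (us @ [y]) (wb (caps ys)) (opp y # y # ys @ vs)"
    unfolding caps_Cons by (subst pad_comp[OF cap_homs(1) pad_homs[OF caps_homs]]) simp_all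
  have 2: "pad (us @ y # ys) (wb (cups (dual (y # ys)))) vs = pad (us @ y # ys @ dual ys) (cup (opp y)) (ys @ vs) * pad (us @ y # ys) (wb (cups (dual ys))) vs"
    using pad_comp[OF pad_homs[OF cup_homs(1)[of "opp y"], of _ "dual ys" ys] cups_homs[of "dual ys"], of _ "us @ y # ys" vs]
    by (simp add: cups_append del: cups.simps)
  note 3 = pad_swap[OF caps_homs[of ys] cup_homs(1)[of "opp y"], of "us @ [y]" "[]" "ys @ vs", simplified]
  note 4 = zigzag_left[of us y "ys @ vs"]
  have 5: "Id (us @ y # ys @ vs) * (pad (us @ [y]) (wb (caps ys)) (ys @ vs) * r) = pad (us @ [y]) (wb (caps ys)) (ys @ vs) * r" for r
    using Id_pad[OF caps_homs[of ys], of "us @ y # ys @ vs" "us @ [y]" "ys @ vs"] by (simp flip: mult.assoc)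
  have 6: "pad (us @ [y]) (wb (caps ys)) (ys @ vs) * pad (us @ y # ys) (wb (cups (dual ys))) vs = Id (us @ y # ys @ vs)"
    using Cons.IH[of "us @ [y]"] by simp
  show ?case
    using 1 2 by (simp add: mult.assoc mult_extend[OF 3] mult_extend1[OF 4] 4 5 6 del: dual_Cons cups.simps caps.simps)
qed simp

lemma zigzag_list': "pad (us @ ys) (wb (caps (dual ys))) vs * pad us (wb (cups ys)) (ys @ vs) = Id (us @ ys @ vs)"
  using arg_cong[OF zigzag_list[of us ys vs], of flp] by (simp add: flp_mult flp_pad)

text \<open>Rotation reverses composition: the nested arcs between the two factors form zigzags. It
  transfers the inverse crossing to two downward strands.\<close>

lemma rotl_comp:
  assumes f: "f \<in> homs ys zs" and g: "g \<in> homs xs ys"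
  shows "rotl xs ys g * rotl ys zs f = rotl xs zs (f * g)"
proof -
  note 1 = pad_swap[OF cups_homs[of "dual xs"] caps_homs[of zs], of "[]" "dual ys" "[]", simplified]
  note 2 = pad_swap[OF g caps_homs[of zs], of "dual xs" "dual ys" "[]", simplified]
  note 3 = pad_swap[OF caps_homs[of ys] caps_homs[of zs], of "dual xs" "[]" "[]", simplified]
  note 4 = pad_swap[OF cups_homs[of "dual xs"] f, of "[]" "dual ys" "dual zs", simplified]
  note 5 = pad_swap[OF g f, of "dual xs" "dual ys" "dual zs", simplified]
  note 6 = pad_swap[OF caps_homs[of ys] f, of "dual xs" "[]" "dual zs", simplified]
  note 7 = pad_swap[OF cups_homs[of "dual xs"] cups_homs[of "dual ys"], of "[]" "[]" "dual zs", simplified]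
  note 8 = pad_swap[OF g cups_homs[of "dual ys"], of "dual xs" "[]" "dual zs", simplified]
  note 9 = zigzag_list[of "dual xs" ys "dual zs"]
  have 10: "Id (dual xs @ ys @ dual zs) * (pad (dual xs) g (dual zs) * r) = pad (dual xs) g (dual zs) * r" for r
    using Id_pad[OF g, of "dual xs @ ys @ dual zs" "dual xs" "dual zs"] by (simp flip: mult.assoc)
  show ?thesis
    unfolding rotl_def pad_comp[OF f g]
    by (simp add: mult.assoc mult_extend[OF 1] mult_extend[OF 2] mult_extend[OF 3] mult_extend[OF 4] mult_extend[OF 5]
        mult_extend[OF 6] 7 mult_extend[OF 8] mult_extend1[OF 9] 10)
qed

lemma rotl_Id: "rotl xs xs (Id xs) = Id (dual xs)"
proof -
  have "Id (dual xs @ xs @ dual xs) * pad [] (wb (cups (dual xs))) (dual xs) = pad [] (wb (cups (dual xs))) (dual xs)"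
    by (rule Id_pad[OF cups_homs]) simp
  then show ?thesis using zigzag_list'[of "[]" "dual xs" "[]"] by (simp add: rotl_def mult.assoc)
qed

lemma rotl_smult: "rotl xs ys (c \<cdot> f) = c \<cdot> rotl xs ys f"
  by (simp add: rotl_def)

lemma cr_Dn_Dn: "Up k \<in> strands n \<Longrightarrow> Up l \<in> strands n \<Longrightarrow>
    cr s (Dn k) (Dn l) = rotl [Up k, Up l] [Up l, Up k] (cr s (Up k) (Up l))"
  using ev_rot[of "Cross s k l"] by (simp add: cr_def)

lemma cr_inverse:
  assumes x: "x \<in> strands n" and y: "y \<in> strands n"
  shows "cr (\<not> s) y x * cr s x y = Id [x, y]"
proof (cases x)
  case (Up k)
  then show ?thesis using inverses_Up[of k y s] x y by (simp add: inverses_def)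
next
  case k: (Dn k)
  show ?thesis
  proof (cases y)
    case (Up l)
    then show ?thesis using inverses_Up[of l x "\<not> s"] x y by (simp add: inverses_def k)
  next
    case l: (Dn l)
    have st: "Up k \<in> strands n" "Up l \<in> strands n" using x y k l by (auto simp: Dn_strands)
    show ?thesis
      using rotl_comp[OF cr_homs[OF st, of s] cr_homs[OF st(2,1), of "\<not> s"]] cr_Up_inverse[OF st(2,1), of "\<not> s"] rotl_Id[of "[Up l, Up k]"]
      by (simp add: k l cr_Dn_Dn st)
  qed
qed

lemma inverses_strand: "x \<in> strands n \<Longrightarrow> y \<in> strands n \<Longrightarrow> inverses s x y"
  using cr_inverse[of x y s] cr_inverse[of y x "\<not> s"] by (simp add: inverses_def)

lemma natr_strand:
  assumes "x \<in> strands n" "f \<in> homs ys zs" "set ys \<subseteq> strands n" "set zs \<subseteq> strands n"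
  shows "natr s x ys zs f"
proof -
  have "natl s x ys zs f \<longleftrightarrow> natr s x ys zs f"
    using assms by (intro natl_iff_natr inverses_strand) auto
  then show ?thesis using natl_strand[OF assms] by simp
qed


section \<open>Curls of arbitrarily oriented strands\<close>

text \<open>For a positive curl this is the square of the framing factor h_k, and for a negative one
  its inverse.\<close>

definition curl_scalar :: "bool \<Rightarrow> int \<Rightarrow> zq" where
  "curl_scalar s k = par k * qp (sg s * (k * (int n - k + 1)))"

lemma curl_scalar_inverse: "curl_scalar s k * curl_scalar (\<not> s) k = 1" "curl_scalar (\<not> s) k * curl_scalar s k = 1"
proof -
  have "qp (sg s * (k * (int n - k + 1))) * qp (- sg s * (k * (int n - k + 1))) = 1"
    unfolding qp_mult by simp
  moreover have "curl_scalar s k * curl_scalar (\<not> s) k =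
     par k * par k * (qp (sg s * (k * (int n - k + 1))) * qp (- sg s * (k * (int n - k + 1))))"
    unfolding curl_scalar_def sg_Not by (simp only: mult_ac)
  ultimately show "curl_scalar s k * curl_scalar (\<not> s) k = 1" by simp
  then show "curl_scalar (\<not> s) k * curl_scalar s k = 1" by (simp only: mult.commute)
qed

lemma curl_Up:
  assumes k: "Up k \<in> strands n"
  shows "pad [Up k] (cap (Up k)) [] * (pad [] (cr s (Up k) (Up k)) [Dn k] * pad [Up k] (cup (Up k)) []) =
    curl_scalar s k \<cdot> Id [Up k]"
  using XC_curl[OF sg_cases, of k s] k by (simp add: curl_scalar_def cr_Up_Up up_strand) (simp add: Up_strands)

lemma pad_curl_Up:
  assumes k: "Up k \<in> strands n"
  shows "pad (us @ [Up k]) (cap (Up k)) vs * (pad us (cr s (Up k) (Up k)) (Dn k # vs) * pad (us @ [Up k]) (cup (Up k)) vs) =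
    curl_scalar s k \<cdot> Id (us @ Up k # vs)"
  using arg_cong[OF curl_Up[OF k, of s], of "\<lambda>f. pad us f vs"]
  by (subst (asm) pad_comp3[OF pad_homs[OF cap_homs(2)] pad_homs[OF cr_homs[OF k k]] pad_homs[OF cup_homs(2)]]) simp_all

text \<open>Unfolding the antiparallel crossing exposes a closed curl of the opposite sign on the
  upward strand.\<close>

lemma cr_cup_Up:
  assumes k: "Up k \<in> strands n"
  shows "cr s (Up k) (Dn k) * cup (Up k) = curl_scalar (\<not> s) k \<cdot> cup (Dn k)"
proof -
  note 1 = pad_swap[OF cup_homs(3)[of k] cup_homs(2)[of k], of "[]" "[]" "[]", simplified, unfolded pad_Nil[OF cup_homs(2)] pad_Nil[OF cup_homs(3)]]
  note 2 = pad_curl_Up[OF k, of "[Dn k]" "[]" "\<not> s", simplified]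
  have "cr s (Up k) (Dn k) * cup (Up k) = pad [Dn k, Up k] (cap (Up k)) [] * (pad [Dn k] (cr (\<not> s) (Up k) (Up k)) [Dn k] *
     pad [Dn k, Up k] (cup (Up k)) []) * cup (Dn k)"
    by (simp add: cr_Up_Dn mult.assoc 1)
  then show ?thesis by (simp add: 2 Id_comp[OF cup_homs(3)])
qed

lemma cap_cr_Dn:
  assumes k: "Up k \<in> strands n"
  shows "cap (Up k) * cr s (Dn k) (Up k) = curl_scalar (\<not> s) k \<cdot> cap (Dn k)"
proof -
  note 1 = pad_swap[OF cap_homs(3)[of k] cap_homs(2)[of k], of "[]" "[]" "[]", simplified, unfolded pad_Nil[OF cap_homs(2)] pad_Nil[OF cap_homs(3)], symmetric]
  note 2 = pad_curl_Up[OF k, of "[Dn k]" "[]" "\<not> s", simplified]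
  have "cap (Up k) * cr s (Dn k) (Up k) = cap (Dn k) * (pad [Dn k, Up k] (cap (Up k)) [] * (pad [Dn k] (cr (\<not> s) (Up k) (Up k)) [Dn k] *
     pad [Dn k, Up k] (cup (Up k)) []))"
    by (simp add: cr_Dn_Up mult_extend[OF 1])
  then show ?thesis by (simp add: 2 comp_Id[OF cap_homs(3)])
qed

lemma cr_cup:
  assumes "x \<in> strands n"
  shows "cr s x (opp x) * cup x = curl_scalar (\<not> s) (label x) \<cdot> cup (opp x)"
proof (cases x)
  case (Up k)
  then show ?thesis using cr_cup_Up[of k s] assms by simp
next
  case (Dn k)
  then have k: "Up k \<in> strands n" "Dn k \<in> strands n" using assms by (auto simp: Dn_strands)
  have "curl_scalar s k \<cdot> (cr s (Dn k) (Up k) * cup (Dn k)) = cr s (Dn k) (Up k) * (cr (\<not> s) (Up k) (Dn k) * cup (Up k))"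
    using cr_cup_Up[OF k(1), of "\<not> s"] by simp
  also have "\<dots> = cup (Up k)"
    using cr_inverse[OF k, of "\<not> s"] by (simp add: mult.assoc[symmetric] Id_comp[OF cup_homs(2)])
  finally have "curl_scalar (\<not> s) k \<cdot> (curl_scalar s k \<cdot> (cr s (Dn k) (Up k) * cup (Dn k))) = curl_scalar (\<not> s) k \<cdot> cup (Up k)"
    by simp
  then show ?thesis by (simp add: Dn curl_scalar_inverse)
qed

lemma cap_cr:
  assumes "x \<in> strands n"
  shows "cap (opp x) * cr s x (opp x) = curl_scalar (\<not> s) (label x) \<cdot> cap x"
proof (cases x)
  case (Dn k)
  then show ?thesis using cap_cr_Dn[of k s] assms by (simp add: Dn_strands)
next
  case (Up k)
  then have k: "Up k \<in> strands n" "Dn k \<in> strands n" using assms by (auto simp: Dn_strands)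
  have "curl_scalar s k \<cdot> (cap (Dn k) * cr s (Up k) (Dn k)) = cap (Up k) * cr (\<not> s) (Dn k) (Up k) * cr s (Up k) (Dn k)"
    using cap_cr_Dn[OF k(1), of "\<not> s"] by simp
  also have "\<dots> = cap (Up k)"
    using cr_inverse[OF k, of s] by (simp add: mult.assoc comp_Id[OF cap_homs(2)])
  finally have "curl_scalar (\<not> s) k \<cdot> (curl_scalar s k \<cdot> (cap (Dn k) * cr s (Up k) (Dn k))) = curl_scalar (\<not> s) k \<cdot> cap (Up k)"
    by simp
  then show ?thesis by (simp add: Up curl_scalar_inverse)
qed

lemma pad_inverse:
  assumes "x \<in> strands n" "y \<in> strands n"
  shows "pad us (cr (\<not> s) y x) vs * pad us (cr s x y) vs = Id (us @ x # y # vs)"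
    "pad us (cr s y x) vs * pad us (cr (\<not> s) x y) vs = Id (us @ x # y # vs)"
  using pad_cr_inverse[OF assms cr_inverse[OF assms]] pad_cr_inverse[OF assms, of "\<not> s"] cr_inverse[OF assms, of "\<not> s"]
  by auto

text \<open>Moving x across its own cup replaces the crossing in the curl by one closed off with a
  cap, whose scalar is known for both orientations.\<close>

lemma curl_right:
  assumes x: "x \<in> strands n"
  shows "pad [x] (cap x) [] * (pad [] (cr s x x) [opp x] * pad [x] (cup x) []) = curl_scalar s (label x) \<cdot> Id [x]"
proof -
  have x': "opp x \<in> strands n" using x by simp
  have nat: "pad [x] (cr s x (opp x)) [] * (pad [] (cr s x x) [opp x] * pad [x] (cup x) []) = pad [] (cup x) [x]"
    using natl_strand[OF x cup_homs(1)[of x], of s] x by (simp add: natl_def XX_two mult.assoc)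
  note 1 = pad_inverse(1)[OF x x', of "[x]" s "[]", simplified]
  have "pad [] (cr s x x) [opp x] * pad [x] (cup x) [] = pad [x] (cr (\<not> s) (opp x) x) [] * pad [] (cup x) [x]"
    unfolding nat[symmetric] using x x' by (simp add: mult_extend1[OF 1])
  then have "pad [x] (cap x) [] * (pad [] (cr s x x) [opp x] * pad [x] (cup x) []) =
    pad [x] (cap x * cr (\<not> s) (opp x) x) [] * pad [] (cup x) [x]"
    by (simp add: pad_comp[OF cap_homs(1) cr_homs[OF x' x]] mult.assoc)
  also have "\<dots> = curl_scalar s (label x) \<cdot> Id [x]"
    using cap_cr[OF x', of "\<not> s"] zigzag_right[of "[]" x "[]"] by simp
  finally show ?thesis .
qed

lemma curl_left:
  assumes x: "x \<in> strands n"
  shows "pad [] (cap (opp x)) [x] * (pad [opp x] (cr s x x) [] * pad [] (cup (opp x)) [x]) = curl_scalar s (label x) \<cdot> Id [x]"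
proof -
  have x': "opp x \<in> strands n" using x by simp
  have h: "cup (opp x) \<in> homs [] [opp x, x]" "cap (opp x) \<in> homs [opp x, x] []" using cup_homs(1)[of "opp x"] cap_homs(1)[of "opp x"] by simp_all
  have nat: "pad [opp x] (cr (\<not> s) x x) [] * (pad [] (cr (\<not> s) x (opp x)) [x] * pad [x] (cup (opp x)) []) = pad [] (cup (opp x)) [x]"
    using natl_strand[OF x h(1), of "\<not> s"] x by (simp add: natl_def XX_two mult.assoc)
  note 1 = pad_inverse(2)[OF x x, of "[opp x]" s "[]", simplified]
  have "pad [opp x] (cr s x x) [] * pad [] (cup (opp x)) [x] = pad [] (cr (\<not> s) x (opp x)) [x] * pad [x] (cup (opp x)) []"
    unfolding nat[symmetric] using x x' by (simp add: mult_extend1[OF 1])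
  then have "pad [] (cap (opp x)) [x] * (pad [opp x] (cr s x x) [] * pad [] (cup (opp x)) [x]) =
    pad [] (cap (opp x) * cr (\<not> s) x (opp x)) [x] * pad [x] (cup (opp x)) []"
    by (simp add: pad_comp[OF h(2) cr_homs[OF x x']] mult.assoc)
  also have "\<dots> = curl_scalar s (label x) \<cdot> Id [x]"
    using cap_cr[OF x, of "\<not> s"] zigzag_left[of "[]" x "[]"] by simp
  finally show ?thesis .
qed


section \<open>Twisted vertices\<close>

lemma twist_Split:
  assumes "1 \<le> k" "1 \<le> l" "k + l \<le> int n"
  shows "cr s (Up k) (Up l) * wb (Split k l) = qp (- sg s * (k * l)) \<cdot> wb (Split l k)"
  using XC_sp[OF sg_cases, of k l s] assms by (simp add: cr_Up_Up Up_strands sp_def split0_def)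

lemma twist_Merge:
  assumes "1 \<le> k" "1 \<le> l" "k + l \<le> int n"
  shows "wb (Merge l k) * cr s (Up k) (Up l) = qp (- sg s * (k * l)) \<cdot> wb (Merge k l)"
  using mg_XC[OF sg_cases, of k l s] assms by (simp add: cr_Up_Up Up_strands mg_def merge0_def)

text \<open>Undoing a twist with the inverse crossing exchanges the two upper legs, which halves the
  cases of rotated vertices.\<close>

lemma twist_reverse:
  assumes "x \<in> strands n" "y \<in> strands n" "V \<in> homs [z] [x, y]" "cr (\<not> s) x y * V = c \<cdot> V'" "d * c = 1"
  shows "cr s y x * V' = d \<cdot> V"
proof -
  have "V = cr s y x * (cr (\<not> s) x y * V)"
    using cr_inverse[OF assms(1,2), of "\<not> s"] assms(3) by (simp flip: mult.assoc)
  then have "V = c \<cdot> (cr s y x * V')" by (simp add: assms(4))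
  then have "d \<cdot> V = (d * c) \<cdot> (cr s y x * V')" by (metis smult_smult)
  then show ?thesis by (simp add: assms(5))
qed

text \<open>Moving the downward leg across the merge leaves a kink on l and a twisted upright
  merge.\<close>

lemma twist_Merge_right:
  assumes kl: "1 \<le> k" "1 \<le> l" "k + l \<le> int n"
  shows "cr s (Up (k + l)) (Dn l) * (pad [] (wb (Merge k l)) [Dn l] * pad [Up k] (cup (Up l)) []) =
    (curl_scalar (\<not> s) l * qp (sg s * (k * l))) \<cdot> (pad [Dn l] (wb (Merge l k)) [] * pad [] (cup (Dn l)) [Up k])"
proof -
  have st: "Up k \<in> strands n" "Up l \<in> strands n" "Dn l \<in> strands n" "Up (k + l) \<in> strands n"
    using kl by (auto simp: Up_strands Dn_strands)
  have 1: "cr s (Up (k + l)) (Dn l) * pad [] (wb (Merge k l)) [Dn l] =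
     pad [Dn l] (wb (Merge k l)) [] * (pad [] (cr s (Up k) (Dn l)) [Up l] * pad [Up k] (cr s (Up l) (Dn l)) [])"
    using natr_strand[OF st(3) Merge_homs[of k l], of "\<not> s"] st by (simp add: natr_def YY_single XX_two)
  have 2: "pad [Up k] (cr s (Up l) (Dn l)) [] * pad [Up k] (cup (Up l)) [] = curl_scalar (\<not> s) l \<cdot> pad [Up k] (cup (Dn l)) []"
    using arg_cong[OF cr_cup_Up[OF st(2), of s], of "\<lambda>f. pad [Up k] f []"] by (simp add: pad_comp[OF cr_homs[OF st(2,3)] cup_homs(2)])
  have nat: "pad [Dn l] (cr s (Up k) (Up l)) [] * (pad [] (cr s (Up k) (Dn l)) [Up l] * pad [Up k] (cup (Dn l)) []) = pad [] (cup (Dn l)) [Up k]"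
    using natl_cup_Dn[OF st(1,2), of s] st by (simp add: natl_def XX_two mult.assoc)
  note i = pad_inverse(1)[OF st(1,2), of "[Dn l]" s "[]", simplified]
  have 3: "pad [] (cr s (Up k) (Dn l)) [Up l] * pad [Up k] (cup (Dn l)) [] = pad [Dn l] (cr (\<not> s) (Up l) (Up k)) [] * pad [] (cup (Dn l)) [Up k]"
    unfolding nat[symmetric] using st by (simp add: mult_extend1[OF i])
  have 4: "pad [Dn l] (wb (Merge k l)) [] * pad [Dn l] (cr (\<not> s) (Up l) (Up k)) [] = qp (sg s * (k * l)) \<cdot> pad [Dn l] (wb (Merge l k)) []"
    using arg_cong[OF twist_Merge[of l k "\<not> s"], of "\<lambda>f. pad [Dn l] f []"] kl
    by (simp add: pad_comp[OF Merge_homs cr_homs[OF st(2,1)]] mult.commute add.commute)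
  show ?thesis
    by (simp add: mult_extend[OF 1] mult.assoc 2 3) (simp add: mult.assoc[symmetric] 4)
qed

text \<open>Three scalars arise: a kink on the stem a, an upright twisted split, and a kink on l
  after the bent split has been moved across the downward strand l.\<close>

lemma twist_Split_right:
  assumes kl: "1 \<le> k" "1 \<le> l" "k + l \<le> int n"
  defines "a \<equiv> k + l"
  shows "cr s (Dn a) (Up k) * (pad [Dn a, Up k] (cap (Up l)) [] * (pad [Dn a] (wb (Split k l)) [Dn l] * pad [] (cup (Dn a)) [Dn l])) =
    (curl_scalar (\<not> s) a * qp (- sg s * (k * l)) * curl_scalar s l) \<cdot>
     (pad [] (cap (Dn l)) [Up k, Dn a] * (pad [Dn l] (wb (Split l k)) [Dn a] * pad [Dn l] (cup (Up a)) []))"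
proof -
  define t where "t = (\<not> s)"
  have st: "Up k \<in> strands n" "Up l \<in> strands n" "Dn l \<in> strands n" "Up a \<in> strands n" "Dn a \<in> strands n"
    using kl by (auto simp: Up_strands Dn_strands a_def)
  have S: "wb (Split k l) \<in> homs [Up a] [Up k, Up l]" "wb (Split l k) \<in> homs [Up a] [Up l, Up k]"
    using Split_homs[of k l] Split_homs[of l k] by (simp_all add: a_def add.commute)
  define D where "D = pad [] (wb (Split l k)) [Dn a] * cup (Up a)"
  have D: "D \<in> homs [] [Up l, Up k, Dn a]" unfolding D_def by (auto intro!: homs_comp[OF pad_homs[OF S(2)] cup_homs(2)])
  have nat: "pad [Up k] (cr s (Dn a) (Up l)) [] * (pad [] (cr s (Dn a) (Up k)) [Up l] * pad [Dn a] (wb (Split k l)) []) =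
    pad [] (wb (Split k l)) [Dn a] * cr s (Dn a) (Up a)"
    using natl_strand[OF st(5) S(1), of s] st by (simp add: natl_def XX_single XX_two mult.assoc)
  note i1 = pad_inverse(1)[OF st(5,2), of "[Up k]" s "[]", simplified]
  have 1: "pad [] (cr s (Dn a) (Up k)) [Up l] * (pad [Dn a] (wb (Split k l)) [] * cup (Dn a)) =
    curl_scalar t a \<cdot> (pad [Up k] (cr t (Up l) (Dn a)) [] * (pad [] (wb (Split k l)) [Dn a] * cup (Up a)))"
  proof -
    have "pad [] (cr s (Dn a) (Up k)) [Up l] * (pad [Dn a] (wb (Split k l)) [] * cup (Dn a)) =
      pad [Up k] (cr t (Up l) (Dn a)) [] * (pad [Up k] (cr s (Dn a) (Up l)) [] * (pad [] (cr s (Dn a) (Up k)) [Up l] * pad [Dn a] (wb (Split k l)) [])) * cup (Dn a)"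
      using st by (simp add: mult.assoc t_def mult_extend1[OF i1])
    also have "\<dots> = pad [Up k] (cr t (Up l) (Dn a)) [] * (pad [] (wb (Split k l)) [Dn a] * (cr s (Dn a) (Up a) * cup (Dn a)))"
      unfolding nat by (simp add: mult.assoc)
    finally show ?thesis using cr_cup[OF st(5), of s] by (simp add: t_def)
  qed
  have 2: "wb (Split k l) = qp (- sg s * (k * l)) \<cdot> (cr t (Up l) (Up k) * wb (Split l k))"
  proof -
    have "cr t (Up l) (Up k) * wb (Split l k) = qp (sg s * (k * l)) \<cdot> wb (Split k l)"
      using twist_Split[of l k t] kl by (simp add: t_def add.commute mult.commute)
    then show ?thesis by (simp add: qp_mult)
  qed
  have 3: "pad [] (wb (Split k l)) [Dn a] * cup (Up a) = qp (- sg s * (k * l)) \<cdot> (pad [] (cr t (Up l) (Up k)) [Dn a] * D)"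
    unfolding 2 D_def by (simp add: pad_comp[OF cr_homs[OF st(2,1)] S(2)] mult.assoc)
  have 4: "pad [] (cr s (Dn a) (Up k)) [Up l] * (pad [Dn a] (wb (Split k l)) [] * cup (Dn a)) =
    (curl_scalar t a * qp (- sg s * (k * l))) \<cdot> (pad [Up k] (cr t (Up l) (Dn a)) [] * (pad [] (cr t (Up l) (Up k)) [Dn a] * D))"
    unfolding 1 3 by simp
  have p4: "pad [] (cr s (Dn a) (Up k)) [Up l, Dn l] * (pad [Dn a] (wb (Split k l)) [Dn l] * pad [] (cup (Dn a)) [Dn l]) =
    (curl_scalar t a * qp (- sg s * (k * l))) \<cdot> (pad [Up k] (cr t (Up l) (Dn a)) [Dn l] * (pad [] (cr t (Up l) (Up k)) [Dn a, Dn l] * pad [] D [Dn l]))"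
  proof -
    have "pad [] (pad [] (cr s (Dn a) (Up k)) [Up l] * (pad [Dn a] (wb (Split k l)) [] * cup (Dn a))) [Dn l] =
      pad [] (cr s (Dn a) (Up k)) [Up l, Dn l] * (pad [Dn a] (wb (Split k l)) [Dn l] * pad [] (cup (Dn a)) [Dn l])"
      by (subst pad_comp3[OF pad_homs[OF cr_homs[OF st(5,1)]] pad_homs[OF S(1)] cup_homs(3)]) simp_all
    moreover have "pad [] (pad [Up k] (cr t (Up l) (Dn a)) [] * (pad [] (cr t (Up l) (Up k)) [Dn a] * D)) [Dn l] =
      pad [Up k] (cr t (Up l) (Dn a)) [Dn l] * (pad [] (cr t (Up l) (Up k)) [Dn a, Dn l] * pad [] D [Dn l])"
      by (subst pad_comp3[OF pad_homs[OF cr_homs[OF st(2,5)]] pad_homs[OF cr_homs[OF st(2,1)]] D]) simp_all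
    ultimately show ?thesis using arg_cong[OF 4, of "\<lambda>f. pad [] f [Dn l]"] by simp
  qed
  note 5 = pad_swap[OF cr_homs[OF st(5,1), of s] cap_homs(2)[of l], of "[]" "[]" "[]", simplified, unfolded pad_Nil[OF cr_homs[OF st(5,1)]]]
  \<comment> \<open>A strand crossing one leg of a cap is moved to its other leg.\<close>
  have capl: "pad us (pad [z] (cap (Up l)) []) vs * pad us (cr t (Up l) z) (Dn l # vs) =
    pad us (cap (Up l)) (z # vs) * pad (us @ [Up l]) (cr s z (Dn l)) vs" if z: "z \<in> strands n" for z us vs
  proof -
    have "pad [] (cap (Up l)) [z] = pad [z] (cap (Up l)) [] * (pad [] (cr t (Up l) z) [Dn l] * pad [Up l] (cr t (Dn l) z) [])"
      using natr_strand[OF z cap_homs(2)[of l], of s] z st by (simp add: natr_def XX_two t_def)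
    then have "pad [] (cap (Up l)) [z] * pad [Up l] (cr s z (Dn l)) [] = pad [z] (cap (Up l)) [] * pad [] (cr t (Up l) z) [Dn l]"
      using pad_inverse(1)[OF z st(3), of "[Up l]" s "[]"] z st by (simp add: mult.assoc t_def)
    moreover have "pad us (pad [] (cap (Up l)) [z] * pad [Up l] (cr s z (Dn l)) []) vs =
      pad us (cap (Up l)) (z # vs) * pad (us @ [Up l]) (cr s z (Dn l)) vs"
      by (subst pad_comp[OF pad_homs[OF cap_homs(2)] pad_homs[OF cr_homs[OF z st(3)]]]) simp_all
    moreover have "pad us (pad [z] (cap (Up l)) [] * pad [] (cr t (Up l) z) [Dn l]) vs =
      pad us (pad [z] (cap (Up l)) []) vs * pad us (cr t (Up l) z) (Dn l # vs)"
      by (subst pad_comp[OF pad_homs[OF cap_homs(2)] pad_homs[OF cr_homs[OF st(2) z]]]) simp_all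
    ultimately show ?thesis by simp
  qed
  note 6 = capl[OF st(5), of "[Up k]" "[]", simplified]
  note 7 = pad_swap[OF cr_homs[OF st(2,1), of t] cr_homs[OF st(5,3), of s], of "[]" "[]" "[]", simplified, symmetric]
  note 8 = capl[OF st(1), of "[]" "[Dn a]", simplified]
  \<comment> \<open>D has no lower endpoints, so the strand l passes it without any crossing on the
    other side.\<close>
  have 9: "pad [] (cr s (Up l) (Dn l)) [Up k, Dn a] * (pad [Up l] (cr s (Up k) (Dn l)) [Dn a] * (pad [Up l, Up k] (cr s (Dn a) (Dn l)) [] * pad [] D [Dn l])) =
    pad [Dn l] D []"
  proof -
    have e: "pad [Up l] (YY t (Dn l) [Up k, Dn a]) [] = pad [Up l] (cr s (Up k) (Dn l)) [Dn a] * pad [Up l, Up k] (cr s (Dn a) (Dn l)) []"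
      using st by (simp add: XX_two t_def pad_comp[OF pad_homs[OF cr_homs[OF st(1,3)]] pad_homs[OF cr_homs[OF st(5,3)]]])
    have y: "YY t (Dn l) [Up l, Up k, Dn a] = pad [] (cr s (Up l) (Dn l)) [Up k, Dn a] *
       (pad [Up l] (cr s (Up k) (Dn l)) [Dn a] * pad [Up l, Up k] (cr s (Dn a) (Dn l)) [])"
      unfolding YY.simps(2)[of t "Dn l" "Up l" "[Up k, Dn a]"] e by (simp add: t_def)
    show ?thesis
      using natr_strand[OF st(3) D, of t] st comp_Id[OF pad_homs[OF D, of "[Dn l]" "[Dn l]" "[]"], of "[Dn l, Up l, Up k, Dn a]"]
      unfolding natr_def y by (simp add: mult.assoc)
  qed
  note i9 = pad_inverse(2)[OF st(2,3), of "[]" t "[Up k, Dn a]", simplified]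
  have 10: "pad [Up l] (cr s (Up k) (Dn l)) [Dn a] * (pad [Up l, Up k] (cr s (Dn a) (Dn l)) [] * pad [] D [Dn l]) =
    pad [] (cr t (Dn l) (Up l)) [Up k, Dn a] * pad [Dn l] D []"
    unfolding 9[symmetric] using st i9 by (simp add: t_def mult_extend1)
  have 11: "pad [] (cap (Up l)) [Up k, Dn a] * pad [] (cr t (Dn l) (Up l)) [Up k, Dn a] = curl_scalar s l \<cdot> pad [] (cap (Dn l)) [Up k, Dn a]"
    using arg_cong[OF cap_cr_Dn[OF st(2), of t], of "\<lambda>f. pad [] f [Up k, Dn a]"] by (simp add: t_def pad_comp[OF cap_homs(2) cr_homs[OF st(3,2)]])
  have 12: "pad [Dn l] D [] = pad [Dn l] (wb (Split l k)) [Dn a] * pad [Dn l] (cup (Up a)) []"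
    unfolding D_def by (subst pad_comp[OF pad_homs[OF S(2)] cup_homs(2)]) simp_all
  have "cr s (Dn a) (Up k) * (pad [Dn a, Up k] (cap (Up l)) [] * (pad [Dn a] (wb (Split k l)) [Dn l] * pad [] (cup (Dn a)) [Dn l])) =
    pad [Up k, Dn a] (cap (Up l)) [] * (pad [] (cr s (Dn a) (Up k)) [Up l, Dn l] * (pad [Dn a] (wb (Split k l)) [Dn l] * pad [] (cup (Dn a)) [Dn l]))"
    by (simp add: mult_extend[OF 5])
  also have "\<dots> = (curl_scalar t a * qp (- sg s * (k * l))) \<cdot> (pad [] (cap (Up l)) [Up k, Dn a] *
      (pad [Up l] (cr s (Up k) (Dn l)) [Dn a] * (pad [Up l, Up k] (cr s (Dn a) (Dn l)) [] * pad [] D [Dn l])))"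
    unfolding p4 by (simp add: mult_extend[OF 6] mult_extend[OF 7] mult_extend[OF 8])
  also have "\<dots> = (curl_scalar t a * qp (- sg s * (k * l)) * curl_scalar s l) \<cdot> (pad [] (cap (Dn l)) [Up k, Dn a] * pad [Dn l] D [])"
    unfolding 10 by (simp add: mult.assoc[symmetric] 11)
  finally show ?thesis by (simp add: 12 t_def)
qed

end


section \<open>Framing factors\<close>

lemma sqrtq_nonzero [simp]: "sqrtq \<noteq> 0" and imag_nonzero [simp]: "imag \<noteq> 0"
  by (simp_all add: sqrtq_def imag_def)

lemma imag_square: "imag * imag = - 1"
  using fls_const_uminus[of "1 :: complex"] by (simp add: imag_def fls_const_mult_const)

text \<open>One of the three labels at a vertex is the sum of the other two, so z - x - y is even:
  the fourth root of unity and the half powers of q drop out and the ratio lies in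
  \<open>Zq\<close>.\<close>

lemma framing_ratio:
  assumes p: "z - x - y = 2 * p" and e: "- int n * (2 * p) + z * (z - 1) - x * (x - 1) - y * (y - 1) = 2 * e"
  shows "inverse (framing n y) * inverse (framing n x) * framing n z = Rep_zq (par p * qp e)"
proof -
  define w where "w k = - int n * k + k * (k - 1)" for k
  have "inverse (framing n y) * inverse (framing n x) * framing n z =
    imag powi (z - x - y) * sqrtq powi (w z - w x - w y)"
    by (simp add: framing_def w_def power_int_diff inverse_mult_distrib divide_inverse)
  also have "w z - w x - w y = 2 * e"
  proof -
    have "w z - w x - w y = - int n * (z - x - y) + z * (z - 1) - x * (x - 1) - y * (y - 1)"
      by (simp add: w_def algebra_simps)
    then show ?thesis using p e by simp
  qed
  also have "imag powi (z - x - y) = (- 1) powi p"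
    unfolding p by (simp add: power_int_mult power2_eq_square imag_square)
  also have "sqrtq powi (2 * e) = q powi e"
    by (simp add: power_int_mult q_def)
  also have "(- 1) powi p = Rep_zq (par p)"
    by (auto simp: par_def one_zq.rep_eq uminus_zq.rep_eq power_int_def minus_one_power_iff even_nat_iff)
  finally show ?thesis by (simp add: times_zq.rep_eq qp.rep_eq)
qed

lemma Zq_ext_1: "1 \<in> Zq_ext" and Zq_ext_mult: "x \<in> Zq_ext \<Longrightarrow> y \<in> Zq_ext \<Longrightarrow> x * y \<in> Zq_ext"
  by (simp_all add: Zq_ext_def ring_gen.intros)

lemma Zq_ext_powi:
  assumes "x \<in> Zq_ext" "inverse x \<in> Zq_ext"
  shows "x powi m \<in> Zq_ext"
proof -
  have pow: "y ^ k \<in> Zq_ext" if "y \<in> Zq_ext" for y k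
    using that by (induction k) (auto intro: Zq_ext_1 Zq_ext_mult)
  show ?thesis using assms by (auto simp: power_int_def intro: pow)
qed

lemma Zq_ext_framing: "framing n k \<in> Zq_ext" "inverse (framing n k) \<in> Zq_ext"
proof -
  have gen: "sqrtq \<in> Zq_ext" "inverse sqrtq \<in> Zq_ext" "imag \<in> Zq_ext"
    by (auto simp: Zq_ext_def intro: ring_gen.gen)
  \<comment> \<open>The generators of \<open>Zq_ext\<close> include no inverse of
    \<open>imag\<close>; its cube is one.\<close>
  have "imag * (imag * (imag * imag)) = 1"
    by (simp add: mult.assoc[symmetric] imag_square)
  then have "inverse imag = imag * (imag * imag)"
    by (simp add: inverse_unique)
  then have inv: "inverse imag \<in> Zq_ext" using gen by (simp add: Zq_ext_mult)
  have i: "sqrtq powi m \<in> Zq_ext" "imag powi m \<in> Zq_ext" for m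
    using gen inv by (auto intro: Zq_ext_powi)
  show "framing n k \<in> Zq_ext"
    unfolding framing_def by (intro Zq_ext_mult i)
  have "inverse (framing n k) = imag powi (- k) * sqrtq powi (- (- int n * k + k * (k - 1)))"
    unfolding framing_def power_int_minus by (simp only: inverse_mult_distrib)
  then show "inverse (framing n k) \<in> Zq_ext" by (simp only: Zq_ext_mult i)
qed

lemma Zq_ext_mark_scalar: "mark_scalar n D \<in> Zq_ext"
  by (induction D) (auto intro: Zq_ext_1 Zq_ext_mult Zq_ext_framing)

lemma null_webs_mono: "x \<in> null_webs A n \<Longrightarrow> A \<subseteq> B \<Longrightarrow> x \<in> null_webs B n"
  by (induction rule: null_webs.induct) (auto intro: null_webs.intros)

lemma unmarked_X [simp]: "unmarked (X s x y)"
  by (cases x; cases y) (auto simp: rot_def)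

lemma mark_scalar_X [simp]: "mark_scalar n (X s x y) = 1"
  by (simp add: mark_scalar_unmarked)

lemma fork_boundary: "fork z x y V \<Longrightarrow> src V = [z] \<and> tgt V = [x, y] \<and> unmarked V"
  by (induction rule: fork.induct) (auto simp: rot_def)


section \<open>Invariance under the moves\<close>

context webs
begin

lemma Id_tens_pad: "f \<in> homs as bs \<Longrightarrow> Id us \<otimes> f = pad us f []"
  and tens_Id_pad: "f \<in> homs as bs \<Longrightarrow> f \<otimes> Id us = pad [] f us"
  using Id_Nil_tens[OF homs_tens[OF _ Id_homs]] by (simp_all add: pad_def)

text \<open>The upright split and the rotated merge carry no kink. Of the four bent vertices, two
  are computed directly and the other two follow from \<open>twist_reverse\<close>. In each case c
  equals the ratio of framing factors.\<close>

lemma vertex_twist_eq: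
  assumes V: "fork z x y V" and V': "fork z y x V'" and adm: "admissible n V" "admissible n V'"
  shows "\<exists>c. cr True x y * ev V = c \<cdot> ev V' \<and>
    Rep_zq c = inverse (framing n (label y)) * inverse (framing n (label x)) * framing n (label z)"
  using V
proof cases
  case (1 k l)
  have "V' = Split l k" using V' unfolding 1 by (auto elim: fork.cases)
  moreover have "qp (k * l) = par 0 * qp (k * l)" by simp
  moreover have "Rep_zq (par 0 * qp (k * l)) = inverse (framing n l) * inverse (framing n k) * framing n (k + l)"
    by (rule framing_ratio[symmetric]) (auto simp: algebra_simps)
  ultimately show ?thesis
    using twist_Split[of k l True] adm unfolding 1 by (intro exI[of _ "qp (k * l)"]) (simp add: sg_def)
next
  case (2 k l)
  have kl: "1 \<le> k" "1 \<le> l" "k + l \<le> int n" using adm unfolding 2 by auto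
  have V'_eq: "V' = Comp (Tens (Ident [Dn l]) (Merge l k)) (Tens (Cup (Dn l)) (Ident [Up k]))"
    using V' unfolding 2 by (auto elim: fork.cases)
  have c: "curl_scalar (\<not> True) l * qp (sg True * (k * l)) = par (- l) * qp (l * (int n - l + 1) - k * l)"
    by (simp add: curl_scalar_def sg_def mult.assoc qp_mult)
  have r: "Rep_zq (par (- l) * qp (l * (int n - l + 1) - k * l)) = inverse (framing n l) * inverse (framing n (k + l)) * framing n k"
    by (rule framing_ratio[symmetric]) (auto simp: algebra_simps)
  show ?thesis
    using twist_Merge_right[OF kl, of True] unfolding 2 V'_eq c
    by (intro exI[of _ "par (- l) * qp (l * (int n - l + 1) - k * l)"])
      (simp add: r Id_tens_pad[OF Merge_homs] tens_Id_pad[OF Merge_homs] Id_tens_pad[OF cup_homs(2)] tens_Id_pad[OF cup_homs(3)] del: par_minus)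
next
  case (3 l k)
  have kl: "1 \<le> l" "1 \<le> k" "l + k \<le> int n" using adm unfolding 3 by auto
  have st: "Up (k + l) \<in> strands n" "Dn k \<in> strands n" using kl by (auto simp: Up_strands Dn_strands)
  have V'_eq: "V' = Comp (Tens (Merge l k) (Ident [Dn k])) (Tens (Ident [Up l]) (Cup (Up k)))"
    using V' unfolding 3 by (auto elim: fork.cases)
  let ?V = "pad [] (wb (Merge l k)) [Dn k] * pad [Up l] (cup (Up k)) []"
  have V: "?V \<in> homs [Up l] [Up (k + l), Dn k]"
    using Merge_homs[of l k] by (auto intro!: homs_comp[OF pad_homs pad_homs[OF cup_homs(2)]] simp: add.commute)
  have "cr (\<not> True) (Up (k + l)) (Dn k) * ?V =
     (curl_scalar (\<not> \<not> True) k * qp (sg (\<not> True) * (l * k))) \<cdot> (pad [Dn k] (wb (Merge k l)) [] * pad [] (cup (Dn k)) [Up l])"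
    using twist_Merge_right[OF kl, of "\<not> True"] by (simp add: add.commute)
  moreover have "par (- k) * qp (k * (int n - k + 1) - k * l) * (curl_scalar (\<not> \<not> True) k * qp (sg (\<not> True) * (l * k))) = 1"
  proof -
    have "par (- k) * qp (k * (int n - k + 1) - k * l) * (curl_scalar (\<not> \<not> True) k * qp (sg (\<not> True) * (l * k))) =
      par k * par k * (qp (k * (int n - k + 1) - k * l) * (qp (- 1 * (k * (int n - k + 1))) * qp (1 * (l * k))))"
      unfolding curl_scalar_def sg_def par_minus by (simp add: mult_ac del: par_square)
    also have "\<dots> = 1" unfolding par_square qp_mult by (simp add: algebra_simps)
    finally show ?thesis .
  qed
  ultimately have "cr True (Dn k) (Up (k + l)) * (pad [Dn k] (wb (Merge k l)) [] * pad [] (cup (Dn k)) [Up l]) =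
     (par (- k) * qp (k * (int n - k + 1) - k * l)) \<cdot> ?V"
    by (rule twist_reverse[OF st V])
  moreover have "Rep_zq (par (- k) * qp (k * (int n - k + 1) - k * l)) = inverse (framing n (k + l)) * inverse (framing n k) * framing n l"
    by (rule framing_ratio[symmetric]) (auto simp: algebra_simps)
  ultimately show ?thesis
    unfolding 3 V'_eq
    by (intro exI[of _ "par (- k) * qp (k * (int n - k + 1) - k * l)"])
      (simp add: Id_tens_pad[OF Merge_homs] tens_Id_pad[OF Merge_homs] Id_tens_pad[OF cup_homs(2)] tens_Id_pad[OF cup_homs(3)] del: par_minus)
next
  case (4 k l)
  have adm': "admissible n (Merge l k)" using adm unfolding 4 rot_def by auto
  then have kl: "1 \<le> k" "1 \<le> l" "k + l \<le> int n" by auto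
  have st: "Up k \<in> strands n" "Up l \<in> strands n" using kl by (auto simp: Up_strands)
  have V'_eq: "V' = rot (Merge k l)" using V' unfolding 4 by (auto elim: fork.cases)
  have M: "wb (Merge l k) \<in> homs [Up l, Up k] [Up (k + l)]" using Merge_homs[of l k] by (simp add: add.commute)
  have "rotl [Up k, Up l] [Up l, Up k] (cr True (Up k) (Up l)) * rotl [Up l, Up k] [Up (k + l)] (wb (Merge l k)) =
     rotl [Up k, Up l] [Up (k + l)] (qp (k * l) \<cdot> wb (Merge k l))"
    using rotl_comp[OF M cr_homs[OF st, of True]] twist_Merge[OF kl, of True] by (simp add: sg_def)
  moreover have "Rep_zq (par 0 * qp (k * l)) = inverse (framing n l) * inverse (framing n k) * framing n (k + l)"
    by (rule framing_ratio[symmetric]) (auto simp: algebra_simps)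
  ultimately show ?thesis
    unfolding 4 V'_eq using adm' kl
    by (intro exI[of _ "qp (k * l)"]) (simp add: cr_Dn_Dn[OF st] ev_rot rotl_smult add.commute)
next
  case (5 l k)
  have kl: "1 \<le> k" "1 \<le> l" "k + l \<le> int n" using adm unfolding 5 by auto
  let ?a = "k + l"
  have V'_eq': "V' = Comp (Tens (Cap (Dn l)) (Ident [Up k, Dn (l + k)]))
     (Comp (Tens (Ident [Dn l]) (Tens (Split l k) (Ident [Dn (l + k)]))) (Tens (Ident [Dn l]) (Cup (Up (l + k)))))"
    using V' unfolding 5 by (auto elim: fork.cases)
  note V'_eq = V'_eq'[unfolded add.commute[of l k]]
  let ?e = "?a * (int n - ?a + 1) + k * l - l * (int n - l + 1)"
  have c: "curl_scalar (\<not> True) ?a * qp (- sg True * (k * l)) * curl_scalar True l = par (- k) * qp ?e"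
  proof -
    have "curl_scalar (\<not> True) ?a * qp (- sg True * (k * l)) * curl_scalar True l =
      par ?a * par l * (qp (1 * (?a * (int n - ?a + 1))) * (qp (k * l) * qp (- 1 * (l * (int n - l + 1)))))"
      by (simp add: curl_scalar_def sg_def mult_ac)
    also have "par ?a * par l = par (- k)" unfolding par_mult by (rule par_cong) simp
    also have "qp (1 * (?a * (int n - ?a + 1))) * (qp (k * l) * qp (- 1 * (l * (int n - l + 1)))) = qp ?e"
      unfolding qp_mult by (rule arg_cong[where f = qp]) simp
    finally show ?thesis .
  qed
  have r: "Rep_zq (par (- k) * qp ?e) = inverse (framing n k) * inverse (framing n ?a) * framing n l"
    by (rule framing_ratio[symmetric]) (auto simp: algebra_simps)
  have S: "wb (Split l k) \<in> homs [Up ?a] [Up l, Up k]" using Split_homs[of l k] by (simp add: add.commute)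
  show ?thesis
    using twist_Split_right[OF kl, of True] unfolding 5 V'_eq c
    by (intro exI[of _ "par (- k) * qp ?e"])
      (simp add: r tens_Id_pad[OF Split_homs] tens_Id_pad[OF S] Id_tens_pad[OF pad_homs[OF Split_homs HOL.refl HOL.refl]] Id_tens_pad[OF pad_homs[OF S HOL.refl HOL.refl]]
        Id_tens_pad[OF cap_homs(2)] tens_Id_pad[OF cap_homs(3)] Id_tens_pad[OF cup_homs(2)] tens_Id_pad[OF cup_homs(3)] del: par_minus)
next
  case (6 k l)
  have kl: "1 \<le> l" "1 \<le> k" "l + k \<le> int n" using adm unfolding 6 by auto
  let ?a = "k + l"
  have st: "Up l \<in> strands n" "Dn ?a \<in> strands n" "Dn k \<in> strands n" using kl by (auto simp: Up_strands Dn_strands)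
  have V'_eq': "V' = Comp (Tens (Ident [Dn (l + k), Up l]) (Cap (Up k)))
     (Comp (Tens (Ident [Dn (l + k)]) (Tens (Split l k) (Ident [Dn k]))) (Tens (Cup (Dn (l + k))) (Ident [Dn k])))"
    using V' unfolding 6 by (auto elim: fork.cases)
  note V'_eq = V'_eq'[unfolded add.commute[of l k]]
  let ?e = "?a * (int n - ?a + 1) + k * l - k * (int n - k + 1)"
  have S: "wb (Split l k) \<in> homs [Up ?a] [Up l, Up k]" using Split_homs[of l k] by (simp add: add.commute)
  let ?V = "pad [Dn ?a, Up l] (cap (Up k)) [] * (pad [Dn ?a] (wb (Split l k)) [Dn k] * pad [] (cup (Dn ?a)) [Dn k])"
  have V: "?V \<in> homs [Dn k] [Dn ?a, Up l]"
    by (rule homs_comp[OF pad_homs[OF cap_homs(2)] homs_comp[OF pad_homs[OF S] pad_homs[OF cup_homs(3)]]]) simp_all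
  let ?c = "curl_scalar (\<not> \<not> True) ?a * qp (- sg (\<not> True) * (l * k)) * curl_scalar (\<not> True) k"
  have "cr (\<not> True) (Dn ?a) (Up l) * ?V = ?c \<cdot> (pad [] (cap (Dn k)) [Up l, Dn ?a] * (pad [Dn k] (wb (Split k l)) [Dn ?a] * pad [Dn k] (cup (Up ?a)) []))"
    using twist_Split_right[OF kl, of "\<not> True"] by (simp add: add.commute)
  moreover have "par (- l) * qp ?e * ?c = 1"
  proof -
    have "par (- l) * qp ?e * ?c = par l * par ?a * par k *
      (qp ?e * (qp (- 1 * (?a * (int n - ?a + 1))) * (qp (- 1 * (l * k)) * qp (1 * (k * (int n - k + 1))))))"
      unfolding curl_scalar_def sg_def par_minus by (simp add: mult_ac)
    also have "par l * par ?a * par k = par 0" unfolding par_mult by (rule par_cong) simp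
    also have "qp ?e * (qp (- 1 * (?a * (int n - ?a + 1))) * (qp (- 1 * (l * k)) * qp (1 * (k * (int n - k + 1))))) = qp 0"
      unfolding qp_mult by (rule arg_cong[where f = qp]) simp
    finally show ?thesis by simp
  qed
  ultimately have "cr True (Up l) (Dn ?a) * (pad [] (cap (Dn k)) [Up l, Dn ?a] * (pad [Dn k] (wb (Split k l)) [Dn ?a] * pad [Dn k] (cup (Up ?a)) [])) =
     (par (- l) * qp ?e) \<cdot> ?V"
    by (rule twist_reverse[OF st(2,1) V])
  moreover have "Rep_zq (par (- l) * qp ?e) = inverse (framing n ?a) * inverse (framing n l) * framing n k"
    by (rule framing_ratio[symmetric]) (auto simp: algebra_simps)
  ultimately show ?thesis
    unfolding 6 V'_eq
    by (intro exI[of _ "par (- l) * qp ?e"])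
      (simp add: tens_Id_pad[OF Split_homs] tens_Id_pad[OF S] Id_tens_pad[OF pad_homs[OF Split_homs HOL.refl HOL.refl]] Id_tens_pad[OF pad_homs[OF S HOL.refl HOL.refl]]
        Id_tens_pad[OF cap_homs(2)] tens_Id_pad[OF cap_homs(3)] Id_tens_pad[OF cup_homs(2)] tens_Id_pad[OF cup_homs(3)] del: par_minus)
qed

lemma ev_X: "ev (X s x y) = cr s x y"
  by (simp add: cr_def)

lemma ev_curl_right: "x \<in> strands n \<Longrightarrow> ev (curl_right s x) = curl_scalar s (label x) \<cdot> Id [x]"
  using curl_right[of x s]
  by (simp add: curl_right_def ev_X Id_tens_pad[OF cap_homs(1)] Id_tens_pad[OF cup_homs(1)] tens_Id_pad[OF cr_homs])

lemma ev_curl_left: "x \<in> strands n \<Longrightarrow> ev (curl_left s x) = curl_scalar s (label x) \<cdot> Id [x]"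
  using curl_left[of x s]
  by (simp add: curl_left_def ev_X tens_Id_pad[OF cap_homs(1)] tens_Id_pad[OF cup_homs(1)] Id_tens_pad[OF cr_homs])

text \<open>The scalar c in \<open>Zq\<close> compensates exactly for the change in the marks; it
  differs from 1 only through the vertex twist. In this form the statement is stable under
  composition with other diagrams.\<close>

lemma move_sound:
  "move n D D' \<Longrightarrow> admissible n D \<and> admissible n D' \<and> src D = src D' \<and> tgt D = tgt D' \<and>
    (\<exists>c. ev D = c \<cdot> ev D' \<and> mark_scalar n D * Rep_zq c = mark_scalar n D')"
proof (induction rule: move.induct)
  case (opposite_curls_right x s)
  then show ?case using X_boundary[of x x]
    by (intro conjI exI[of _ 1]) (auto simp: ev_curl_right curl_scalar_inverse one_zq.rep_eq, auto simp: curl_right_def)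
next
  case (opposite_curls_left x s)
  then show ?case using X_boundary[of x x]
    by (intro conjI exI[of _ 1]) (auto simp: ev_curl_left curl_scalar_inverse one_zq.rep_eq, auto simp: curl_left_def)
next
  case (reidemeister2 x y s)
  then show ?case using X_boundary[of x y] X_boundary[of y x] cr_inverse[of x y s]
    by (intro conjI exI[of _ 1]) (auto simp: ev_X one_zq.rep_eq)
next
  case (reidemeister3 x y z s)
  \<comment> \<open>The crossing of y and z is itself an element across which x can be moved, here
    underneath.\<close>
  have "XX False x [z, y] * pad [x] (cr s y z) [] = pad [] (cr s y z) [x] * XX False x [y, z]"
    using natl_strand[OF reidemeister3(1) cr_homs[OF reidemeister3(2,3)], of False s] reidemeister3 by (simp add: natl_def)
  with reidemeister3 show ?case using X_boundary
    by (intro conjI exI[of _ 1])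
      (auto simp: ev_X one_zq.rep_eq XX_two Id_tens_pad[OF cr_homs] tens_Id_pad[OF cr_homs] mult.assoc)
next
  case (vertex_slide z x y V w s)
  have bd: "src V = [z]" "tgt V = [x, y]" "unmarked V" using fork_boundary[OF vertex_slide(1)] by auto
  have st: "z \<in> strands n" "x \<in> strands n" "y \<in> strands n" using admissible_boundary[OF vertex_slide(2)] bd by auto
  have h: "ev V \<in> homs [z] [x, y]" using ev_homs[OF vertex_slide(2)] bd by simp
  have "XX s w [x, y] * pad [w] (ev V) [] = pad [] (ev V) [w] * XX s w [z]"
    using natl_strand[OF vertex_slide(3) h, of s] st by (simp add: natl_def)
  with vertex_slide st bd show ?case using X_boundary
    by (intro conjI exI[of _ 1])
      (auto simp: ev_X one_zq.rep_eq XX_two XX_single Id_tens_pad[OF cr_homs] tens_Id_pad[OF cr_homs] Id_tens_pad[OF h] tens_Id_pad[OF h] mult.assoc mark_scalar_unmarked)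
next
  case (vertex_twist z x y V V')
  have bd: "src V = [z]" "tgt V = [x, y]" "unmarked V" "src V' = [z]" "tgt V' = [y, x]" "unmarked V'"
    using fork_boundary[OF vertex_twist(1)] fork_boundary[OF vertex_twist(2)] by auto
  have st: "z \<in> strands n" "x \<in> strands n" "y \<in> strands n" using admissible_boundary[OF vertex_twist(3)] bd by auto
  have h: "ev V' \<in> homs [z] [y, x]" using ev_homs[OF vertex_twist(4)] bd by simp
  obtain c where c: "cr True x y * ev V = c \<cdot> ev V'"
    "Rep_zq c = inverse (framing n (label y)) * inverse (framing n (label x)) * framing n (label z)"
    using vertex_twist_eq[OF vertex_twist(1-4)] by auto
  show ?case using vertex_twist(3,4) st bd X_boundary[OF st(2,3)] c h
    by (intro conjI exI[of _ c]) (auto simp: ev_X mark_scalar_unmarked mult.assoc)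
next
  case (above D D' C)
  then obtain c where c: "ev D = c \<cdot> ev D'" "mark_scalar n D * Rep_zq c = mark_scalar n D'" by auto
  from above show ?case by (intro conjI exI[of _ c]) (auto simp: c(1) c(2)[symmetric])
next
  case (below D D' C)
  then obtain c where c: "ev D = c \<cdot> ev D'" "mark_scalar n D * Rep_zq c = mark_scalar n D'" by auto
  from below show ?case by (intro conjI exI[of _ c]) (auto simp: c(1) c(2)[symmetric])
next
  case (left D D' C)
  then obtain c where c: "ev D = c \<cdot> ev D'" "mark_scalar n D * Rep_zq c = mark_scalar n D'" by auto
  from left show ?case by (intro conjI exI[of _ c]) (auto simp: c(1) c(2)[symmetric])
next
  case (right D D' C)
  then obtain c where c: "ev D = c \<cdot> ev D'" "mark_scalar n D * Rep_zq c = mark_scalar n D'" by auto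
  from right show ?case by (intro conjI exI[of _ c]) (auto simp: c(1) c(2)[symmetric])
qed

lemma Psi_T_invariant:
  assumes "isotopic n D D' \<or> move n D D'"
  shows "nWeb_eq Zq_ext n (Psi_T n D) (Psi_T n D')"
    and "unmarked D \<Longrightarrow> nWeb_eq Zq n (Psi_T n D) (Psi_T n D')"
proof -
  have "admissible n D \<and> admissible n D' \<and> (\<exists>c. ev D = c \<cdot> ev D' \<and> mark_scalar n D * Rep_zq c = mark_scalar n D')"
    using assms
  proof
    assume "isotopic n D D'"
    then show ?thesis using isotopic_boundary ev_isotopic mark_scalar_isotopic
      by (metis mult.right_neutral one_zq.rep_eq smult_1)
  qed (use move_sound in blast)
  then obtain c where adm: "admissible n D" "admissible n D'" and c: "ev D = c \<cdot> ev D'"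
    "mark_scalar n D * Rep_zq c = mark_scalar n D'" by auto
  obtain x where x: "x \<in> free_webs n" "Psi_T n D = scale (mark_scalar n D) x" "cls n x = ev D"
    using resolve_eq[OF adm(1)] by (auto simp: Psi_T_def)
  obtain y where y: "y \<in> free_webs n" "Psi_T n D' = scale (mark_scalar n D') y" "cls n y = ev D'"
    using resolve_eq[OF adm(2)] by (auto simp: Psi_T_def)
  have "cls n x = cls n (scale (Rep_zq c) y)" by (simp add: x(3) c(1) y(3) cls_scale_Rep[OF y(1)])
  then have null: "x - scale (Rep_zq c) y \<in> nulls n"
    using x(1) y(1) Rep_zq by (simp add: cls_eq_iff free_webs_scale)
  \<comment> \<open>All that lies outside \<open>Zq\<close> is one common factor, which is 1 in the
    unmarked case.\<close>
  have diff: "Psi_T n D - Psi_T n D' = scale (mark_scalar n D) (x - scale (Rep_zq c) y)"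
    by (simp add: x(2) y(2) scale_diff c(2))
  show "nWeb_eq Zq_ext n (Psi_T n D) (Psi_T n D')"
    unfolding nWeb_eq_def diff
    by (intro null_webs.scale Zq_ext_mark_scalar null_webs_mono[OF null Zq_subset_Zq_ext])
  show "nWeb_eq Zq n (Psi_T n D) (Psi_T n D')" if "unmarked D"
    unfolding nWeb_eq_def diff using null by (simp add: mark_scalar_unmarked[OF that])
qed

end

theorem theorem2p8:
  fixes n :: nat
  assumes "n \<ge> 1"
  shows "kauffman_bracket n (Psi_T n)"
  unfolding kauffman_bracket_def
  using webs.Psi_T_invariant[of n] ladder_crossing_lin_webs[of _ _ n]
  by (intro conjI exI[of _ "ladder_crossing n"]) (auto simp: Psi_T_def)

end
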